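(* Let $R$ be essentially of finite type over an $F$-finite field of characteristic $p>0$, let $(M,\kappa)$ be a Cartier module over $R$, let $f\in R$, and let $\lambda>0$ be an $F$-jumping number of the test module filtration of $M$ along $f$. Let $e\ge 1$ and let $a$ be an integer with $a\ge\lceil\lambda(p^e-1)\rceil$. Then the Cartier structure on $Gr^\lambda M$ defined by $\kappa^e f^a$ is not nilpotent if and only if $a=\lambda(p^e-1)$ (and this quantity is an integer). In particular, if the denominator of $\lambda$ is divisible by $p$, then all these Cartier structures are nilpotent.
   Context: All rings are commutative Noetherian of prime characteristic $p$; $F$ is the Frobenius, and $F^e_*M$ is $M$ with $R$ acting through $p^e$-th powers. $R$ is $F$-finite if $F_*R$ is a finitely generated $R$-module. A Cartier module $(M,\kappa)$ is a finitely generated $R$-module $M$ with an $R$-linear map $\kappa\colon F_*M\to M$; $\kappa^e\colon F^e_*M\to M$ is its iterate, and for $g\in R$, $\kappa^e g$ denotes $m\mapsto\kappa^e(gm)$. A Cartier algebra is an $\mathbb N$-graded ring $\mathcal C=\bigoplus_{e\ge0}\mathcal C_e$ with $\mathcal C_0=R$ and $r\varphi=\varphi r^{p^e}$ for $\varphi\in\mathcal C_e$, $r\in R$; $\mathcal C_+=\bigoplus_{e\ge1}\mathcal C_e$. A $\mathcal C$-module is a left $\mathcal C$-module finitely generated over $R$; it is nilpotent if $\mathcal C_+^aM=0$ for some $a$; a morphism is a nil-isomorphism if its kernel and cokernel are nilpotent. Test modules: for $f\in R$ and rational $\lambda\ge0$ let $\mathcal C$ be the Cartier algebra with $\mathcal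 C_0=R$, $\mathcal C_e=\kappa^ef^{\lceil\lambda p^e\rceil}R$ ($e\ge1$), acting on $M$. $\tau(M,f^\lambda)$ is the smallest $\mathcal C$-submodule $N\subseteq M$ such that $H^0_\eta(N)_\eta\subseteq H^0_\eta(M)_\eta$ is a nil-isomorphism for every associated prime $\eta$ of the $R$-module $M$ ($H^0_\eta$ = elements killed by a power of $\eta$; the outer subscript is localization). If $R$ is essentially of finite type over an $F$-finite field, $\tau(M,f^\lambda)$ exists for all $\lambda$ and is a non-increasing, right-continuous, discrete filtration. A number $\lambda>0$ is an $F$-jumping number if $\tau(M,f^\lambda)\ne\tau(M,f^{\lambda-\varepsilon})$ for all $0<\varepsilon\le\lambda$. $Gr^\lambda M=\tau(M,f^{\lambda-\varepsilon})/\tau(M,f^\lambda)$ for $0<\varepsilon\ll1$. For $a\ge\lceil\lambda(p^e-1)\rceil$ the map $\kappa^ef^a$ induces an $R$-linear map $F^e_*Gr^\lambda M\to Gr^\lambda M$ (a Cartier structure); it is nilpotent if some power (iterate) of it is zero. Denominators of rational numbers are taken in lowest terms. *)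

theory Defs
  imports Complex_Main
begin

section \<open>Algebras essentially of finite type over an F-finite field\<close>

definition ring_hom_on_type :: "('a::comm_ring_1 \<Rightarrow> 'b::comm_ring_1) \<Rightarrow> bool" where
  "ring_hom_on_type h \<longleftrightarrow>
     h 1 = 1 \<and> (\<forall>x y. h (x + y) = h x + h y) \<and> (\<forall>x y. h (x * y) = h x * h y)"

text \<open>The subalgebra generated by \<open>X\<close>, the algebra structure being given by a ring
  homomorphism \<open>h\<close>.\<close>
inductive_set generated_subalgebra :: "('k::comm_ring_1 \<Rightarrow> 'a::comm_ring_1) \<Rightarrow> 'a set \<Rightarrow> 'a set"
  for h :: "'k::comm_ring_1 \<Rightarrow> 'a::comm_ring_1" and X :: "'a set" where
  scalar: "h c \<in> generated_subalgebra h X"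
| gen: "x \<in> X \<Longrightarrow> x \<in> generated_subalgebra h X"
| add: "x \<in> generated_subalgebra h X \<Longrightarrow> y \<in> generated_subalgebra h X \<Longrightarrow>
    x + y \<in> generated_subalgebra h X"
| mult: "x \<in> generated_subalgebra h X \<Longrightarrow> y \<in> generated_subalgebra h X \<Longrightarrow>
    x * y \<in> generated_subalgebra h X"

definition finite_type_algebra :: "('k::comm_ring_1 \<Rightarrow> 'a::comm_ring_1) \<Rightarrow> bool" where
  "finite_type_algebra h \<longleftrightarrow>
     ring_hom_on_type h \<and> (\<exists>X. finite X \<and> generated_subalgebra h X = UNIV)"

definition multiplicative_set :: "'a::comm_ring_1 set \<Rightarrow> bool" where
  "multiplicative_set S \<longleftrightarrow> 1 \<in> S \<and> (\<forall>s\<in>S. \<forall>t\<in>S. s * t \<in> S)"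

text \<open>The ring \<open>'r\<close> is the localization of \<open>'a\<close> at the multiplicative set \<open>S\<close>, with
  \<open>l\<close> as the canonical map.\<close>
definition is_localization ::
    "'a::comm_ring_1 set \<Rightarrow> ('a \<Rightarrow> 'r::comm_ring_1) \<Rightarrow> bool" where
  "is_localization S l \<longleftrightarrow>
     multiplicative_set S \<and> ring_hom_on_type l \<and>
     (\<forall>s\<in>S. l s dvd 1) \<and>
     (\<forall>r. \<exists>a. \<exists>s\<in>S. r * l s = l a) \<and>
     (\<forall>a b. l a = l b \<longrightarrow> (\<exists>s\<in>S. s * a = s * b))"

text \<open>The scalar multiplication of \<open>F\<^sup>e\<^sub>* M\<close>: the same abelian group, with \<open>r\<close> acting as
  its \<open>p ^ e\<close>-th power.\<close>
definition frob_scale ::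
    "nat \<Rightarrow> nat \<Rightarrow> ('r::comm_ring_1 \<Rightarrow> 'm::ab_group_add \<Rightarrow> 'm) \<Rightarrow> 'r \<Rightarrow> 'm \<Rightarrow> 'm" where
  "frob_scale p e scale = (\<lambda>r m. scale (r ^ (p ^ e)) m)"

definition fin_gen_module :: "('r::comm_ring_1 \<Rightarrow> 'm::ab_group_add \<Rightarrow> 'm) \<Rightarrow> bool" where
  "fin_gen_module scale \<longleftrightarrow> module scale \<and> (\<exists>B. finite B \<and> module.span scale B = UNIV)"

definition F_finite :: "'r::comm_ring_1 itself \<Rightarrow> bool" where
  "F_finite _ \<longleftrightarrow> fin_gen_module (frob_scale CHAR('r) 1 ((*) :: 'r \<Rightarrow> 'r \<Rightarrow> 'r))"

section \<open>Cartier modules and the Cartier algebra of a pair\<close>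

definition cartier_module ::
    "nat \<Rightarrow> ('r::comm_ring_1 \<Rightarrow> 'm::ab_group_add \<Rightarrow> 'm) \<Rightarrow> ('m \<Rightarrow> 'm) \<Rightarrow> bool" where
  "cartier_module p scale \<kappa> \<longleftrightarrow>
     fin_gen_module scale \<and> module_hom (frob_scale p 1 scale) scale \<kappa>"

text \<open>The homogeneous parts of the Cartier algebra attached to \<open>f\<close> and the exponent \<open>c\<close>,
  as sets of operators on \<open>M\<close>.\<close>
definition cartier_alg ::
    "nat \<Rightarrow> ('r::comm_ring_1 \<Rightarrow> 'm::ab_group_add \<Rightarrow> 'm) \<Rightarrow> ('m \<Rightarrow> 'm) \<Rightarrow> 'r \<Rightarrow> rat
      \<Rightarrow> nat \<Rightarrow> ('m \<Rightarrow> 'm) set" where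
  "cartier_alg p scale \<kappa> f c e =
     (if e = 0 then range scale
      else range (\<lambda>r m. (\<kappa> ^^ e) (scale (f ^ nat \<lceil>c * of_nat (p ^ e)\<rceil> * r) m)))"

definition cartier_submodule ::
    "('r::comm_ring_1 \<Rightarrow> 'm::ab_group_add \<Rightarrow> 'm) \<Rightarrow> (nat \<Rightarrow> ('m \<Rightarrow> 'm) set) \<Rightarrow> 'm set \<Rightarrow> bool" where
  "cartier_submodule scale C N \<longleftrightarrow>
     module.subspace scale N \<and> (\<forall>e. \<forall>\<phi>\<in>C e. \<phi> ` N \<subseteq> N)"

section \<open>Quotients, nilpotence and nil-isomorphisms\<close>

text \<open>In this section \<open>d\<close> is the subtraction and \<open>z\<close> the zero of an ambient abelian group;
  they are parameters because the notions are applied both to \<open>M\<close> and to localizations of \<open>M\<close>,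
  which are not types.\<close>

definition quot :: "('x \<Rightarrow> 'x \<Rightarrow> 'x) \<Rightarrow> 'x set \<Rightarrow> 'x set \<Rightarrow> 'x set set" where
  "quot d A B = A // {(x, y). x \<in> A \<and> y \<in> A \<and> d x y \<in> B}"

text \<open>The map that \<open>\<phi>\<close> induces on cosets, for \<open>\<phi>\<close> mapping \<open>A\<close> to \<open>A\<close> and \<open>B\<close> to \<open>B\<close>.\<close>
definition quot_map ::
    "('x \<Rightarrow> 'x \<Rightarrow> 'x) \<Rightarrow> 'x set \<Rightarrow> 'x set \<Rightarrow> ('x \<Rightarrow> 'x) \<Rightarrow> 'x set \<Rightarrow> 'x set" where
  "quot_map d A B \<phi> X = {y \<in> A. \<exists>x\<in>X. d y (\<phi> x) \<in> B}"

text \<open>Products of \<open>a\<close> homogeneous elements of positive degree. They generate the \<open>a\<close>-th power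
  of the ideal \<open>C\<^sub>+\<close> additively, so they annihilate a module iff that power does.\<close>
fun positive_products :: "(nat \<Rightarrow> ('x \<Rightarrow> 'x) set) \<Rightarrow> nat \<Rightarrow> ('x \<Rightarrow> 'x) set" where
  "positive_products C 0 = {id}"
| "positive_products C (Suc a) =
     {\<phi> \<circ> \<psi> |\<phi> \<psi>. (\<exists>e\<ge>1. \<phi> \<in> C e) \<and> \<psi> \<in> positive_products C a}"

definition nilpotent_module :: "(nat \<Rightarrow> ('x \<Rightarrow> 'x) set) \<Rightarrow> 'x set \<Rightarrow> 'x \<Rightarrow> bool" where
  "nilpotent_module C A z \<longleftrightarrow> (\<exists>a. \<forall>\<phi>\<in>positive_products C a. \<forall>x\<in>A. \<phi> x = z)"

text \<open>\<open>h\<close> is a morphism from \<open>A\<close> to \<open>B\<close>, which lie in the same ambient group; the zero of the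
  cokernel is the coset \<open>h ` A\<close>.\<close>
definition nil_isomorphism ::
    "('x \<Rightarrow> 'x \<Rightarrow> 'x) \<Rightarrow> 'x \<Rightarrow> (nat \<Rightarrow> ('x \<Rightarrow> 'x) set) \<Rightarrow> 'x set \<Rightarrow> 'x set \<Rightarrow> ('x \<Rightarrow> 'x) \<Rightarrow> bool"
  where
  "nil_isomorphism d z C A B h \<longleftrightarrow>
     nilpotent_module C {x \<in> A. h x = z} z \<and>
     nilpotent_module (\<lambda>e. quot_map d B (h ` A) ` C e) (quot d B (h ` A)) (h ` A)"

section \<open>Associated primes, local cohomology and localization at a prime\<close>

definition prime_ideal :: "'r::comm_ring_1 set \<Rightarrow> bool" where
  "prime_ideal I \<longleftrightarrow>
     module.subspace (*) I \<and> I \<noteq> UNIV \<and> (\<forall>x y. x * y \<in> I \<longrightarrow> x \<in> I \<or> y \<in> I)"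

definition associated_primes ::
    "('r::comm_ring_1 \<Rightarrow> 'm::ab_group_add \<Rightarrow> 'm) \<Rightarrow> 'r set set" where
  "associated_primes scale = {\<eta>. prime_ideal \<eta> \<and> (\<exists>m. \<eta> = {r. scale r m = 0})}"

fun ideal_power :: "'r::comm_ring_1 set \<Rightarrow> nat \<Rightarrow> 'r set" where
  "ideal_power I 0 = UNIV"
| "ideal_power I (Suc n) = module.span (*) {x * y |x y. x \<in> I \<and> y \<in> ideal_power I n}"

definition H0 ::
    "('r::comm_ring_1 \<Rightarrow> 'm::ab_group_add \<Rightarrow> 'm) \<Rightarrow> 'r set \<Rightarrow> 'm set \<Rightarrow> 'm set" where
  "H0 scale \<eta> N = {m \<in> N. \<exists>n. \<forall>x\<in>ideal_power \<eta> n. scale x m = 0}"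

text \<open>The fraction \<open>m / s\<close> in the localization of \<open>M\<close> at \<open>\<eta>\<close>, as an equivalence class of
  pairs.\<close>
definition loc_frac ::
    "('r::comm_ring_1 \<Rightarrow> 'm::ab_group_add \<Rightarrow> 'm) \<Rightarrow> 'r set \<Rightarrow> 'm \<Rightarrow> 'r \<Rightarrow> ('m \<times> 'r) set" where
  "loc_frac scale \<eta> m s =
     {(n, t). t \<notin> \<eta> \<and> (\<exists>u. u \<notin> \<eta> \<and> scale (u * t) m = scale (u * s) n)}"

text \<open>Localization being exact, the localization of a submodule \<open>N\<close> is identified with its
  image in the localization of \<open>M\<close>.\<close>
definition loc_module ::
    "('r::comm_ring_1 \<Rightarrow> 'm::ab_group_add \<Rightarrow> 'm) \<Rightarrow> 'r set \<Rightarrow> 'm set \<Rightarrow> ('m \<times> 'r) set set" where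
  "loc_module scale \<eta> N = {loc_frac scale \<eta> m s |m s. m \<in> N \<and> s \<notin> \<eta>}"

definition loc_minus ::
    "('r::comm_ring_1 \<Rightarrow> 'm::ab_group_add \<Rightarrow> 'm) \<Rightarrow> 'r set
      \<Rightarrow> ('m \<times> 'r) set \<Rightarrow> ('m \<times> 'r) set \<Rightarrow> ('m \<times> 'r) set" where
  "loc_minus scale \<eta> X Y =
     (\<Union>(m, s)\<in>X. \<Union>(n, t)\<in>Y. loc_frac scale \<eta> (scale t m - scale s n) (s * t))"

definition loc_scale ::
    "('r::comm_ring_1 \<Rightarrow> 'm::ab_group_add \<Rightarrow> 'm) \<Rightarrow> 'r set \<Rightarrow> 'r \<Rightarrow> 'r
      \<Rightarrow> ('m \<times> 'r) set \<Rightarrow> ('m \<times> 'r) set" where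
  "loc_scale scale \<eta> r t X = (\<Union>(m, s)\<in>X. loc_frac scale \<eta> (scale r m) (t * s))"

text \<open>A homogeneous \<open>\<phi>\<close> of degree \<open>e\<close> acts on fractions by
  \<open>m / s = s\<^sup>q\<^sup>-\<^sup>1 m / s\<^sup>q \<mapsto> \<phi> (s\<^sup>q\<^sup>-\<^sup>1 m) / s\<close>, where \<open>q = p ^ e\<close>.\<close>
definition loc_map ::
    "('r::comm_ring_1 \<Rightarrow> 'm::ab_group_add \<Rightarrow> 'm) \<Rightarrow> 'r set \<Rightarrow> nat \<Rightarrow> ('m \<Rightarrow> 'm)
      \<Rightarrow> ('m \<times> 'r) set \<Rightarrow> ('m \<times> 'r) set" where
  "loc_map scale \<eta> q \<phi> X = (\<Union>(m, s)\<in>X. loc_frac scale \<eta> (\<phi> (scale (s ^ (q - 1)) m)) s)"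

text \<open>The localized Cartier algebra, whose part of degree \<open>e\<close> consists of the \<open>\<phi> \<cdot> (r / t)\<close>
  with \<open>\<phi>\<close> in \<open>C e\<close>; its part of degree \<open>0\<close> is the localization of \<open>R\<close>.\<close>
definition loc_alg ::
    "nat \<Rightarrow> ('r::comm_ring_1 \<Rightarrow> 'm::ab_group_add \<Rightarrow> 'm) \<Rightarrow> 'r set \<Rightarrow> (nat \<Rightarrow> ('m \<Rightarrow> 'm) set)
      \<Rightarrow> nat \<Rightarrow> (('m \<times> 'r) set \<Rightarrow> ('m \<times> 'r) set) set" where
  "loc_alg p scale \<eta> C e =
     {loc_map scale \<eta> (p ^ e) \<phi> \<circ> loc_scale scale \<eta> r t |\<phi> r t. \<phi> \<in> C e \<and> t \<notin> \<eta>}"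

section \<open>Test modules, jumping numbers and the associated graded\<close>

definition test_condition ::
    "nat \<Rightarrow> ('r::comm_ring_1 \<Rightarrow> 'm::ab_group_add \<Rightarrow> 'm) \<Rightarrow> (nat \<Rightarrow> ('m \<Rightarrow> 'm) set) \<Rightarrow> 'm set \<Rightarrow> bool"
  where
  "test_condition p scale C N \<longleftrightarrow>
     cartier_submodule scale C N \<and>
     (\<forall>\<eta>\<in>associated_primes scale.
        nil_isomorphism (loc_minus scale \<eta>) (loc_frac scale \<eta> 0 1) (loc_alg p scale \<eta> C)
          (loc_module scale \<eta> (H0 scale \<eta> N)) (loc_module scale \<eta> (H0 scale \<eta> UNIV)) id)"

definition test_module ::
    "nat \<Rightarrow> ('r::comm_ring_1 \<Rightarrow> 'm::ab_group_add \<Rightarrow> 'm) \<Rightarrow> ('m \<Rightarrow> 'm) \<Rightarrow> 'r \<Rightarrow> rat \<Rightarrow> 'm set" where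
  "test_module p scale \<kappa> f c =
     (LEAST N. test_condition p scale (cartier_alg p scale \<kappa> f c) N)"

definition F_jumping_number ::
    "nat \<Rightarrow> ('r::comm_ring_1 \<Rightarrow> 'm::ab_group_add \<Rightarrow> 'm) \<Rightarrow> ('m \<Rightarrow> 'm) \<Rightarrow> 'r \<Rightarrow> rat \<Rightarrow> bool" where
  "F_jumping_number p scale \<kappa> f c \<longleftrightarrow>
     c > 0 \<and>
     (\<forall>\<epsilon>. 0 < \<epsilon> \<and> \<epsilon> \<le> c \<longrightarrow> test_module p scale \<kappa> f c \<noteq> test_module p scale \<kappa> f (c - \<epsilon>))"

text \<open>The common value of \<open>test_module p scale \<kappa> f (c - \<epsilon>)\<close> for all sufficiently small
  positive \<open>\<epsilon>\<close>.\<close>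
definition test_module_left ::
    "nat \<Rightarrow> ('r::comm_ring_1 \<Rightarrow> 'm::ab_group_add \<Rightarrow> 'm) \<Rightarrow> ('m \<Rightarrow> 'm) \<Rightarrow> 'r \<Rightarrow> rat \<Rightarrow> 'm set" where
  "test_module_left p scale \<kappa> f c =
     (THE N. \<exists>\<delta>. 0 < \<delta> \<and> \<delta> \<le> c \<and>
        (\<forall>\<epsilon>. 0 < \<epsilon> \<and> \<epsilon> < \<delta> \<longrightarrow> test_module p scale \<kappa> f (c - \<epsilon>) = N))"

definition Gr ::
    "nat \<Rightarrow> ('r::comm_ring_1 \<Rightarrow> 'm::ab_group_add \<Rightarrow> 'm) \<Rightarrow> ('m \<Rightarrow> 'm) \<Rightarrow> 'r \<Rightarrow> rat \<Rightarrow> 'm set set" where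
  "Gr p scale \<kappa> f c =
     quot (-) (test_module_left p scale \<kappa> f c) (test_module p scale \<kappa> f c)"

text \<open>The map on \<open>Gr\<close> induced by \<open>m \<mapsto> \<kappa>\<^sup>e (f\<^sup>a m)\<close>.\<close>
definition Gr_map ::
    "nat \<Rightarrow> ('r::comm_ring_1 \<Rightarrow> 'm::ab_group_add \<Rightarrow> 'm) \<Rightarrow> ('m \<Rightarrow> 'm) \<Rightarrow> 'r \<Rightarrow> rat \<Rightarrow> nat \<Rightarrow> nat
      \<Rightarrow> 'm set \<Rightarrow> 'm set" where
  "Gr_map p scale \<kappa> f c e a =
     quot_map (-) (test_module_left p scale \<kappa> f c) (test_module p scale \<kappa> f c)
       (\<lambda>m. (\<kappa> ^^ e) (scale (f ^ a) m))"

text \<open>Some iterate is zero; the zero of \<open>Gr\<close> is the coset \<open>test_module p scale \<kappa> f c\<close>.\<close>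
definition Gr_nilpotent ::
    "nat \<Rightarrow> ('r::comm_ring_1 \<Rightarrow> 'm::ab_group_add \<Rightarrow> 'm) \<Rightarrow> ('m \<Rightarrow> 'm) \<Rightarrow> 'r \<Rightarrow> rat \<Rightarrow> nat \<Rightarrow> nat
      \<Rightarrow> bool" where
  "Gr_nilpotent p scale \<kappa> f c e a \<longleftrightarrow>
     (\<exists>n. \<forall>X\<in>Gr p scale \<kappa> f c.
        (Gr_map p scale \<kappa> f c e a ^^ n) X = test_module p scale \<kappa> f c)"

end

theory Submission
  imports Defs "HOL-Library.FuncSet"
begin

text \<open>The two inclusions behind the theorem compare the test modules \<open>\<tau>(c) = \<tau>(M, f\<^sup>c)\<close> for
different exponents. For positive \<open>c, c'\<close> and \<open>q = p\<^sup>e\<close>,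
\<open>\<kappa>\<^sup>e f\<^sup>a \<tau>(c) \<subseteq> \<tau>(c')\<close> if \<open>q c' \<le> c + a\<close> (\<open>twist_tau_subset\<close>), and
\<open>\<tau>(c') \<subseteq> \<kappa>\<^sup>e f\<^sup>a \<tau>(c)\<close> if \<open>q c' = c + a\<close> (\<open>tau_subset_twist\<close>).
Put \<open>c = \<lambda> - \<epsilon>\<close> with \<open>\<epsilon>\<close> small. If \<open>a > \<lambda> (q - 1)\<close>, then \<open>q \<lambda> \<le> c + a\<close>, and
\<open>\<kappa>\<^sup>e f\<^sup>a\<close> is already zero on \<open>Gr\<^sup>\<lambda>\<close>. If \<open>a = \<lambda> (q - 1)\<close>, then an iterate of \<open>\<kappa>\<^sup>e f\<^sup>a\<close>
is again of the form \<open>\<kappa>\<^sup>E f\<^sup>b\<close> with \<open>b = \<lambda> (p\<^sup>E - 1)\<close>, and the second inclusion says that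
\<open>\<kappa>\<^sup>E f\<^sup>b\<close> maps \<open>\<tau>(\<lambda> - \<epsilon>)\<close> onto a module that contains \<open>\<tau>(\<lambda> - \<epsilon> / p\<^sup>E) = \<tau>(\<lambda> - \<epsilon>)\<close>;
were the iterate zero on \<open>Gr\<^sup>\<lambda>\<close>, the number \<open>\<lambda>\<close> would not be a jumping number.

Both inclusions come from minimality once the defining condition is made explicit. At an
associated prime \<open>\<eta>\<close> that contains \<open>f\<close>, a power of \<open>f\<close> kills \<open>H\<^sup>0\<^sub>\<eta>(M)\<close>, so for \<open>c > 0\<close>
everything there is nilpotent. At the other associated primes \<open>f\<close> becomes invertible, and the
condition says that some \<open>\<kappa>\<^sup>a H\<^sup>0\<^sub>\<eta>(M)\<close> lies in \<open>N\<^sub>\<eta>\<close>; this does not involve \<open>c\<close>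
(\<open>test_condition_iff\<close>). It is inherited by intersections and passes from \<open>N\<close> to every
module that contains some \<open>\<kappa>\<^sup>E f\<^sup>b N\<close> (\<open>kappa_dense_twist\<close>).

It remains to see that \<open>\<tau>(c)\<close> exists and is constant for \<open>c\<close> just below \<open>\<lambda>\<close>. Both follow
from a degree argument. After a common denominator has been chosen, \<open>M\<close> carries
finite-dimensional spaces \<open>M\<^sub>n\<close> of elements of degree at most \<open>n\<close>, and \<open>\<kappa>\<close> divides degrees by
\<open>p\<close> up to a constant (\<open>contraction\<close>). Hence, for a submodule \<open>N\<close>, for \<open>e\<close> large and
\<open>x \<le> b p\<^sup>e\<close>, the module \<open>\<kappa>\<^sup>e f\<^sup>x N\<close> is generated in a degree that depends on \<open>b\<close> only
(\<open>gauge_bound\<close>). Every candidate for \<open>\<tau>(c)\<close> with \<open>c \<le> b\<close> contains a candidate of the form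
\<open>\<Sum>\<^sub>e \<kappa>\<^sup>e f\<^sup>x N\<close>, \<open>x = \<lceil>c p\<^sup>e\<rceil>\<close>, the sum being over large \<open>e\<close>, and the latter is generated in that
degree. So the candidates are governed by subspaces of one finite-dimensional space: a candidate
of least dimension there is the smallest one, and the decreasing family \<open>\<tau>(c)\<close>, \<open>c < \<lambda>\<close>, becomes
stationary.\<close>

section \<open>Hilbert's basis theorem for commuting operators\<close>

locale linear_operators = vector_space scale
  for scale :: "'a::field \<Rightarrow> 'b::ab_group_add \<Rightarrow> 'b"
begin

definition invariant :: "('b \<Rightarrow> 'b) set \<Rightarrow> 'b set \<Rightarrow> bool" where
  "invariant T J \<longleftrightarrow> subspace J \<and> (\<forall>t\<in>T. t ` J \<subseteq> J)"

lemma invariant_hull: "invariant T (invariant T hull W)"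
  by (rule hull_in) (auto simp: invariant_def image_subset_iff intro!: subspace_Inter)

lemma subspace_span_finite:
  assumes "finite B" "subspace J" "J \<subseteq> span B"
  shows "\<exists>W. finite W \<and> W \<subseteq> J \<and> J \<subseteq> span W"
proof -
  obtain W where W: "W \<subseteq> J" "independent W" "J \<subseteq> span W"
    using maximal_independent_subset[of J] by blast
  moreover have "finite W" using independent_span_bound[OF assms(1) W(2)] W(1) assms(3) by blast
  ultimately show ?thesis by blast
qed

lemma subspace_eq_if_dim_le:
  assumes B: "finite B" "W \<subseteq> span B" and V: "subspace V" "V \<subseteq> W" and d: "dim W \<le> dim V"
  shows "V = W"
proof (rule ccontr)
  assume "V \<noteq> W"
  then obtain w where w: "w \<in> W" "w \<notin> V" using V by blast
  obtain U where U: "U \<subseteq> V" "independent U" "V \<subseteq> span U" "card U = dim V"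
    using basis_exists[of V] by blast
  have "span U = V" using U V(1) by (metis span_minimal subset_antisym)
  then have ind: "independent (insert w U)" using w U(2) by (simp add: independent_insertI)
  obtain U' where U': "insert w U \<subseteq> U'" "U' \<subseteq> W" "independent U'" "W \<subseteq> span U'"
    using maximal_independent_subset_extend[of "insert w U" W] ind w U(1) V(2) by blast
  have fin: "finite U'" using independent_span_bound[OF B(1) U'(3)] U'(2) B(2) by blast
  have W: "dim W = card U'" using basis_card_eq_dim[OF U'(2,4,3)] by simp
  have "w \<notin> U" using w U(1) by blast
  moreover have "finite U" by (rule finite_subset[OF _ fin]) (use U'(1) in simp)
  ultimately have "card (insert w U) = Suc (card U)" by (rule card_insert_disjoint[rotated])
  moreover have "card (insert w U) \<le> card U'" by (rule card_mono[OF fin U'(1)])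
  ultimately show False using d U(4) W by linarith
qed

text \<open>The polynomials of degree less than \<open>n\<close> in the operator \<open>x\<close>, with coefficients in \<open>E\<close> written
to the right of the powers of \<open>x\<close>.\<close>
primrec op_layers :: "('b \<Rightarrow> 'b) \<Rightarrow> 'b set \<Rightarrow> nat \<Rightarrow> 'b set" where
  "op_layers x E 0 = {0}"
| "op_layers x E (Suc n) = {(x ^^ n) e + g |e g. e \<in> E \<and> g \<in> op_layers x E n}"

lemma op_layersI:
  "e \<in> E \<Longrightarrow> g \<in> op_layers x E n \<Longrightarrow> v = (x ^^ n) e + g \<Longrightarrow> v \<in> op_layers x E (Suc n)"
  by auto

lemma funpow_commute:
  assumes "\<And>v. x (t v) = t (x v)"
  shows "(x ^^ n) (t v) = t ((x ^^ n) v)"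
  by (induction n) (auto simp: assms)

lemma funpow_hom:
  assumes "module_hom scale scale x"
  shows "module_hom scale scale (x ^^ n)"
proof -
  interpret x: module_hom scale scale x by fact
  show ?thesis
    by (unfold_locales) (induction n; simp add: x.add x.scale)+
qed

lemma op_layers_invariant:
  assumes x: "module_hom scale scale x" and lin: "\<And>t. t \<in> T \<Longrightarrow> module_hom scale scale t"
    and comm: "\<And>t v. t \<in> T \<Longrightarrow> x (t v) = t (x v)" and E: "invariant T E"
  shows "invariant T (op_layers x E n)"
proof (induction n)
  case 0
  have "t 0 = 0" if "t \<in> T" for t using module_hom.zero[OF lin[OF that]] .
  then show ?case by (auto simp: invariant_def subspace_def)
next
  case (Suc n)
  interpret xn: module_hom scale scale "x ^^ n" by (rule funpow_hom[OF x])
  have sE: "subspace E" and sF: "subspace (op_layers x E n)"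
    using E Suc by (auto simp: invariant_def)
  have "subspace (op_layers x E (Suc n))"
  proof (rule subspaceI)
    show "0 \<in> op_layers x E (Suc n)"
      using subspace_0[OF sE] subspace_0[OF sF] xn.zero
      by (auto intro!: exI[of _ 0])
  next
    fix u v assume "u \<in> op_layers x E (Suc n)" "v \<in> op_layers x E (Suc n)"
    then obtain a b c d where ab: "u = (x ^^ n) a + b" "v = (x ^^ n) c + d"
      "a \<in> E" "c \<in> E" "b \<in> op_layers x E n" "d \<in> op_layers x E n" by auto
    show "u + v \<in> op_layers x E (Suc n)"
      by (rule op_layersI[OF subspace_add[OF sE ab(3,4)] subspace_add[OF sF ab(5,6)]])
         (simp add: ab(1,2) xn.add)
  next
    fix k u assume "u \<in> op_layers x E (Suc n)"
    then obtain a b where ab: "u = (x ^^ n) a + b" "a \<in> E" "b \<in> op_layers x E n" by auto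
    show "scale k u \<in> op_layers x E (Suc n)"
      by (rule op_layersI[OF subspace_scale[OF sE ab(2)] subspace_scale[OF sF ab(3)]])
         (simp add: ab(1) xn.scale scale_right_distrib)
  qed
  moreover have "t ` op_layers x E (Suc n) \<subseteq> op_layers x E (Suc n)" if t: "t \<in> T" for t
  proof
    fix u assume "u \<in> t ` op_layers x E (Suc n)"
    then obtain a b where u: "u = t ((x ^^ n) a + b)" "a \<in> E" "b \<in> op_layers x E n" by auto
    have "u = (x ^^ n) (t a) + t b"
      by (simp add: u(1) module_hom.add[OF lin[OF t]] funpow_commute[of x t, OF comm[OF t]])
    moreover have "t a \<in> E" "t b \<in> op_layers x E n"
      using E Suc t u(2,3) unfolding invariant_def by blast+
    ultimately show "u \<in> op_layers x E (Suc n)" by auto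
  qed
  ultimately show ?case by (simp add: invariant_def)
qed

lemma op_layers_step:
  assumes x: "module_hom scale scale x" and E: "subspace E" 
    and v: "v \<in> op_layers x E n"
  shows "x v \<in> op_layers x E (Suc n)"
  using v
proof (induction n arbitrary: v)
  case 0
  then have "x v = (x ^^ 0) 0 + 0" using module_hom.zero[OF x] by simp
  then show ?case using subspace_0[OF E] by auto
next
  case (Suc n)
  then obtain e g where eg: "v = (x ^^ n) e + g" "e \<in> E" "g \<in> op_layers x E n" by auto
  have "x v = (x ^^ Suc n) e + x g" by (simp add: eg(1) module_hom.add[OF x])
  then show ?case using Suc.IH[OF eg(3)] eg(2) op_layers.simps(2)[of x E "Suc n"] by blast
qed

lemma op_layers_steps:
  assumes x: "module_hom scale scale x" and E: "subspace E" 
    and v: "v \<in> op_layers x E n"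
  shows "(x ^^ k) v \<in> op_layers x E (n + k)"
proof (induction k)
  case (Suc k)
  then show ?case using op_layers_step[OF x E Suc] by simp
qed (simp add: v)

lemma op_layers_mono:
  assumes x: "module_hom scale scale x" and E: "subspace E" and "m \<le> n"
  shows "op_layers x E m \<subseteq> op_layers x E n"
proof (rule lift_Suc_mono_le[OF _ \<open>m \<le> n\<close>])
  fix k
  show "op_layers x E k \<subseteq> op_layers x E (Suc k)"
  proof
    fix v assume v: "v \<in> op_layers x E k"
    have "v = (x ^^ k) 0 + v" using module_hom.zero[OF funpow_hom[OF x]] by simp
    then show "v \<in> op_layers x E (Suc k)" unfolding op_layers.simps(2) using subspace_0[OF E] v by blast
  qed
qed

lemma invariant_hull_subset_op_layers:
  assumes x: "module_hom scale scale x" and lin: "\<And>t. t \<in> T \<Longrightarrow> module_hom scale scale t"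
    and comm: "\<And>t v. t \<in> T \<Longrightarrow> x (t v) = t (x v)" and E: "invariant T E"
  shows "invariant (insert x T) hull E \<subseteq> (\<Union>n. op_layers x E n)"
proof (rule hull_minimal)
  have sE: "subspace E" using E by (simp add: invariant_def)
  note mono = op_layers_mono[OF x sE]
  have inv: "subspace (op_layers x E n) \<and> (\<forall>t\<in>T. t ` op_layers x E n \<subseteq> op_layers x E n)" for n
    using op_layers_invariant[OF x lin comm E, of n] by (simp add: invariant_def)
  show "E \<subseteq> (\<Union>n. op_layers x E n)"
  proof
    fix e assume "e \<in> E"
    then have "e \<in> op_layers x E (Suc 0)" by auto
    then show "e \<in> (\<Union>n. op_layers x E n)" by blast
  qed
  have "subspace (\<Union>n. op_layers x E n)"
  proof (rule subspaceI)
    show "0 \<in> (\<Union>n. op_layers x E n)" by (auto intro: exI[of _ 0])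
  next
    fix u v assume "u \<in> (\<Union>n. op_layers x E n)" "v \<in> (\<Union>n. op_layers x E n)"
    then obtain i j where "u \<in> op_layers x E i" "v \<in> op_layers x E j" by auto
    then have "u \<in> op_layers x E (max i j)" "v \<in> op_layers x E (max i j)"
      using mono[of i "max i j"] mono[of j "max i j"] by auto
    then have "u + v \<in> op_layers x E (max i j)" by (rule subspace_add[OF conjunct1[OF inv]])
    then show "u + v \<in> (\<Union>n. op_layers x E n)" by blast
  next
    fix k u assume "u \<in> (\<Union>n. op_layers x E n)"
    then obtain i where "u \<in> op_layers x E i" by auto
    then have "scale k u \<in> op_layers x E i" by (rule subspace_scale[OF conjunct1[OF inv]])
    then show "scale k u \<in> (\<Union>n. op_layers x E n)" by blast
  qed
  moreover have "t ` (\<Union>n. op_layers x E n) \<subseteq> (\<Union>n. op_layers x E n)" if "t \<in> T" for t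
    using inv that by blast
  moreover have "x ` (\<Union>n. op_layers x E n) \<subseteq> (\<Union>n. op_layers x E n)"
    using op_layers_step[OF x sE] by blast
  ultimately show "invariant (insert x T) (\<Union>n. op_layers x E n)"
    by (auto simp: invariant_def)
qed

text \<open>Hilbert's argument with leading coefficients, for vectors instead of polynomials. The set \<open>L n\<close>
of leading coefficients in degree \<open>n\<close> of elements of \<open>J\<close> grows with \<open>n\<close>, because \<open>J\<close> is stable
under \<open>x\<close>, and becomes constant at some \<open>n0\<close>. Elements of \<open>J\<close> that realise generators of
\<open>L 0, \<dots>, L n0\<close> generate \<open>J\<close>, by induction on the degree. A vector may have several
representations as a polynomial in \<open>x\<close>, so a leading coefficient is a relation between elements
and coefficients rather than a function.\<close>
lemma hilbert_basis_step:
  assumes x: "module_hom scale scale x" and lin: "\<And>t. t \<in> T \<Longrightarrow> module_hom scale scale t"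
    and comm: "\<And>t v. t \<in> T \<Longrightarrow> x (t v) = t (x v)" and E: "invariant T E"
    and fg: "\<And>J. invariant T J \<Longrightarrow> J \<subseteq> E \<Longrightarrow>
               \<exists>W. finite W \<and> W \<subseteq> J \<and> J \<subseteq> invariant T hull W"
    and J: "invariant (insert x T) J" "J \<subseteq> invariant (insert x T) hull E"
  shows "\<exists>W. finite W \<and> W \<subseteq> J \<and> J \<subseteq> invariant (insert x T) hull W"
proof -
  define F where "F = op_layers x E"
  define L where "L n = {e \<in> E. \<exists>g\<in>J. g - (x ^^ n) e \<in> F n}" for n
  have sE: "subspace E" using E by (simp add: invariant_def)
  have sJ: "subspace J" and TJ: "\<And>t g. t \<in> T \<Longrightarrow> g \<in> J \<Longrightarrow> t g \<in> J" and xJ: "\<And>g. g \<in> J \<Longrightarrow> x g \<in> J"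
    using J(1) by (auto simp: invariant_def)
  have F: "subspace (F n)" "\<And>t g. t \<in> T \<Longrightarrow> g \<in> F n \<Longrightarrow> t g \<in> F n" for n
    using op_layers_invariant[OF x lin comm E, of n] by (auto simp: invariant_def F_def)
  have step: "g \<in> F n \<Longrightarrow> (x ^^ k) g \<in> F (n + k)" for g n k
    unfolding F_def by (rule op_layers_steps[OF x sE])
  have xn: "module_hom scale scale (x ^^ n)" for n by (rule funpow_hom[OF x])
  \<comment> \<open>Needed for \<open>J\<close> itself and for the part of \<open>J\<close> generated by the chosen lifts.\<close>
  have lead: "invariant T {e \<in> E. \<exists>g\<in>J'. g - (x ^^ n) e \<in> F n}"
    if J': "subspace J'" "\<And>t g. t \<in> T \<Longrightarrow> g \<in> J' \<Longrightarrow> t g \<in> J'" for J' n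
    unfolding invariant_def
  proof (intro conjI ballI subspaceI)
    show "0 \<in> {e \<in> E. \<exists>g\<in>J'. g - (x ^^ n) e \<in> F n}"
      using subspace_0[OF sE] subspace_0[OF J'(1)] subspace_0[OF F(1)[of n]] module_hom.zero[OF xn]
      by fastforce
  next
    fix u v assume "u \<in> {e \<in> E. \<exists>g\<in>J'. g - (x ^^ n) e \<in> F n}"
      "v \<in> {e \<in> E. \<exists>g\<in>J'. g - (x ^^ n) e \<in> F n}"
    then obtain g g' where g: "u \<in> E" "v \<in> E" "g \<in> J'" "g' \<in> J'"
      "g - (x ^^ n) u \<in> F n" "g' - (x ^^ n) v \<in> F n" by auto
    have "(g + g') - (x ^^ n) (u + v) = (g - (x ^^ n) u) + (g' - (x ^^ n) v)"
      by (simp add: module_hom.add[OF xn])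
    then have "(g + g') - (x ^^ n) (u + v) \<in> F n" using g subspace_add[OF F(1)] by metis
    then show "u + v \<in> {e \<in> E. \<exists>g\<in>J'. g - (x ^^ n) e \<in> F n}"
      using g subspace_add[OF J'(1)] subspace_add[OF sE] by blast
  next
    fix k u assume "u \<in> {e \<in> E. \<exists>g\<in>J'. g - (x ^^ n) e \<in> F n}"
    then obtain g where g: "u \<in> E" "g \<in> J'" "g - (x ^^ n) u \<in> F n" by auto
    have "scale k g - (x ^^ n) (scale k u) = scale k (g - (x ^^ n) u)"
      by (simp add: module_hom.scale[OF xn] scale_right_diff_distrib)
    then have "scale k g - (x ^^ n) (scale k u) \<in> F n" using g subspace_scale[OF F(1)] by metis
    then show "scale k u \<in> {e \<in> E. \<exists>g\<in>J'. g - (x ^^ n) e \<in> F n}"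
      using g subspace_scale[OF J'(1)] subspace_scale[OF sE] by blast
  next
    fix t assume t: "t \<in> T"
    show "t ` {e \<in> E. \<exists>g\<in>J'. g - (x ^^ n) e \<in> F n} \<subseteq> {e \<in> E. \<exists>g\<in>J'. g - (x ^^ n) e \<in> F n}"
    proof
      fix v assume "v \<in> t ` {e \<in> E. \<exists>g\<in>J'. g - (x ^^ n) e \<in> F n}"
      then obtain u g where g: "v = t u" "u \<in> E" "g \<in> J'" "g - (x ^^ n) u \<in> F n" by auto
      have "t g - (x ^^ n) (t u) = t (g - (x ^^ n) u)"
        by (simp add: module_hom.diff[OF lin[OF t]] funpow_commute[of x t, OF comm[OF t]])
      then have "t g - (x ^^ n) (t u) \<in> F n" using F(2)[OF t g(4)] by simp
      moreover have "t u \<in> E" using E t g(2) by (auto simp: invariant_def)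
      ultimately show "v \<in> {e \<in> E. \<exists>g\<in>J'. g - (x ^^ n) e \<in> F n}"
        using J'(2)[OF t g(3)] g(1) by blast
    qed
  qed
  have Linv: "invariant T (L n)" for n unfolding L_def by (rule lead) (auto intro: sJ TJ)
  have LE: "L n \<subseteq> E" for n by (auto simp: L_def)
  have Lmono: "L m \<subseteq> L n" if "m \<le> n" for m n
  proof (rule lift_Suc_mono_le[OF _ that], rule subsetI)
    fix k e assume "e \<in> L k"
    then obtain g where g: "e \<in> E" "g \<in> J" "g - (x ^^ k) e \<in> F k" by (auto simp: L_def)
    have "x g - (x ^^ Suc k) e = x (g - (x ^^ k) e)" by (simp add: module_hom.diff[OF x])
    also have "\<dots> \<in> F (Suc k)" using step[OF g(3), of 1] by simp
    finally show "e \<in> L (Suc k)" unfolding L_def using g(1) xJ[OF g(2)] by blast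
  qed
  have "subspace (\<Union>n. L n)"
  proof (rule subspaceI)
    show "0 \<in> (\<Union>n. L n)" using Linv subspace_0 by (auto simp: invariant_def)
  next
    fix u v assume "u \<in> (\<Union>n. L n)" "v \<in> (\<Union>n. L n)"
    then obtain i j where "u \<in> L i" "v \<in> L j" by auto
    then have "u \<in> L (max i j)" "v \<in> L (max i j)"
      using Lmono[of i "max i j"] Lmono[of j "max i j"] by auto
    then show "u + v \<in> (\<Union>n. L n)"
      using Linv[of "max i j"] subspace_add by (auto simp: invariant_def)
  next
    fix k u assume "u \<in> (\<Union>n. L n)"
    then obtain i where "u \<in> L i" by auto
    then have "scale k u \<in> L i" using Linv[of i] subspace_scale by (auto simp: invariant_def)
    then show "scale k u \<in> (\<Union>n. L n)" by blast
  qed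
  then have "invariant T (\<Union>n. L n)" using Linv by (fastforce simp: invariant_def)
  from fg[OF this] LE obtain W where W: "finite W" "W \<subseteq> (\<Union>n. L n)" "(\<Union>n. L n) \<subseteq> invariant T hull W"
    by blast
  obtain n0 where n0: "W \<subseteq> L n0"
  proof -
    have "\<exists>n. W' \<subseteq> L n" if "finite W'" "W' \<subseteq> (\<Union>n. L n)" for W'
      using that
    proof (induction W')
      case (insert w W')
      then obtain i j where "W' \<subseteq> L i" "w \<in> L j" by auto
      then have "insert w W' \<subseteq> L (max i j)" using Lmono[of i "max i j"] Lmono[of j "max i j"] by auto
      then show ?case by blast
    qed auto
    from this[OF W(1,2)] show ?thesis using that by (elim exE)
  qed
  have Ln0: "L n \<subseteq> L n0" for n
    using hull_minimal[of W "L n0" "invariant T"] n0 Linv W(3) by blast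
  have "\<forall>n. \<exists>Wn. finite Wn \<and> Wn \<subseteq> L n \<and> L n \<subseteq> invariant T hull Wn"
    using fg[OF Linv LE] by blast
  then obtain Wn where Wn: "\<And>n. finite (Wn n)" "\<And>n. Wn n \<subseteq> L n" "\<And>n. L n \<subseteq> invariant T hull Wn n"
    by metis
  have "\<forall>n. \<forall>w\<in>Wn n. \<exists>g. g \<in> J \<and> g - (x ^^ n) w \<in> F n"
    using Wn(2) by (auto simp: L_def)
  then obtain lift where lift: "\<And>n w. w \<in> Wn n \<Longrightarrow> lift n w \<in> J \<and> lift n w - (x ^^ n) w \<in> F n"
    by metis
  define G where "G = (\<Union>n\<in>{..n0}. lift n ` Wn n)"
  define J' where "J' = invariant (insert x T) hull G"
  have G: "finite G" "G \<subseteq> J" using Wn(1) lift by (auto simp: G_def)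
  have J'inv: "invariant (insert x T) J'" unfolding J'_def by (rule invariant_hull)
  have sJ': "subspace J'" and TJ': "\<And>t g. t \<in> T \<Longrightarrow> g \<in> J' \<Longrightarrow> t g \<in> J'" 
    and xJ': "\<And>g. g \<in> J' \<Longrightarrow> x g \<in> J'"
    using J'inv by (auto simp: invariant_def)
  have xJ'n: "g \<in> J' \<Longrightarrow> (x ^^ k) g \<in> J'" for g k by (induction k) (auto simp: xJ')
  have J'J: "J' \<subseteq> J" unfolding J'_def by (rule hull_minimal) (use G(2) J(1) in auto)
  have real: "\<exists>g\<in>J'. g - (x ^^ n) e \<in> F n" if "e \<in> L n" "n \<le> n0" for n e
  proof -
    have "invariant T hull Wn n \<subseteq> {e \<in> E. \<exists>g\<in>J'. g - (x ^^ n) e \<in> F n}"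
    proof (rule hull_minimal)
      show "Wn n \<subseteq> {e \<in> E. \<exists>g\<in>J'. g - (x ^^ n) e \<in> F n}"
      proof
        fix w assume w: "w \<in> Wn n"
        then have "lift n w \<in> J'" using that(2) hull_subset[of G] by (auto simp: J'_def G_def)
        then show "w \<in> {e \<in> E. \<exists>g\<in>J'. g - (x ^^ n) e \<in> F n}"
          using lift[OF w] w Wn(2) LE by blast
      qed
      show "invariant T {e \<in> E. \<exists>g\<in>J'. g - (x ^^ n) e \<in> F n}"
        by (rule lead) (auto intro: sJ' TJ')
    qed
    then show ?thesis using that Wn(3) by blast
  qed
  have main: "g \<in> J \<Longrightarrow> g \<in> F n \<Longrightarrow> g \<in> J'" for g n
  proof (induction n arbitrary: g)
    case 0
    then show ?case using subspace_0[OF sJ'] by (simp add: F_def)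
  next
    case (Suc n)
    then obtain e r where er: "g = (x ^^ n) e + r" "e \<in> E" "r \<in> F n" by (auto simp: F_def)
    then have "e \<in> L n" using Suc.prems(1) by (auto simp: L_def intro!: bexI[of _ g])
    have "\<exists>g'\<in>J'. g' - (x ^^ n) e \<in> F n"
    proof (cases "n \<le> n0")
      case True
      then show ?thesis using real \<open>e \<in> L n\<close> by blast
    next
      case False
      obtain g' where g': "g' \<in> J'" "g' - (x ^^ n0) e \<in> F n0"
        using real[of e n0] Ln0[of n] \<open>e \<in> L n\<close> by auto
      have "(x ^^ (n - n0)) g' - (x ^^ n) e = (x ^^ (n - n0)) (g' - (x ^^ n0) e)"
        using False by (simp add: module_hom.diff[OF xn] flip: funpow_add o_apply[of "x ^^ (n - n0)"])
      also have "\<dots> \<in> F n" using step[OF g'(2), of "n - n0"] False by simp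
      finally show ?thesis using xJ'n[OF g'(1)] by blast
    qed
    then obtain g' where g': "g' \<in> J'" "g' - (x ^^ n) e \<in> F n" by blast
    have "g - g' = r - (g' - (x ^^ n) e)" using er(1) by simp
    also have "\<dots> \<in> F n" by (rule subspace_diff[OF F(1) er(3) g'(2)])
    finally have "g - g' \<in> F n" .
    moreover have "g - g' \<in> J" using subspace_diff[OF sJ Suc.prems(1)] g'(1) J'J by blast
    ultimately have "g - g' \<in> J'" by (intro Suc.IH)
    then show ?case using subspace_add[OF sJ' _ g'(1)] by fastforce
  qed
  have "J \<subseteq> J'"
  proof
    fix g assume g: "g \<in> J"
    then obtain n where "g \<in> F n"
      using J(2) invariant_hull_subset_op_layers[OF x lin comm E] by (auto simp: F_def)
    then show "g \<in> J'" using main g by blast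
  qed
  then show ?thesis using G unfolding J'_def by blast
qed

text \<open>With the generators of an algebra as the operators, this says that submodules of a finitely
generated module over a finitely generated commutative algebra are finitely generated.\<close>
theorem hilbert_basis_commuting_operators:
  assumes "finite T" and lin: "\<And>t. t \<in> T \<Longrightarrow> module_hom scale scale t"
    and comm: "\<And>s t v. s \<in> T \<Longrightarrow> t \<in> T \<Longrightarrow> s (t v) = t (s v)"
    and B: "finite B"
    and J: "invariant T J" "J \<subseteq> invariant T hull B"
  shows "\<exists>W. finite W \<and> W \<subseteq> J \<and> J \<subseteq> invariant T hull W"
  using assms(1) lin comm J
proof (induction T arbitrary: J)
  case empty
  have "invariant {} = subspace" by (auto simp: invariant_def fun_eq_iff)
  then show ?case using empty subspace_span_finite[OF B] by (simp add: span_def)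
next
  case (insert x T)
  have "invariant (insert x T) hull B \<subseteq> invariant (insert x T) hull (invariant T hull B)"
    by (intro hull_mono hull_subset)
  then have "J \<subseteq> invariant (insert x T) hull (invariant T hull B)" using insert.prems(4) by blast
  then show ?case
    by (intro hilbert_basis_step[OF _ _ _ invariant_hull[of T B] _ insert.prems(3)])
       (use insert.prems insert.IH in auto)
qed

end

section \<open>Powers of the Cartier map twisted by powers of f\<close>

locale cartier_pair = module scale
  for scale :: "'r::comm_ring_1 \<Rightarrow> 'm::ab_group_add \<Rightarrow> 'm" (infixr "*s" 75) +
  fixes p :: nat and \<kappa> :: "'m \<Rightarrow> 'm" and f :: 'r
  assumes p_ge_2: "p \<ge> 2"
    and \<kappa>_add: "\<kappa> (m + n) = \<kappa> m + \<kappa> n"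
    and \<kappa>_frob: "\<kappa> (r ^ p *s m) = r *s \<kappa> m"
begin

definition twist :: "nat \<Rightarrow> nat \<Rightarrow> 'm \<Rightarrow> 'm" where
  "twist e x m = (\<kappa> ^^ e) (f ^ x *s m)"

lemma \<kappa>_pow_add: "(\<kappa> ^^ e) (m + n) = (\<kappa> ^^ e) m + (\<kappa> ^^ e) n"
  by (induction e) (auto simp: \<kappa>_add)

lemma \<kappa>_pow_frob: "(\<kappa> ^^ e) (r ^ (p ^ e) *s m) = r *s (\<kappa> ^^ e) m"
proof (induction e arbitrary: r)
  case (Suc e)
  have "r ^ (p ^ Suc e) = (r ^ p) ^ (p ^ e)" by (simp add: power_mult)
  then show ?case using Suc[of "r ^ p"] by (simp add: \<kappa>_frob)
qed simp

lemma \<kappa>_pow_zero: "(\<kappa> ^^ e) 0 = 0"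
  using \<kappa>_pow_add[of e 0 0] by simp

lemma twist_add: "twist e x (m + n) = twist e x m + twist e x n"
  by (simp add: twist_def scale_right_distrib \<kappa>_pow_add)

lemma twist_zero: "twist e x 0 = 0"
  by (simp add: twist_def \<kappa>_pow_zero)

lemma twist_frob: "r *s twist e x m = twist e x (r ^ (p ^ e) *s m)"
  by (simp only: twist_def scale_left_commute[of "f ^ x"] \<kappa>_pow_frob)

lemma twist_twist: "twist e x (twist d y m) = twist (e + d) (x * p ^ d + y) m"
  by (simp add: twist_def funpow_add power_add power_mult \<kappa>_pow_frob flip: \<kappa>_pow_frob scale_scale)

lemma twist_absorb: "twist e (x + y) m = twist e x (f ^ y *s m)"
  by (simp add: twist_def power_add)

text \<open>For \<open>x = \<lambda> (q - 1)\<close>, \<open>q = p\<^sup>e\<close>, the new exponent is \<open>\<lambda> (q\<^sup>n - 1)\<close>: the critical exponents are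
closed under iteration.\<close>
lemma twist_funpow: "(twist e x ^^ n) m = twist (n * e) (\<Sum>i<n. x * p ^ (i * e)) m"
proof (induction n arbitrary: m)
  case 0
  then show ?case by (simp add: twist_def)
next
  case (Suc n)
  have "(twist e x ^^ Suc n) m = (twist e x ^^ n) (twist e x m)"
    by (simp only: funpow_Suc_right o_apply)
  also have "\<dots> = twist (n * e + e) ((\<Sum>i<n. x * p ^ (i * e)) * p ^ e + x) m"
    by (simp only: Suc twist_twist)
  also have "(\<Sum>i<n. x * p ^ (i * e)) * p ^ e + x = (\<Sum>i<Suc n. x * p ^ (i * e))"
    by (simp only: sum.lessThan_Suc_shift sum_distrib_right) (simp add: power_add algebra_simps)
  finally show ?case by (simp add: add.commute)
qed

lemma subspace_twist_image:
  assumes "subspace N"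
  shows "subspace (twist e x ` N)"
proof (rule subspaceI)
  show "0 \<in> twist e x ` N" using subspace_0[OF assms] twist_zero by (metis imageI)
qed (auto simp: twist_frob subspace_add[OF assms] subspace_scale[OF assms] simp flip: twist_add)

definition cexp :: "rat \<Rightarrow> nat \<Rightarrow> nat" where
  "cexp c e = nat \<lceil>c * of_nat (p ^ e)\<rceil>"

lemma cexp_le_iff: "cexp c e \<le> x \<longleftrightarrow> c * of_nat (p ^ e) \<le> of_nat x"
  unfolding cexp_def by linarith

lemma cexp_ge: "c * of_nat (p ^ e) \<le> of_nat (cexp c e)"
  using cexp_le_iff by blast

lemma cartier_alg_mem:
  assumes "e \<ge> 1" "\<phi> \<in> cartier_alg p scale \<kappa> f c e"
  obtains r where "\<phi> = (\<lambda>m. twist e (cexp c e) (r *s m))"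
  using assms by (auto simp: cartier_alg_def twist_def cexp_def)

lemma cartier_alg_memI:
  assumes "e \<ge> 1" "cexp c e \<le> x"
  shows "(\<lambda>m. twist e x (r *s m)) \<in> cartier_alg p scale \<kappa> f c e"
proof -
  have "(\<lambda>m. twist e x (r *s m)) = (\<lambda>m. (\<kappa> ^^ e) (scale (f ^ cexp c e * (f ^ (x - cexp c e) * r)) m))"
    using assms(2) by (simp add: twist_def flip: power_add mult.assoc)
  then show ?thesis using assms(1) by (auto simp: cartier_alg_def cexp_def)
qed

text \<open>A long product of elements of positive degree is not only of high degree but also carries a high
power of \<open>f\<close>; the second fact is what kills the local cohomology at primes containing \<open>f\<close>.\<close>
lemma positive_products_form:
  assumes "c > 0" "\<phi> \<in> positive_products (cartier_alg p scale \<kappa> f c) a"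
  shows "\<exists>d x r. a \<le> d \<and> c * of_nat d \<le> of_nat x \<and> \<phi> = (\<lambda>m. twist d x (r *s m))"
  using assms(2)
proof (induction a arbitrary: \<phi>)
  case 0
  then have "\<phi> = (\<lambda>m. twist 0 0 (1 *s m))" by (auto simp: twist_def fun_eq_iff)
  then show ?case by (intro exI[of _ 0] exI[of _ 1]) simp
next
  case (Suc a)
  then obtain \<chi> \<psi> e where \<phi>: "\<phi> = \<chi> \<circ> \<psi>" "e \<ge> 1" "\<chi> \<in> cartier_alg p scale \<kappa> f c e"
    "\<psi> \<in> positive_products (cartier_alg p scale \<kappa> f c) a" by auto
  obtain r where r: "\<chi> = (\<lambda>m. twist e (cexp c e) (r *s m))" using cartier_alg_mem[OF \<phi>(2,3)] .
  obtain d x s where d: "a \<le> d" "c * of_nat d \<le> of_nat x" "\<psi> = (\<lambda>m. twist d x (s *s m))"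
    using Suc.IH[OF \<phi>(4)] by blast
  have "\<phi> = (\<lambda>m. twist (e + d) (cexp c e * p ^ d + x) ((r ^ (p ^ d) * s) *s m))"
    by (simp add: \<phi>(1) r d(3) fun_eq_iff twist_frob twist_twist)
  moreover have "c * of_nat (e + d) \<le> of_nat (cexp c e * p ^ d + x)"
  proof -
    have "e < p ^ e" using p_ge_2 by (metis Suc_1 less_exp order_less_le_trans power_mono zero_le)
    then have "c * of_nat e \<le> c * of_nat (p ^ e)" using \<open>c > 0\<close> by (simp add: order_less_imp_le del: of_nat_power)
    also have "\<dots> \<le> of_nat (cexp c e)" by (rule cexp_ge)
    also have "\<dots> \<le> of_nat (cexp c e * p ^ d)" using p_ge_2 by (simp del: of_nat_mult)
    finally show ?thesis using d(2) by (simp add: algebra_simps)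
  qed
  moreover have "Suc a \<le> e + d" using d(1) \<phi>(2) by linarith
  ultimately show ?case by blast
qed

lemma twist_mem_positive_products:
  "\<exists>y. twist a y \<in> positive_products (cartier_alg p scale \<kappa> f c) a"
proof (induction a)
  case 0
  have "twist 0 0 = id" by (simp add: twist_def fun_eq_iff)
  then show ?case unfolding positive_products.simps by blast
next
  case (Suc a)
  then obtain y where y: "twist a y \<in> positive_products (cartier_alg p scale \<kappa> f c) a" ..
  have "(\<lambda>m. twist 1 (cexp c 1) (1 *s m)) \<in> cartier_alg p scale \<kappa> f c 1"
    by (rule cartier_alg_memI) auto
  then have "twist 1 (cexp c 1) \<in> cartier_alg p scale \<kappa> f c 1" by simp
  then have "twist 1 (cexp c 1) \<circ> twist a y \<in> positive_products (cartier_alg p scale \<kappa> f c) (Suc a)"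
    using y by fastforce
  moreover have "twist 1 (cexp c 1) \<circ> twist a y = twist (Suc a) (cexp c 1 * p ^ a + y)"
    by (auto simp: twist_twist)
  ultimately show ?case by metis
qed

lemma ideal_power_subspace: "module.subspace (*) (ideal_power (I :: 'r set) n)"
proof (cases n)
  case 0
  interpret R: module "(*) :: 'r \<Rightarrow> 'r \<Rightarrow> 'r" by unfold_locales (auto simp: algebra_simps)
  show ?thesis using 0 by (simp add: R.subspace_UNIV)
next
  case (Suc k)
  interpret R: module "(*) :: 'r \<Rightarrow> 'r \<Rightarrow> 'r" by unfold_locales (auto simp: algebra_simps)
  show ?thesis using Suc by (simp add: R.subspace_span)
qed

lemma ideal_power_mult: "x \<in> ideal_power (I :: 'r set) n \<Longrightarrow> r * x \<in> ideal_power I n"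
proof -
  interpret R: module "(*) :: 'r \<Rightarrow> 'r \<Rightarrow> 'r" by unfold_locales (auto simp: algebra_simps)
  show "x \<in> ideal_power I n \<Longrightarrow> r * x \<in> ideal_power I n"
    by (rule R.subspace_scale[OF ideal_power_subspace])
qed

lemma ideal_power_antimono: "m \<le> n \<Longrightarrow> ideal_power (I :: 'r set) n \<subseteq> ideal_power I m"
proof (rule lift_Suc_antimono_le[of "ideal_power I"])
  fix n
  interpret R: module "(*) :: 'r \<Rightarrow> 'r \<Rightarrow> 'r" by unfold_locales (auto simp: algebra_simps)
  show "ideal_power I (Suc n) \<subseteq> ideal_power I n"
    unfolding ideal_power.simps
    by (rule R.span_minimal[OF _ ideal_power_subspace]) (auto intro: ideal_power_mult)
qed

lemma power_mem_ideal_power: "x \<in> (I :: 'r set) \<Longrightarrow> x ^ n \<in> ideal_power I n"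
proof (induction n)
  case (Suc n)
  interpret R: module "(*) :: 'r \<Rightarrow> 'r \<Rightarrow> 'r" by unfold_locales (auto simp: algebra_simps)
  show ?case using Suc by (auto intro!: R.span_base)
qed auto

lemma subspace_H0:
  assumes "subspace N"
  shows "subspace (H0 scale \<eta> N)"
proof (rule subspaceI)
  show "0 \<in> H0 scale \<eta> N" using subspace_0[OF assms] by (auto simp: H0_def)
next
  fix u v assume "u \<in> H0 scale \<eta> N" "v \<in> H0 scale \<eta> N"
  then obtain i j where "\<And>x. x \<in> ideal_power \<eta> i \<Longrightarrow> x *s u = 0" "\<And>x. x \<in> ideal_power \<eta> j \<Longrightarrow> x *s v = 0"
    and uv: "u \<in> N" "v \<in> N" by (auto simp: H0_def)
  then have "x *s (u + v) = 0" if "x \<in> ideal_power \<eta> (max i j)" for x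
    using that ideal_power_antimono[of i "max i j" \<eta>] ideal_power_antimono[of j "max i j" \<eta>]
    by (auto simp: scale_right_distrib subset_iff)
  then show "u + v \<in> H0 scale \<eta> N" using subspace_add[OF assms uv] unfolding H0_def by blast
next
  fix r u assume "u \<in> H0 scale \<eta> N"
  then obtain i where i: "\<And>x. x \<in> ideal_power \<eta> i \<Longrightarrow> x *s u = 0" and u: "u \<in> N" by (auto simp: H0_def)
  have "x *s (r *s u) = 0" if "x \<in> ideal_power \<eta> i" for x
    using i[OF that] by (metis scale_left_commute scale_zero_right)
  then show "r *s u \<in> H0 scale \<eta> N" using subspace_scale[OF assms u] unfolding H0_def by blast
qed

lemma twist_H0:
  assumes "m \<in> H0 scale \<eta> UNIV"
  shows "twist e x m \<in> H0 scale \<eta> UNIV"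
proof -
  obtain n where n: "\<And>y. y \<in> ideal_power \<eta> n \<Longrightarrow> y *s m = 0" using assms by (auto simp: H0_def)
  have "y *s twist e x m = 0" if "y \<in> ideal_power \<eta> n" for y
  proof -
    have "y ^ (p ^ e) = y ^ (p ^ e - 1) * y" using p_ge_2 by (simp flip: power_Suc2)
    then have "y ^ (p ^ e) \<in> ideal_power \<eta> n" using that by (simp add: ideal_power_mult)
    then show ?thesis using n by (simp add: twist_frob twist_zero)
  qed
  then show ?thesis by (auto simp: H0_def)
qed

section \<open>Density of iterated images at the associated primes\<close>

text \<open>Where \<open>f\<close> is invertible, the localized Cartier algebra is generated by \<open>\<kappa>\<close>, whatever the
exponent \<open>c\<close>. This is the resulting form of the condition that defines the test module, with
fractions cleared: \<open>\<kappa>\<^sup>a H\<^sup>0\<^sub>\<eta>(M) \<subseteq> N\<^sub>\<eta>\<close> for some \<open>a\<close>.\<close>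
definition kappa_dense :: "'m set \<Rightarrow> bool" where
  "kappa_dense N \<longleftrightarrow> (\<forall>\<eta>\<in>associated_primes scale. f \<notin> \<eta> \<longrightarrow>
     (\<exists>a. \<forall>m\<in>H0 scale \<eta> UNIV. \<exists>s. s \<notin> \<eta> \<and> s *s (\<kappa> ^^ a) m \<in> N))"

lemma assoc_prime_facts:
  assumes "\<eta> \<in> associated_primes scale"
  shows "1 \<notin> \<eta>" and "\<And>x y. x \<notin> \<eta> \<Longrightarrow> y \<notin> \<eta> \<Longrightarrow> x * y \<notin> \<eta>" and "\<And>x n. x \<notin> \<eta> \<Longrightarrow> x ^ n \<notin> \<eta>"
proof -
  interpret R: module "(*) :: 'r \<Rightarrow> 'r \<Rightarrow> 'r" by unfold_locales (auto simp: algebra_simps)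
  have \<eta>: "R.subspace \<eta>" "\<eta> \<noteq> UNIV" "\<And>x y. x * y \<in> \<eta> \<Longrightarrow> x \<in> \<eta> \<or> y \<in> \<eta>"
    using assms by (auto simp: associated_primes_def prime_ideal_def)
  show 1: "1 \<notin> \<eta>"
  proof
    assume "1 \<in> \<eta>"
    then have "x \<in> \<eta>" for x using R.subspace_scale[OF \<eta>(1), of 1 x] by simp
    then show False using \<eta>(2) by blast
  qed
  show m: "\<And>x y. x \<notin> \<eta> \<Longrightarrow> y \<notin> \<eta> \<Longrightarrow> x * y \<notin> \<eta>" using \<eta>(3) by blast
  show "x ^ n \<notin> \<eta>" if "x \<notin> \<eta>" for x n using that 1 m by (induction n) auto
qed

lemma kappa_denseD:
  assumes "kappa_dense N" "\<eta> \<in> associated_primes scale" "f \<notin> \<eta>"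
  shows "\<exists>a. \<forall>m\<in>H0 scale \<eta> UNIV. \<exists>s. s \<notin> \<eta> \<and> s *s (\<kappa> ^^ a) m \<in> N"
  using assms(1)[unfolded kappa_dense_def, THEN bspec, OF assms(2), THEN mp, OF assms(3)] .

lemma kappa_dense_UNIV: "kappa_dense UNIV"
  using assoc_prime_facts(1) by (auto simp: kappa_dense_def)

lemma kappa_H0: "m \<in> H0 scale \<eta> UNIV \<Longrightarrow> (\<kappa> ^^ a) m \<in> H0 scale \<eta> UNIV"
  using twist_H0[of m \<eta> a 0] by (simp add: twist_def)

lemma kappa_dense_Int:
  assumes "kappa_dense N" "kappa_dense N'" "subspace N" "subspace N'"
  shows "kappa_dense (N \<inter> N')"
  unfolding kappa_dense_def
proof (intro ballI impI)
  fix \<eta> assume \<eta>: "\<eta> \<in> associated_primes scale" "f \<notin> \<eta>"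
  obtain a where a: "\<forall>m\<in>H0 scale \<eta> UNIV. \<exists>s. s \<notin> \<eta> \<and> s *s (\<kappa> ^^ a) m \<in> N"
    using kappa_denseD[OF assms(1) \<eta>] ..
  obtain b where b: "\<forall>m\<in>H0 scale \<eta> UNIV. \<exists>s. s \<notin> \<eta> \<and> s *s (\<kappa> ^^ b) m \<in> N'"
    using kappa_denseD[OF assms(2) \<eta>] ..
  have "\<exists>s. s \<notin> \<eta> \<and> s *s (\<kappa> ^^ (a + b)) m \<in> N \<inter> N'" if m: "m \<in> H0 scale \<eta> UNIV" for m
  proof -
    obtain s where s: "s \<notin> \<eta>" "s *s (\<kappa> ^^ (a + b)) m \<in> N"
      using bspec[OF a kappa_H0[OF m, of b]] by (auto simp: funpow_add)
    obtain t where t: "t \<notin> \<eta>" "t *s (\<kappa> ^^ (a + b)) m \<in> N'"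
      using bspec[OF b kappa_H0[OF m, of a]] by (auto simp: add.commute[of a b] funpow_add)
    have "(s * t) *s (\<kappa> ^^ (a + b)) m \<in> N \<inter> N'"
      using subspace_scale[OF assms(3) s(2), of t] subspace_scale[OF assms(4) t(2), of s]
      by (metis IntI mult.commute scale_scale)
    then show ?thesis using assoc_prime_facts(2)[OF \<eta>(1) s(1) t(1)] by blast
  qed
  then show "\<exists>a. \<forall>m\<in>H0 scale \<eta> UNIV. \<exists>s. s \<notin> \<eta> \<and> s *s (\<kappa> ^^ a) m \<in> N \<inter> N'"
    by (intro exI[of _ "a + b"] ballI)
qed

text \<open>Applied to \<open>f\<^bsup>y (q - 1)\<^esup> m\<close> with \<open>q = p\<^sup>a\<close>, the hypothesis is about \<open>\<kappa>\<^sup>a (f\<^bsup>y q\<^esup> m) = f\<^sup>y \<kappa>\<^sup>a m\<close>, and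
\<open>f\<^sup>y\<close> joins the denominator because \<open>f \<notin> \<eta>\<close>.\<close>
lemma untwist:
  assumes \<eta>: "\<eta> \<in> associated_primes scale" "f \<notin> \<eta>"
    and N: "\<And>m. m \<in> H0 scale \<eta> UNIV \<Longrightarrow> \<exists>s. s \<notin> \<eta> \<and> s *s twist a y m \<in> N"
    and m: "m \<in> H0 scale \<eta> UNIV"
  shows "\<exists>s. s \<notin> \<eta> \<and> s *s (\<kappa> ^^ a) m \<in> N"
proof -
  have "f ^ (y * (p ^ a - 1)) *s m \<in> H0 scale \<eta> UNIV"
    by (rule subspace_scale[OF subspace_H0[OF subspace_UNIV] m])
  then obtain s where s: "s \<notin> \<eta>" "s *s twist a y (f ^ (y * (p ^ a - 1)) *s m) \<in> N" using N by blast
  have "y + y * (p ^ a - 1) = y * p ^ a" using p_ge_2 by (simp add: algebra_simps)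
  then have "twist a y (f ^ (y * (p ^ a - 1)) *s m) = (\<kappa> ^^ a) ((f ^ y) ^ (p ^ a) *s m)"
    by (simp add: twist_def flip: power_add power_mult)
  then have "(s * f ^ y) *s (\<kappa> ^^ a) m \<in> N" using s(2) by (simp add: \<kappa>_pow_frob)
  then show ?thesis using assoc_prime_facts(2,3)[OF \<eta>(1)] s(1) \<eta>(2) by blast
qed

text \<open>An element \<open>s\<close> outside \<open>\<eta>\<close> moves through \<open>\<kappa>\<^sup>E\<close> once it has been raised to the power \<open>p\<^sup>E\<close>, so
applying \<open>\<kappa>\<^sup>E f\<^sup>b\<close> to \<open>\<kappa>\<^sup>a H\<^sup>0\<^sub>\<eta>(M) \<subseteq> Q\<^sub>\<eta>\<close> only replaces \<open>a\<close> by \<open>E + a\<close>. New candidates for test modules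
arise from old ones in this way.\<close>
lemma kappa_dense_twist:
  assumes Q: "kappa_dense Q" "subspace Q" and img: "twist E b ` Q \<subseteq> N"
  shows "kappa_dense N"
  unfolding kappa_dense_def
proof (intro ballI impI)
  fix \<eta> assume \<eta>: "\<eta> \<in> associated_primes scale" "f \<notin> \<eta>"
  obtain a where a: "\<forall>m\<in>H0 scale \<eta> UNIV. \<exists>s. s \<notin> \<eta> \<and> s *s (\<kappa> ^^ a) m \<in> Q"
    using kappa_denseD[OF Q(1) \<eta>] ..
  have "\<exists>s. s \<notin> \<eta> \<and> s *s twist (E + a) (b * p ^ a) m \<in> N" if m: "m \<in> H0 scale \<eta> UNIV" for m
  proof -
    obtain s where s: "s \<notin> \<eta>" "s *s (\<kappa> ^^ a) m \<in> Q" using bspec[OF a m] by blast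
    have "s *s twist (E + a) (b * p ^ a) m = s *s twist E b (twist a 0 m)" by (simp add: twist_twist)
    also have "\<dots> = twist E b (s ^ (p ^ E - 1) *s (s *s (\<kappa> ^^ a) m))"
      using p_ge_2 by (simp add: twist_frob twist_def[of a 0] flip: power_Suc2)
    finally have *: "s *s twist (E + a) (b * p ^ a) m = twist E b (s ^ (p ^ E - 1) *s (s *s (\<kappa> ^^ a) m))" .
    have "s ^ (p ^ E - 1) *s (s *s (\<kappa> ^^ a) m) \<in> Q" by (rule subspace_scale[OF Q(2) s(2)])
    then show ?thesis using * s(1) img by auto
  qed
  from untwist[OF \<eta> this]
  show "\<exists>a. \<forall>m\<in>H0 scale \<eta> UNIV. \<exists>s. s \<notin> \<eta> \<and> s *s (\<kappa> ^^ a) m \<in> N"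
    by (intro exI[of _ "E + a"] ballI)
qed

section \<open>Nil-isomorphisms after localization\<close>

lemma scale_cong: "x *s m = y *s n \<Longrightarrow> a = k * x \<Longrightarrow> b = k * y \<Longrightarrow> a *s m = b *s n"
  by (simp flip: scale_scale)

lemma loc_frac_mem:
  "(n, t) \<in> loc_frac scale \<eta> m s \<longleftrightarrow> t \<notin> \<eta> \<and> (\<exists>u. u \<notin> \<eta> \<and> (u * t) *s m = (u * s) *s n)"
  by (simp add: loc_frac_def)

context
  fixes \<eta> assumes \<eta>: "\<eta> \<in> associated_primes scale"
begin

lemma mult_notin: "x \<notin> \<eta> \<Longrightarrow> y \<notin> \<eta> \<Longrightarrow> x * y \<notin> \<eta>"
  by (rule assoc_prime_facts(2)[OF \<eta>])

lemma one_notin: "1 \<notin> \<eta>"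
  by (rule assoc_prime_facts(1)[OF \<eta>])

lemma loc_frac_eqI:
  assumes "s \<notin> \<eta>" "t \<notin> \<eta>" "u \<notin> \<eta>" "(u * t) *s m = (u * s) *s n"
  shows "loc_frac scale \<eta> m s = loc_frac scale \<eta> n t"
proof -
  have *: "loc_frac scale \<eta> m s \<subseteq> loc_frac scale \<eta> n t"
    if "s \<notin> \<eta>" "u \<notin> \<eta>" "(u * t) *s m = (u * s) *s n" for m n s t
  proof (intro subsetI, clarify)
    fix k v assume "(k, v) \<in> loc_frac scale \<eta> m s"
    then obtain w where v: "v \<notin> \<eta>" "w \<notin> \<eta>" "(w * v) *s m = (w * s) *s k" by (auto simp: loc_frac_mem)
    have "((w * u * s) * v) *s n = (w * v * u * t) *s m"
      by (rule scale_cong[OF that(3)[symmetric], of _ "w * v"]) (simp_all add: ac_simps)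
    also have "\<dots> = ((w * u * s) * t) *s k"
      by (rule scale_cong[OF v(3), of _ "u * t"]) (simp_all add: ac_simps)
    finally show "(k, v) \<in> loc_frac scale \<eta> n t"
      using v that mult_notin by (auto simp: loc_frac_mem intro!: exI[of _ "w * u * s"])
  qed
  show ?thesis
    using *[OF assms(1,3,4)] *[OF assms(2,3) assms(4)[symmetric]] by blast
qed

lemma loc_frac_eqD:
  assumes "s \<notin> \<eta>" "t \<notin> \<eta>" "loc_frac scale \<eta> m s = loc_frac scale \<eta> n t"
  shows "\<exists>u. u \<notin> \<eta> \<and> (u * t) *s m = (u * s) *s n"
proof -
  have "(n, t) \<in> loc_frac scale \<eta> m s"
    unfolding assms(3) using assms(2) one_notin by (auto simp: loc_frac_mem)
  then show ?thesis by (simp add: loc_frac_mem)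
qed

text \<open>Operations on fractions are unions over all representatives; each union collapses because every
representative contributes the same class.\<close>
lemma loc_frac_UN_eqI:
  assumes "s \<notin> \<eta>"
    and "\<And>n t. t \<notin> \<eta> \<Longrightarrow> loc_frac scale \<eta> m s = loc_frac scale \<eta> n t \<Longrightarrow> g n t = y"
  shows "(\<Union>(n, t)\<in>loc_frac scale \<eta> m s. g n t) = y"
proof -
  have self: "(m, s) \<in> loc_frac scale \<eta> m s" using assms(1) one_notin by (auto simp: loc_frac_mem)
  have "g n t = y" if "(n, t) \<in> loc_frac scale \<eta> m s" for n t
  proof -
    obtain u where "t \<notin> \<eta>" "u \<notin> \<eta>" "(u * t) *s m = (u * s) *s n" using \<open>(n, t) \<in> _\<close> by (auto simp: loc_frac_mem)
    then show ?thesis using assms(2) loc_frac_eqI[OF assms(1)] by blast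
  qed
  then have "(\<lambda>(n, t). g n t) ` loc_frac scale \<eta> m s = {y}" using self by auto
  then show ?thesis by simp
qed

lemma loc_scale_frac:
  assumes "s \<notin> \<eta>" "t \<notin> \<eta>"
  shows "loc_scale scale \<eta> r t (loc_frac scale \<eta> m s) = loc_frac scale \<eta> (r *s m) (t * s)"
  unfolding loc_scale_def
proof (rule loc_frac_UN_eqI[OF assms(1)])
  fix n s' assume s': "s' \<notin> \<eta>" "loc_frac scale \<eta> m s = loc_frac scale \<eta> n s'"
  obtain u where u: "u \<notin> \<eta>" "(u * s') *s m = (u * s) *s n" using loc_frac_eqD[OF assms(1) s'] by blast
  have "(u * (t * s)) *s (r *s n) = (u * (t * s')) *s (r *s m)"
    unfolding scale_scale
    by (rule scale_cong[OF u(2)[symmetric], of _ "t * r"]) (simp_all add: ac_simps)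
  then show "loc_frac scale \<eta> (r *s n) (t * s') = loc_frac scale \<eta> (r *s m) (t * s)"
    using assms s' u mult_notin by (intro loc_frac_eqI) auto
qed

lemma loc_minus_frac:
  assumes "s \<notin> \<eta>" "t \<notin> \<eta>"
  shows "loc_minus scale \<eta> (loc_frac scale \<eta> m s) (loc_frac scale \<eta> n t)
    = loc_frac scale \<eta> (t *s m - s *s n) (s * t)"
  unfolding loc_minus_def
proof (rule loc_frac_UN_eqI[OF assms(1)], rule loc_frac_UN_eqI[OF assms(2)])
  fix m' s' n' t'
  assume s': "s' \<notin> \<eta>" "loc_frac scale \<eta> m s = loc_frac scale \<eta> m' s'"
    and t': "t' \<notin> \<eta>" "loc_frac scale \<eta> n t = loc_frac scale \<eta> n' t'"
  obtain u where u: "u \<notin> \<eta>" "(u * s') *s m = (u * s) *s m'" using loc_frac_eqD[OF assms(1) s'] by blast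
  obtain v where v: "v \<notin> \<eta>" "(v * t') *s n = (v * t) *s n'" using loc_frac_eqD[OF assms(2) t'] by blast
  have "(u * v * (s * t) * t') *s m' = (u * v * (s' * t') * t) *s m"
    by (rule scale_cong[OF u(2)[symmetric], of _ "v * t * t'"]) (simp_all add: ac_simps)
  moreover have "(u * v * (s * t) * s') *s n' = (u * v * (s' * t') * s) *s n"
    by (rule scale_cong[OF v(2)[symmetric], of _ "u * s * s'"]) (simp_all add: ac_simps)
  ultimately have "(u * v * (s * t)) *s (t' *s m' - s' *s n') = (u * v * (s' * t')) *s (t *s m - s *s n)"
    by (simp only: scale_right_diff_distrib scale_scale)
  then show "loc_frac scale \<eta> (t' *s m' - s' *s n') (s' * t') = loc_frac scale \<eta> (t *s m - s *s n) (s * t)"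
    using assms s' t' u(1) v(1) mult_notin by (intro loc_frac_eqI[of _ _ "u * v"]) auto
qed

lemma loc_map_frac:
  assumes "s \<notin> \<eta>" and lin: "\<And>r m. \<phi> (r ^ (p ^ e) *s m) = r *s \<phi> m"
  shows "loc_map scale \<eta> (p ^ e) \<phi> (loc_frac scale \<eta> m s)
    = loc_frac scale \<eta> (\<phi> (s ^ (p ^ e - 1) *s m)) s"
  unfolding loc_map_def
proof (rule loc_frac_UN_eqI[OF assms(1)])
  fix n t assume t: "t \<notin> \<eta>" "loc_frac scale \<eta> m s = loc_frac scale \<eta> n t"
  obtain u where u: "u \<notin> \<eta>" "(u * t) *s m = (u * s) *s n" using loc_frac_eqD[OF assms(1) t] by blast
  have q: "x ^ (p ^ e) = x * x ^ (p ^ e - 1)" for x :: 'r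
    using p_ge_2 by (simp flip: power_Suc)
  have "(u * s) *s \<phi> (t ^ (p ^ e - 1) *s n) = \<phi> ((u * s * t) ^ (p ^ e - 1) *s ((u * s) *s n))"
    by (simp add: q power_mult_distrib ac_simps flip: lin)
  also have "\<dots> = \<phi> ((u * s * t) ^ (p ^ e - 1) *s ((u * t) *s m))" by (simp add: u(2))
  also have "\<dots> = (u * t) *s \<phi> (s ^ (p ^ e - 1) *s m)"
    by (simp add: q power_mult_distrib ac_simps flip: lin)
  finally show "loc_frac scale \<eta> (\<phi> (t ^ (p ^ e - 1) *s n)) t = loc_frac scale \<eta> (\<phi> (s ^ (p ^ e - 1) *s m)) s"
    using assms(1) t(1) u(1) by (intro loc_frac_eqI) auto
qed

lemma mem_loc_module_iff:
  assumes N: "subspace N" and m: "m \<in> H0 scale \<eta> UNIV" and s: "s \<notin> \<eta>"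
  shows "loc_frac scale \<eta> m s \<in> loc_module scale \<eta> (H0 scale \<eta> N) \<longleftrightarrow> (\<exists>u. u \<notin> \<eta> \<and> u *s m \<in> N)"
proof
  assume "loc_frac scale \<eta> m s \<in> loc_module scale \<eta> (H0 scale \<eta> N)"
  then obtain n t where n: "loc_frac scale \<eta> m s = loc_frac scale \<eta> n t" "n \<in> N" "t \<notin> \<eta>"
    by (auto simp: loc_module_def H0_def)
  obtain u where u: "u \<notin> \<eta>" "(u * t) *s m = (u * s) *s n" using loc_frac_eqD[OF s n(3,1)] by blast
  have "(u * t) *s m \<in> N" unfolding u(2) by (rule subspace_scale[OF N n(2)])
  then show "\<exists>u. u \<notin> \<eta> \<and> u *s m \<in> N" using mult_notin[OF u(1) n(3)] by blast
next
  assume "\<exists>u. u \<notin> \<eta> \<and> u *s m \<in> N"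
  then obtain u where u: "u \<notin> \<eta>" "u *s m \<in> N" by blast
  have "u *s m \<in> H0 scale \<eta> UNIV" by (rule subspace_scale[OF subspace_H0[OF subspace_UNIV] m])
  then have "u *s m \<in> H0 scale \<eta> N" using u(2) by (auto simp: H0_def)
  moreover have "loc_frac scale \<eta> m s = loc_frac scale \<eta> (u *s m) (u * s)"
    by (rule loc_frac_eqI[OF s mult_notin[OF u(1) s] one_notin]) (simp add: ac_simps)
  ultimately show "loc_frac scale \<eta> m s \<in> loc_module scale \<eta> (H0 scale \<eta> N)"
    using mult_notin[OF u(1) s] by (auto simp: loc_module_def)
qed

text \<open>The difference of \<open>m / s\<close> and \<open>n / t\<close> lies in the localization of \<open>N\<close>. All computations in the
cokernel are carried out with this relation on representatives.\<close>
definition frac_near :: "'m set \<Rightarrow> 'm \<Rightarrow> 'r \<Rightarrow> 'm \<Rightarrow> 'r \<Rightarrow> bool" where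
  "frac_near N m s n t \<longleftrightarrow> (\<exists>u. u \<notin> \<eta> \<and> u *s (t *s m - s *s n) \<in> N)"

lemma frac_near_refl: "subspace N \<Longrightarrow> frac_near N m s m s"
  using one_notin by (auto simp: frac_near_def subspace_0 intro!: exI[of _ 1])

lemma frac_near_sym:
  assumes "subspace N" "frac_near N m s n t"
  shows "frac_near N n t m s"
proof -
  obtain u where u: "u \<notin> \<eta>" "u *s (t *s m - s *s n) \<in> N" using assms(2) by (auto simp: frac_near_def)
  have "u *s (s *s n - t *s m) = - (u *s (t *s m - s *s n))"
    by (simp add: scale_right_diff_distrib)
  then have "u *s (s *s n - t *s m) \<in> N" using subspace_neg[OF assms(1) u(2)] by simp
  then show ?thesis using u(1) by (auto simp: frac_near_def)
qed

lemma frac_near_trans: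
  assumes N: "subspace N" and t: "t \<notin> \<eta>" and mn: "frac_near N m s n t" and nk: "frac_near N n t k w"
  shows "frac_near N m s k w"
proof -
  obtain u where u: "u \<notin> \<eta>" "u *s (t *s m - s *s n) \<in> N" using mn by (auto simp: frac_near_def)
  obtain v where v: "v \<notin> \<eta>" "v *s (w *s n - t *s k) \<in> N" using nk by (auto simp: frac_near_def)
  have "(u * v * t) *s (w *s m - s *s k)
      = (v * w) *s (u *s (t *s m - s *s n)) + (u * s) *s (v *s (w *s n - t *s k))"
    by (simp add: scale_right_diff_distrib ac_simps)
  also have "\<dots> \<in> N" by (intro subspace_add[OF N] subspace_scale[OF N] u v)
  finally show ?thesis using mult_notin[OF mult_notin[OF u(1) v(1)] t] by (auto simp: frac_near_def)
qed

lemma loc_minus_mem_iff: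
  assumes N: "subspace N" and "m \<in> H0 scale \<eta> UNIV" "s \<notin> \<eta>" "n \<in> H0 scale \<eta> UNIV" "t \<notin> \<eta>"
  shows "loc_minus scale \<eta> (loc_frac scale \<eta> m s) (loc_frac scale \<eta> n t)
      \<in> loc_module scale \<eta> (H0 scale \<eta> N) \<longleftrightarrow> frac_near N m s n t"
proof -
  note H = subspace_H0[OF subspace_UNIV, of \<eta>]
  have "t *s m - s *s n \<in> H0 scale \<eta> UNIV"
    by (intro subspace_diff[OF H] subspace_scale[OF H] assms)
  then show ?thesis
    using assms by (simp add: loc_minus_frac mem_loc_module_iff mult_notin frac_near_def)
qed

context
  fixes c :: rat and N :: "'m set"
  assumes N: "cartier_submodule scale (cartier_alg p scale \<kappa> f c) N"
begin

abbreviation "locH \<equiv> loc_module scale \<eta> (H0 scale \<eta> UNIV)"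
abbreviation "locN \<equiv> loc_module scale \<eta> (H0 scale \<eta> N)"
abbreviation "locC \<equiv> loc_alg p scale \<eta> (cartier_alg p scale \<kappa> f c)"
abbreviation "quotC \<equiv> (\<lambda>e. quot_map (loc_minus scale \<eta>) locH locN ` locC e)"

lemma subspace_N: "subspace N"
  using N by (simp add: cartier_submodule_def)

lemma alg_facts:
  assumes "e \<ge> 1" "\<phi> \<in> cartier_alg p scale \<kappa> f c e"
  shows "\<phi> (m + n) = \<phi> m + \<phi> n" "\<phi> (m - n) = \<phi> m - \<phi> n" "\<phi> (r ^ (p ^ e) *s m) = r *s \<phi> m"
    "m \<in> N \<Longrightarrow> \<phi> m \<in> N" "m \<in> H0 scale \<eta> UNIV \<Longrightarrow> \<phi> m \<in> H0 scale \<eta> UNIV"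
    "(\<lambda>m. \<phi> (r *s m)) \<in> cartier_alg p scale \<kappa> f c e"
proof -
  obtain s where s: "\<phi> = (\<lambda>m. twist e (cexp c e) (s *s m))" using cartier_alg_mem[OF assms] .
  show add: "\<phi> (m + n) = \<phi> m + \<phi> n" for m n by (simp add: s scale_right_distrib twist_add)
  show "\<phi> (m - n) = \<phi> m - \<phi> n" using add[of "m - n" n] by (simp add: algebra_simps)
  show "\<phi> (r ^ (p ^ e) *s m) = r *s \<phi> m" by (simp add: s twist_frob ac_simps)
  show "m \<in> N \<Longrightarrow> \<phi> m \<in> N" using N assms(2) by (auto simp: cartier_submodule_def)
  show "m \<in> H0 scale \<eta> UNIV \<Longrightarrow> \<phi> m \<in> H0 scale \<eta> UNIV"
    unfolding s by (intro twist_H0 subspace_scale[OF subspace_H0[OF subspace_UNIV]])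
  show "(\<lambda>m. \<phi> (r *s m)) \<in> cartier_alg p scale \<kappa> f c e"
    using cartier_alg_memI[OF assms(1) order_refl, of c "s * r"] by (simp add: s)
qed

lemma loc_alg_frac:
  assumes "e \<ge> 1" "\<phi> \<in> cartier_alg p scale \<kappa> f c e" "t \<notin> \<eta>" "s \<notin> \<eta>"
  shows "(loc_map scale \<eta> (p ^ e) \<phi> \<circ> loc_scale scale \<eta> r t) (loc_frac scale \<eta> m s)
    = loc_frac scale \<eta> (\<phi> (((t * s) ^ (p ^ e - 1) * r) *s m)) (t * s)"
  using assms by (simp add: loc_scale_frac loc_map_frac mult_notin alg_facts(3))

lemma loc_alg_near:
  assumes e: "e \<ge> 1" "\<phi> \<in> cartier_alg p scale \<kappa> f c e" and near: "frac_near N m s n v"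
  shows "frac_near N (\<phi> (((t * s) ^ (p ^ e - 1) * r) *s m)) (t * s) (\<phi> (((t * v) ^ (p ^ e - 1) * r) *s n)) (t * v)"
proof -
  obtain u where u: "u \<notin> \<eta>" "u *s (v *s m - s *s n) \<in> N" using near by (auto simp: frac_near_def)
  let ?q = "p ^ e - 1"
  have q: "x ^ (p ^ e) = x * x ^ ?q" for x :: 'r using p_ge_2 by (simp flip: power_Suc)
  have "u *s ((t * v) *s \<phi> (((t * s) ^ ?q * r) *s m) - (t * s) *s \<phi> (((t * v) ^ ?q * r) *s n))
    = \<phi> ((u * t * v) ^ (p ^ e) *s (((t * s) ^ ?q * r) *s m)) - \<phi> ((u * t * s) ^ (p ^ e) *s (((t * v) ^ ?q * r) *s n))"
    unfolding alg_facts(3)[OF e] by (simp add: scale_right_diff_distrib ac_simps)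
  also have "\<dots> = \<phi> ((u * t * v) ^ (p ^ e) *s (((t * s) ^ ?q * r) *s m) - (u * t * s) ^ (p ^ e) *s (((t * v) ^ ?q * r) *s n))"
    by (simp only: alg_facts(2)[OF e])
  also have "(u * t * v) ^ (p ^ e) *s (((t * s) ^ ?q * r) *s m) - (u * t * s) ^ (p ^ e) *s (((t * v) ^ ?q * r) *s n)
    = (u ^ ?q * t ^ ?q * t ^ ?q * t * s ^ ?q * v ^ ?q * r) *s (u *s (v *s m - s *s n))"
    unfolding q power_mult_distrib by (simp add: scale_right_diff_distrib ac_simps)
  finally have "u *s ((t * v) *s \<phi> (((t * s) ^ ?q * r) *s m) - (t * s) *s \<phi> (((t * v) ^ ?q * r) *s n)) \<in> N"
    using alg_facts(4)[OF e subspace_scale[OF subspace_N u(2)]] by (simp only:)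
  then show ?thesis using u(1) by (auto simp: frac_near_def)
qed

definition frac_coset :: "'m \<Rightarrow> 'r \<Rightarrow> ('m \<times> 'r) set set" where
  "frac_coset m s = {loc_frac scale \<eta> n t |n t. n \<in> H0 scale \<eta> UNIV \<and> t \<notin> \<eta> \<and> frac_near N m s n t}"

lemma frac_coset_memI:
  "n \<in> H0 scale \<eta> UNIV \<Longrightarrow> t \<notin> \<eta> \<Longrightarrow> frac_near N m s n t \<Longrightarrow> loc_frac scale \<eta> n t \<in> frac_coset m s"
  by (auto simp: frac_coset_def)

lemma quot_eq_frac_coset:
  "quot (loc_minus scale \<eta>) locH locN = {frac_coset m s |m s. m \<in> H0 scale \<eta> UNIV \<and> s \<notin> \<eta>}"
proof -
  define R where "R = {(x, y). x \<in> locH \<and> y \<in> locH \<and> loc_minus scale \<eta> x y \<in> locN}"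
  have *: "R `` {loc_frac scale \<eta> m s} = frac_coset m s"
    if ms: "m \<in> H0 scale \<eta> UNIV" "s \<notin> \<eta>" for m s
  proof -
    have H: "loc_frac scale \<eta> m s \<in> locH" using ms by (auto simp: loc_module_def)
    show ?thesis
    proof (intro subset_antisym subsetI)
      fix y assume "y \<in> R `` {loc_frac scale \<eta> m s}"
      then obtain n t where "y = loc_frac scale \<eta> n t" "n \<in> H0 scale \<eta> UNIV" "t \<notin> \<eta>"
        "loc_minus scale \<eta> (loc_frac scale \<eta> m s) (loc_frac scale \<eta> n t) \<in> locN"
        by (auto simp: loc_module_def R_def)
      then show "y \<in> frac_coset m s"
        using loc_minus_mem_iff[OF subspace_N ms] by (auto simp: frac_coset_def)
    next
      fix y assume "y \<in> frac_coset m s"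
      then obtain n t where y: "y = loc_frac scale \<eta> n t" "n \<in> H0 scale \<eta> UNIV" "t \<notin> \<eta>" "frac_near N m s n t"
        by (auto simp: frac_coset_def)
      moreover have "y \<in> locH" using y by (auto simp: loc_module_def)
      ultimately show "y \<in> R `` {loc_frac scale \<eta> m s}"
        using loc_minus_mem_iff[OF subspace_N ms] H by (auto simp: R_def)
    qed
  qed
  have quot: "quot (loc_minus scale \<eta>) locH locN = (\<lambda>x. R `` {x}) ` locH"
    unfolding quot_def quotient_def R_def by blast
  have "quot (loc_minus scale \<eta>) locH locN
      = {R `` {loc_frac scale \<eta> m s} |m s. m \<in> H0 scale \<eta> UNIV \<and> s \<notin> \<eta>}"
    unfolding quot by (subst loc_module_def) blast
  also have "\<dots> = {frac_coset m s |m s. m \<in> H0 scale \<eta> UNIV \<and> s \<notin> \<eta>}"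
    by (rule Collect_cong) (use * in \<open>metis (no_types, lifting)\<close>)
  finally show ?thesis .
qed

lemma quot_map_frac_coset:
  assumes e: "e \<ge> 1" "\<phi> \<in> cartier_alg p scale \<kappa> f c e" and t: "t \<notin> \<eta>"
    and m: "m \<in> H0 scale \<eta> UNIV" and s: "s \<notin> \<eta>"
  shows "quot_map (loc_minus scale \<eta>) locH locN (loc_map scale \<eta> (p ^ e) \<phi> \<circ> loc_scale scale \<eta> r t) (frac_coset m s)
    = frac_coset (\<phi> (((t * s) ^ (p ^ e - 1) * r) *s m)) (t * s)"
proof -
  let ?q = "p ^ e - 1"
  let ?\<psi> = "loc_map scale \<eta> (p ^ e) \<phi> \<circ> loc_scale scale \<eta> r t"
  have \<phi>H: "\<phi> (x *s n) \<in> H0 scale \<eta> UNIV" if "n \<in> H0 scale \<eta> UNIV" for x n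
    by (rule alg_facts(5)[OF e subspace_scale[OF subspace_H0[OF subspace_UNIV] that]])
  show ?thesis
  proof (intro subset_antisym subsetI)
    fix y assume "y \<in> quot_map (loc_minus scale \<eta>) locH locN ?\<psi> (frac_coset m s)"
    then obtain x where y: "y \<in> locH" "x \<in> frac_coset m s" "loc_minus scale \<eta> y (?\<psi> x) \<in> locN"
      by (auto simp: quot_map_def)
    obtain n v where n: "x = loc_frac scale \<eta> n v" "n \<in> H0 scale \<eta> UNIV" "v \<notin> \<eta>" "frac_near N m s n v"
      using y(2) by (auto simp: frac_coset_def)
    obtain k w where k: "y = loc_frac scale \<eta> k w" "k \<in> H0 scale \<eta> UNIV" "w \<notin> \<eta>"
      using y(1) by (auto simp: loc_module_def)
    have "frac_near N k w (\<phi> (((t * v) ^ ?q * r) *s n)) (t * v)"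
      using y(3) unfolding n(1) k(1) loc_alg_frac[OF e t n(3)]
      by (subst (asm) loc_minus_mem_iff[OF subspace_N k(2,3) \<phi>H[OF n(2)] mult_notin[OF t n(3)]])
    then have "frac_near N (\<phi> (((t * v) ^ ?q * r) *s n)) (t * v) k w"
      by (rule frac_near_sym[OF subspace_N])
    then have "frac_near N (\<phi> (((t * s) ^ ?q * r) *s m)) (t * s) k w"
      by (rule frac_near_trans[OF subspace_N mult_notin[OF t n(3)] loc_alg_near[OF e n(4)]])
    then show "y \<in> frac_coset (\<phi> (((t * s) ^ ?q * r) *s m)) (t * s)"
      unfolding k(1) by (intro frac_coset_memI k)
  next
    fix y assume "y \<in> frac_coset (\<phi> (((t * s) ^ ?q * r) *s m)) (t * s)"
    then obtain k w where k: "y = loc_frac scale \<eta> k w" "k \<in> H0 scale \<eta> UNIV" "w \<notin> \<eta>"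
      "frac_near N (\<phi> (((t * s) ^ ?q * r) *s m)) (t * s) k w" by (auto simp: frac_coset_def)
    have "loc_frac scale \<eta> m s \<in> frac_coset m s"
      by (rule frac_coset_memI[OF m s frac_near_refl[OF subspace_N]])
    moreover have "loc_minus scale \<eta> y (?\<psi> (loc_frac scale \<eta> m s)) \<in> locN"
      unfolding k(1) loc_alg_frac[OF e t s]
      by (subst loc_minus_mem_iff[OF subspace_N k(2,3) \<phi>H[OF m] mult_notin[OF t s]])
         (rule frac_near_sym[OF subspace_N k(4)])
    moreover have "y \<in> locH" using k by (auto simp: loc_module_def)
    ultimately show "y \<in> quot_map (loc_minus scale \<eta>) locH locN ?\<psi> (frac_coset m s)"
      unfolding quot_map_def by blast
  qed
qed

lemma positive_products_H0:
  assumes "\<phi> \<in> positive_products (cartier_alg p scale \<kappa> f c) a" "m \<in> H0 scale \<eta> UNIV"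
  shows "\<phi> m \<in> H0 scale \<eta> UNIV"
  using assms
proof (induction a arbitrary: \<phi>)
  case (Suc a)
  then obtain \<chi> \<psi> e where "\<phi> = \<chi> \<circ> \<psi>" "e \<ge> 1" "\<chi> \<in> cartier_alg p scale \<kappa> f c e"
    "\<psi> \<in> positive_products (cartier_alg p scale \<kappa> f c) a" by auto
  then show ?case using Suc.IH[of \<psi>] Suc.prems(2) alg_facts(5) by auto
qed auto

text \<open>Every product in the Cartier algebra of \<open>M\<close> is realised by a product in the localized algebra
acting on the cokernel, so nilpotence of the cokernel can be tested on elements \<open>m / 1\<close>.\<close>
lemma positive_product_lift:
  assumes \<phi>: "\<phi> \<in> positive_products (cartier_alg p scale \<kappa> f c) a"
  shows "\<exists>\<Psi>\<in>positive_products quotC a. \<forall>m\<in>H0 scale \<eta> UNIV. \<forall>X.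
    loc_frac scale \<eta> m 1 \<in> X \<longrightarrow> loc_frac scale \<eta> (\<phi> m) 1 \<in> \<Psi> X"
  using \<phi>
proof (induction a arbitrary: \<phi>)
  case 0
  then show ?case by auto
next
  case (Suc a)
  then obtain \<chi> \<psi> e where \<phi>: "\<phi> = \<chi> \<circ> \<psi>" "e \<ge> 1" "\<chi> \<in> cartier_alg p scale \<kappa> f c e"
    "\<psi> \<in> positive_products (cartier_alg p scale \<kappa> f c) a" by auto
  obtain \<Psi> where \<Psi>: "\<Psi> \<in> positive_products quotC a" "\<And>m X. m \<in> H0 scale \<eta> UNIV \<Longrightarrow>
      loc_frac scale \<eta> m 1 \<in> X \<Longrightarrow> loc_frac scale \<eta> (\<psi> m) 1 \<in> \<Psi> X"
    using Suc.IH[OF \<phi>(4)] by blast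
  let ?\<chi> = "loc_map scale \<eta> (p ^ e) \<chi> \<circ> loc_scale scale \<eta> 1 1"
  let ?Q = "quot_map (loc_minus scale \<eta>) locH locN ?\<chi>"
  have "?\<chi> \<in> locC e" using \<phi>(3) one_notin unfolding loc_alg_def by blast
  then have "?Q \<circ> \<Psi> \<in> positive_products quotC (Suc a)"
    unfolding positive_products.simps using \<Psi>(1) \<phi>(2) by blast
  moreover have "loc_frac scale \<eta> (\<phi> m) 1 \<in> (?Q \<circ> \<Psi>) X"
    if m: "m \<in> H0 scale \<eta> UNIV" and X: "loc_frac scale \<eta> m 1 \<in> X" for m X
  proof -
    have H: "\<phi> m \<in> H0 scale \<eta> UNIV" by (rule positive_products_H0[OF Suc.prems m])
    have "?\<chi> (loc_frac scale \<eta> (\<psi> m) 1) = loc_frac scale \<eta> (\<phi> m) 1"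
      using loc_alg_frac[OF \<phi>(2,3) one_notin one_notin, of 1 "\<psi> m"] \<phi>(1) by simp
    moreover have "loc_minus scale \<eta> (loc_frac scale \<eta> (\<phi> m) 1) (loc_frac scale \<eta> (\<phi> m) 1) \<in> locN"
      using loc_minus_mem_iff[OF subspace_N H one_notin H one_notin] frac_near_refl[OF subspace_N] by blast
    moreover have "loc_frac scale \<eta> (\<phi> m) 1 \<in> locH" using H one_notin by (auto simp: loc_module_def)
    ultimately show ?thesis
      using \<Psi>(2)[OF m X] unfolding quot_map_def comp_apply[of _ \<Psi>]
      by (intro CollectI conjI bexI[of _ "loc_frac scale \<eta> (\<psi> m) 1"]) simp_all
  qed
  ultimately show ?case by blast
qed

text \<open>Conversely, the denominators in a product of localized operators can be absorbed into the
operators, since a homogeneous part of the Cartier algebra is stable under right multiplication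
by \<open>R\<close>.\<close>
lemma positive_products_frac_coset:
  assumes "\<Psi> \<in> positive_products quotC a" "m \<in> H0 scale \<eta> UNIV" "s \<notin> \<eta>"
  shows "\<exists>\<phi>\<in>positive_products (cartier_alg p scale \<kappa> f c) a. \<exists>t. t \<notin> \<eta> \<and> \<Psi> (frac_coset m s) = frac_coset (\<phi> m) t"
  using assms(1)
proof (induction a arbitrary: \<Psi>)
  case 0
  then show ?case using assms(3) by auto
next
  case (Suc a)
  obtain \<chi> \<Psi>' e where \<Psi>: "\<Psi> = \<chi> \<circ> \<Psi>'" "e \<ge> 1" "\<chi> \<in> quotC e" "\<Psi>' \<in> positive_products quotC a"
    using Suc.prems unfolding positive_products.simps by blast
  obtain \<psi> r t where \<psi>: "\<chi> = quot_map (loc_minus scale \<eta>) locH locN (loc_map scale \<eta> (p ^ e) \<psi> \<circ> loc_scale scale \<eta> r t)"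
    "\<psi> \<in> cartier_alg p scale \<kappa> f c e" "t \<notin> \<eta>"
    using \<Psi>(3) unfolding loc_alg_def by blast
  obtain \<phi> s' where \<phi>: "\<phi> \<in> positive_products (cartier_alg p scale \<kappa> f c) a" "s' \<notin> \<eta>"
    "\<Psi>' (frac_coset m s) = frac_coset (\<phi> m) s'" using Suc.IH[OF \<Psi>(4)] by blast
  let ?\<psi> = "\<lambda>m. \<psi> (((t * s') ^ (p ^ e - 1) * r) *s m)"
  have "\<Psi> (frac_coset m s) = frac_coset ((?\<psi> \<circ> \<phi>) m) (t * s')"
    using quot_map_frac_coset[OF \<Psi>(2) \<psi>(2,3) positive_products_H0[OF \<phi>(1) assms(2)] \<phi>(2)]
    by (simp add: \<Psi>(1) \<psi>(1) \<phi>(3))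
  moreover have "?\<psi> \<circ> \<phi> \<in> positive_products (cartier_alg p scale \<kappa> f c) (Suc a)"
    unfolding positive_products.simps using alg_facts(6)[OF \<Psi>(2) \<psi>(2)] \<Psi>(2) \<phi>(1) by blast
  ultimately show ?case using mult_notin[OF \<psi>(3) \<phi>(2)] by blast
qed

lemma frac_coset_eq_locN:
  assumes m: "m \<in> H0 scale \<eta> UNIV" and s: "s \<notin> \<eta>" and u: "u \<notin> \<eta>" "u *s m \<in> N"
  shows "frac_coset m s = locN"
proof (intro subset_antisym subsetI)
  fix y assume "y \<in> frac_coset m s"
  then obtain n t where n: "y = loc_frac scale \<eta> n t" "n \<in> H0 scale \<eta> UNIV" "t \<notin> \<eta>" "frac_near N m s n t"
    by (auto simp: frac_coset_def)
  obtain v where v: "v \<notin> \<eta>" "v *s (t *s m - s *s n) \<in> N" using n(4) by (auto simp: frac_near_def)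
  have "(u * v * s) *s n = (v * t) *s (u *s m) - u *s (v *s (t *s m - s *s n))"
    by (simp add: scale_right_diff_distrib ac_simps)
  also have "\<dots> \<in> N" by (intro subspace_diff[OF subspace_N] subspace_scale[OF subspace_N] u v)
  finally show "y \<in> locN" unfolding n(1)
    using mem_loc_module_iff[OF subspace_N n(2,3)] mult_notin[OF mult_notin[OF u(1) v(1)] s] by blast
next
  fix y assume "y \<in> locN"
  then obtain n t where n: "y = loc_frac scale \<eta> n t" "n \<in> H0 scale \<eta> N" "t \<notin> \<eta>"
    by (auto simp: loc_module_def)
  then have nN: "n \<in> N" "n \<in> H0 scale \<eta> UNIV" by (auto simp: H0_def)
  have "u *s (t *s m - s *s n) = t *s (u *s m) - (u * s) *s n"
    by (simp add: scale_right_diff_distrib ac_simps)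
  also have "\<dots> \<in> N" by (intro subspace_diff[OF subspace_N] subspace_scale[OF subspace_N] u nN)
  finally have "frac_near N m s n t" using u(1) by (auto simp: frac_near_def)
  then show "y \<in> frac_coset m s" unfolding n(1) by (intro frac_coset_memI nN n)
qed

text \<open>The kernel of an inclusion is zero, so only the cokernel matters; its nilpotence is here expressed
in \<open>M\<close> itself.\<close>
lemma nil_isomorphism_iff:
  "nil_isomorphism (loc_minus scale \<eta>) (loc_frac scale \<eta> 0 1) locC locN locH id \<longleftrightarrow>
   (\<exists>a. \<forall>\<phi>\<in>positive_products (cartier_alg p scale \<kappa> f c) a. \<forall>m\<in>H0 scale \<eta> UNIV. \<exists>s. s \<notin> \<eta> \<and> s *s \<phi> m \<in> N)"
  (is "?L \<longleftrightarrow> ?R")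
proof
  assume ?L
  then obtain a where a: "\<And>\<Psi> X. \<Psi> \<in> positive_products quotC a \<Longrightarrow> X \<in> quot (loc_minus scale \<eta>) locH locN \<Longrightarrow> \<Psi> X = locN"
    unfolding nil_isomorphism_def nilpotent_module_def by auto
  have "\<exists>s. s \<notin> \<eta> \<and> s *s \<phi> m \<in> N"
    if \<phi>: "\<phi> \<in> positive_products (cartier_alg p scale \<kappa> f c) a" and m: "m \<in> H0 scale \<eta> UNIV" for \<phi> m
  proof -
    obtain \<Psi> where \<Psi>: "\<Psi> \<in> positive_products quotC a" 
      "loc_frac scale \<eta> m 1 \<in> X \<Longrightarrow> loc_frac scale \<eta> (\<phi> m) 1 \<in> \<Psi> X" for X
      using positive_product_lift[OF \<phi>] m by blast
    have "loc_frac scale \<eta> (\<phi> m) 1 \<in> \<Psi> (frac_coset m 1)"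
      by (intro \<Psi>(2) frac_coset_memI m one_notin frac_near_refl subspace_N)
    moreover have "frac_coset m 1 \<in> quot (loc_minus scale \<eta>) locH locN"
      unfolding quot_eq_frac_coset using m one_notin by blast
    ultimately have "loc_frac scale \<eta> (\<phi> m) 1 \<in> locN" using a[OF \<Psi>(1)] by blast
    then show ?thesis
      using mem_loc_module_iff[OF subspace_N positive_products_H0[OF \<phi> m] one_notin] by blast
  qed
  then show ?R by blast
next
  assume ?R
  then obtain a where a: "\<And>\<phi> m. \<phi> \<in> positive_products (cartier_alg p scale \<kappa> f c) a \<Longrightarrow> m \<in> H0 scale \<eta> UNIV \<Longrightarrow>
    \<exists>s. s \<notin> \<eta> \<and> s *s \<phi> m \<in> N" by blast
  have "\<Psi> X = locN" if \<Psi>: "\<Psi> \<in> positive_products quotC a" and X: "X \<in> quot (loc_minus scale \<eta>) locH locN" for \<Psi> X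
  proof -
    obtain m s where m: "m \<in> H0 scale \<eta> UNIV" "s \<notin> \<eta>" "X = frac_coset m s"
      using X unfolding quot_eq_frac_coset by blast
    obtain \<phi> t where \<phi>: "\<phi> \<in> positive_products (cartier_alg p scale \<kappa> f c) a" "t \<notin> \<eta>" "\<Psi> X = frac_coset (\<phi> m) t"
      using positive_products_frac_coset[OF \<Psi> m(1,2)] m(3) by blast
    obtain u where "u \<notin> \<eta>" "u *s \<phi> m \<in> N" using a[OF \<phi>(1) m(1)] by blast
    then show ?thesis using frac_coset_eq_locN[OF positive_products_H0[OF \<phi>(1) m(1)] \<phi>(2)] \<phi>(3) by blast
  qed
  then have "nilpotent_module quotC (quot (loc_minus scale \<eta>) locH locN) locN"
    unfolding nilpotent_module_def by blast
  moreover have "nilpotent_module locC {x \<in> locN. id x = loc_frac scale \<eta> 0 1} (loc_frac scale \<eta> 0 1)"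
    unfolding nilpotent_module_def by (rule exI[of _ 0]) simp
  ultimately show ?L unfolding nil_isomorphism_def by simp
qed

end
end

lemma nilpotent_cokernel_iff_iterate:
  assumes c: "c > 0" and \<eta>: "\<eta> \<in> associated_primes scale" "f \<notin> \<eta>"
  shows "(\<exists>a. \<forall>\<phi>\<in>positive_products (cartier_alg p scale \<kappa> f c) a. \<forall>m\<in>H0 scale \<eta> UNIV. \<exists>s. s \<notin> \<eta> \<and> s *s \<phi> m \<in> N)
    \<longleftrightarrow> (\<exists>a. \<forall>m\<in>H0 scale \<eta> UNIV. \<exists>s. s \<notin> \<eta> \<and> s *s (\<kappa> ^^ a) m \<in> N)"
proof
  assume "\<exists>a. \<forall>\<phi>\<in>positive_products (cartier_alg p scale \<kappa> f c) a. \<forall>m\<in>H0 scale \<eta> UNIV. \<exists>s. s \<notin> \<eta> \<and> s *s \<phi> m \<in> N"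
  then obtain a where a: "\<forall>\<phi>\<in>positive_products (cartier_alg p scale \<kappa> f c) a. \<forall>m\<in>H0 scale \<eta> UNIV. \<exists>s. s \<notin> \<eta> \<and> s *s \<phi> m \<in> N" ..
  obtain y where y: "twist a y \<in> positive_products (cartier_alg p scale \<kappa> f c) a"
    using twist_mem_positive_products by blast
  from untwist[OF \<eta> bspec[OF bspec[OF a y]]]
  show "\<exists>a. \<forall>m\<in>H0 scale \<eta> UNIV. \<exists>s. s \<notin> \<eta> \<and> s *s (\<kappa> ^^ a) m \<in> N" by (intro exI[of _ a] ballI)
next
  assume "\<exists>a. \<forall>m\<in>H0 scale \<eta> UNIV. \<exists>s. s \<notin> \<eta> \<and> s *s (\<kappa> ^^ a) m \<in> N"
  then obtain a where a: "\<forall>m\<in>H0 scale \<eta> UNIV. \<exists>s. s \<notin> \<eta> \<and> s *s (\<kappa> ^^ a) m \<in> N" ..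
  have "\<exists>s. s \<notin> \<eta> \<and> s *s \<phi> m \<in> N" if \<phi>: "\<phi> \<in> positive_products (cartier_alg p scale \<kappa> f c) a"
    and m: "m \<in> H0 scale \<eta> UNIV" for \<phi> m
  proof -
    obtain d x r where d: "a \<le> d" "\<phi> = (\<lambda>m. twist d x (r *s m))"
      using positive_products_form[OF c \<phi>] by blast
    have "\<phi> m = (\<kappa> ^^ a) (twist (d - a) x (r *s m))"
      using d by (simp add: twist_def flip: funpow_add o_apply[of "\<kappa> ^^ a"])
    then show ?thesis
      using bspec[OF a twist_H0[OF subspace_scale[OF subspace_H0[OF subspace_UNIV] m]]] by simp
  qed
  then show "\<exists>a. \<forall>\<phi>\<in>positive_products (cartier_alg p scale \<kappa> f c) a. \<forall>m\<in>H0 scale \<eta> UNIV. \<exists>s. s \<notin> \<eta> \<and> s *s \<phi> m \<in> N"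
    by blast
qed

text \<open>A fixed power \<open>f\<^sup>n\<close> kills the finitely generated module \<open>H\<^sup>0\<^sub>\<eta>(M)\<close>, and products of more than
\<open>n / c\<close> factors carry at least \<open>f\<^sup>n\<close>; here \<open>c > 0\<close> is essential.\<close>
lemma H0_nilpotent:
  assumes c: "c > 0" and f: "f \<in> \<eta>" and fg: "finite W" "W \<subseteq> H0 scale \<eta> UNIV" "H0 scale \<eta> UNIV \<subseteq> span W"
  shows "\<exists>a. \<forall>\<phi>\<in>positive_products (cartier_alg p scale \<kappa> f c) a. \<forall>m\<in>H0 scale \<eta> UNIV. \<phi> m = 0"
proof -
  have "\<exists>n. f ^ n *s w = 0" if "w \<in> W" for w
    using that fg(2) power_mem_ideal_power[OF f] by (fastforce simp: H0_def)
  then obtain k where k: "\<And>w. w \<in> W \<Longrightarrow> f ^ k w *s w = 0" by metis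
  define n where "n = Max (insert 0 (k ` W))"
  have "f ^ n *s w = 0" if w: "w \<in> W" for w
  proof -
    have "k w \<le> n" using w fg(1) by (simp add: n_def)
    then have "f ^ n *s w = f ^ (n - k w) *s (f ^ k w *s w)" by (simp flip: power_add)
    then show ?thesis using k[OF w] by simp
  qed
  moreover have "subspace {m. f ^ n *s m = 0}"
    by (rule subspaceI) (auto simp: scale_right_distrib scale_left_commute[of "f ^ n"] simp del: scale_scale)
  ultimately have "span W \<subseteq> {m. f ^ n *s m = 0}" by (intro span_minimal) auto
  then have kill: "f ^ n *s m = 0" if "m \<in> H0 scale \<eta> UNIV" for m using that fg(3) by blast
  obtain a :: nat where a: "of_nat n < of_nat a * c" using reals_Archimedean3[OF c] 
    by (metis ex_less_of_nat_mult c)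
  have "\<phi> m = 0" if \<phi>: "\<phi> \<in> positive_products (cartier_alg p scale \<kappa> f c) a" and m: "m \<in> H0 scale \<eta> UNIV" for \<phi> m
  proof -
    obtain d x r where d: "a \<le> d" "c * of_nat d \<le> of_nat x" "\<phi> = (\<lambda>m. twist d x (r *s m))"
      using positive_products_form[OF c \<phi>] by blast
    have "of_nat n < (of_nat a * c :: rat)" by (rule a)
    also have "\<dots> \<le> of_nat d * c" using d(1) c by simp
    also have "\<dots> \<le> of_nat x" using d(2) by (simp add: mult.commute)
    finally have "n \<le> x" by simp
    then have "f ^ x *s (r *s m) = (f ^ (x - n) * r) *s (f ^ n *s m)"
      by (simp add: ac_simps flip: power_add)
    then show ?thesis using kill[OF m] by (simp add: d(3) twist_def \<kappa>_pow_zero)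
  qed
  then show ?thesis by blast
qed

section \<open>Candidates for the test module\<close>
definition test_candidate :: "rat \<Rightarrow> 'm set \<Rightarrow> bool" where
  "test_candidate c N \<longleftrightarrow> subspace N \<and> (\<forall>e\<ge>1. twist e (cexp c e) ` N \<subseteq> N) \<and> kappa_dense N"

lemma cartier_submodule_iff:
  "cartier_submodule scale (cartier_alg p scale \<kappa> f c) N \<longleftrightarrow> subspace N \<and> (\<forall>e\<ge>1. twist e (cexp c e) ` N \<subseteq> N)"
proof (intro iffI conjI allI impI)
  assume N: "cartier_submodule scale (cartier_alg p scale \<kappa> f c) N"
  then show "subspace N" by (simp add: cartier_submodule_def)
  fix e :: nat assume "e \<ge> 1"
  then have "(\<lambda>m. twist e (cexp c e) (1 *s m)) \<in> cartier_alg p scale \<kappa> f c e"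
    by (intro cartier_alg_memI) auto
  then show "twist e (cexp c e) ` N \<subseteq> N" using N by (auto simp: cartier_submodule_def)
next
  assume N: "subspace N \<and> (\<forall>e\<ge>1. twist e (cexp c e) ` N \<subseteq> N)"
  have "\<phi> ` N \<subseteq> N" if \<phi>: "\<phi> \<in> cartier_alg p scale \<kappa> f c e" for e \<phi>
  proof (cases "e \<ge> 1")
    case True
    obtain r where r: "\<phi> = (\<lambda>m. twist e (cexp c e) (r *s m))" using cartier_alg_mem[OF True \<phi>] .
    show ?thesis unfolding r using N True subspace_scale by blast
  next
    case False
    then show ?thesis using \<phi> N subspace_scale by (auto simp: cartier_alg_def)
  qed
  then show "cartier_submodule scale (cartier_alg p scale \<kappa> f c) N"
    using N by (simp add: cartier_submodule_def)
qed

lemma test_condition_iff: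
  assumes c: "c > 0"
    and fg: "\<And>N. subspace N \<Longrightarrow> \<exists>W. finite W \<and> W \<subseteq> N \<and> N \<subseteq> span W"
  shows "test_condition p scale (cartier_alg p scale \<kappa> f c) N \<longleftrightarrow> test_candidate c N"
proof (cases "cartier_submodule scale (cartier_alg p scale \<kappa> f c) N")
  case True
  then have N: "subspace N" by (simp add: cartier_submodule_def)
  let ?P = "\<lambda>\<eta>. \<exists>a. \<forall>\<phi>\<in>positive_products (cartier_alg p scale \<kappa> f c) a. \<forall>m\<in>H0 scale \<eta> UNIV. \<exists>s. s \<notin> \<eta> \<and> s *s \<phi> m \<in> N"
  let ?K = "\<lambda>\<eta>. \<exists>a. \<forall>m\<in>H0 scale \<eta> UNIV. \<exists>s. s \<notin> \<eta> \<and> s *s (\<kappa> ^^ a) m \<in> N"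
  have "?P \<eta> \<longleftrightarrow> (f \<notin> \<eta> \<longrightarrow> ?K \<eta>)" if \<eta>: "\<eta> \<in> associated_primes scale" for \<eta>
  proof (cases "f \<in> \<eta>")
    case f: True
    obtain W where "finite W" "W \<subseteq> H0 scale \<eta> UNIV" "H0 scale \<eta> UNIV \<subseteq> span W"
      using fg[OF subspace_H0[OF subspace_UNIV]] by blast
    from H0_nilpotent[OF c f this] obtain a where
      a: "\<forall>\<phi>\<in>positive_products (cartier_alg p scale \<kappa> f c) a. \<forall>m\<in>H0 scale \<eta> UNIV. \<phi> m = 0" ..
    have "?P \<eta>"
    proof (intro exI[of _ a] ballI)
      fix \<phi> m assume "\<phi> \<in> positive_products (cartier_alg p scale \<kappa> f c) a" "m \<in> H0 scale \<eta> UNIV"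
      then have "\<phi> m = 0" using a by blast
      then show "\<exists>s. s \<notin> \<eta> \<and> s *s \<phi> m \<in> N"
        using assoc_prime_facts(1)[OF \<eta>] subspace_0[OF N] by (intro exI[of _ 1]) simp
    qed
    then show ?thesis using f by blast
  next
    case False
    then show ?thesis using nilpotent_cokernel_iff_iterate[OF c \<eta> False] by simp
  qed
  then have "(\<forall>\<eta>\<in>associated_primes scale. ?P \<eta>) \<longleftrightarrow> kappa_dense N"
    unfolding kappa_dense_def by (intro ball_cong refl)
  then show ?thesis
    using True nil_isomorphism_iff[OF _ True]
    unfolding test_condition_def test_candidate_def cartier_submodule_iff by simp
next
  case False
  then show ?thesis
    unfolding test_condition_def test_candidate_def using cartier_submodule_iff by blast
qed

lemma cexp_add: "cexp c (d + e) \<le> cexp c d * p ^ e + cexp c e"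
proof -
  have "c * of_nat (p ^ (d + e)) = (c * of_nat (p ^ d)) * of_nat (p ^ e)" by (simp add: power_add)
  also have "\<dots> \<le> of_nat (cexp c d) * of_nat (p ^ e)"
    by (rule mult_right_mono[OF cexp_ge]) simp
  also have "\<dots> \<le> of_nat (cexp c d * p ^ e + cexp c e)" by simp
  finally show ?thesis by (simp only: cexp_le_iff)
qed

lemma cexp_mono: "c \<le> c' \<Longrightarrow> cexp c e \<le> cexp c' e"
  unfolding cexp_le_iff by (rule order_trans[OF mult_right_mono cexp_ge]) auto

lemma twist_le_image:
  assumes "subspace N" "x \<le> y"
  shows "twist e y ` N \<subseteq> twist e x ` N"
proof -
  have "twist e y n = twist e x (f ^ (y - x) *s n)" for n
    using twist_absorb[of e x "y - x" n] assms(2) by simp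
  then show ?thesis using subspace_scale[OF assms(1)] by auto
qed

lemma twist_span_subset:
  assumes N: "subspace N" and G: "\<And>g r. g \<in> G \<Longrightarrow> twist d x (r *s g) \<in> N"
  shows "twist d x ` span G \<subseteq> N"
proof -
  have "subspace {m. \<forall>r. twist d x (r *s m) \<in> N}"
    by (rule subspaceI)
       (auto simp: twist_zero scale_right_distrib twist_add intro: subspace_0[OF N] subspace_add[OF N])
  then have "span G \<subseteq> {m. \<forall>r. twist d x (r *s m) \<in> N}" using G by (intro span_minimal) auto
  then have "twist d x (1 *s m) \<in> N" if "m \<in> span G" for m using that by blast
  then show ?thesis by auto
qed

text \<open>The part of degree at least \<open>j\<close> of the Cartier algebra, applied to \<open>Q\<close>.\<close>
definition cartier_tail :: "rat \<Rightarrow> nat \<Rightarrow> 'm set \<Rightarrow> 'm set" where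
  "cartier_tail c j Q = span (\<Union>e\<in>{j..}. twist e (cexp c e) ` Q)"

text \<open>Composing with an operator of degree \<open>d\<close> only raises degrees, so the tail is stable. Here \<open>Q\<close> can
be a candidate for the same exponent, which is cut down, or for another one, which is compared
with \<open>c\<close>.\<close>
lemma test_candidate_cartier_tail:
  assumes Q: "subspace Q" "kappa_dense Q"
  shows "test_candidate c (cartier_tail c j Q)"
  unfolding test_candidate_def
proof (intro conjI allI impI)
  let ?N = "cartier_tail c j Q"
  show N: "subspace ?N" by (simp add: cartier_tail_def)
  show "kappa_dense ?N"
    by (rule kappa_dense_twist[OF Q(2,1), of j "cexp c j"]) (auto simp: cartier_tail_def intro!: span_base)
  fix d :: nat assume "d \<ge> 1"
  show "twist d (cexp c d) ` ?N \<subseteq> ?N"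
  proof (subst (1) cartier_tail_def, rule twist_span_subset[OF N])
    fix g r assume "g \<in> (\<Union>e\<in>{j..}. twist e (cexp c e) ` Q)"
    then obtain e q where g: "e \<ge> j" "q \<in> Q" "g = twist e (cexp c e) q" by auto
    have "twist d (cexp c d) (r *s g) = twist (d + e) (cexp c d * p ^ e + cexp c e) (r ^ (p ^ e) *s q)"
      by (simp only: g(3) twist_frob twist_twist)
    also have "\<dots> \<in> twist (d + e) (cexp c (d + e)) ` Q"
      using twist_le_image[OF Q(1) cexp_add[of c d e], of "d + e"] subspace_scale[OF Q(1) g(2)] by blast
    also have "\<dots> \<subseteq> ?N" unfolding cartier_tail_def using g(1) by (intro subset_trans[OF _ span_superset]) force
    finally show "twist d (cexp c d) (r *s g) \<in> ?N" .
  qed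
qed

lemma test_candidate_Int: "test_candidate c N \<Longrightarrow> test_candidate c N' \<Longrightarrow> test_candidate c (N \<inter> N')"
  unfolding test_candidate_def
  by (intro conjI allI impI kappa_dense_Int subspace_inter) (auto simp: image_subset_iff)

lemma test_candidate_mono:
  assumes "test_candidate c N" "c \<le> c'"
  shows "test_candidate c' N"
proof -
  have N: "subspace N" "kappa_dense N" "\<And>e. e \<ge> 1 \<Longrightarrow> twist e (cexp c e) ` N \<subseteq> N"
    using assms(1) by (auto simp: test_candidate_def)
  have "twist e (cexp c' e) ` N \<subseteq> N" if "e \<ge> 1" for e
    by (rule subset_trans[OF twist_le_image[OF N(1) cexp_mono[OF assms(2)]] N(3)[OF that]])
  then show ?thesis using N(1,2) by (simp add: test_candidate_def)
qed

lemma test_candidate_UNIV: "test_candidate c UNIV"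
  by (simp add: test_candidate_def kappa_dense_UNIV)

text \<open>Stability rests on \<open>p\<^sup>E \<lceil>c' p\<^sup>d\<rceil> \<ge> c' p\<^sup>d p\<^sup>E = (c + b) p\<^sup>d\<close>: after the
\<open>p\<^sup>d\<close>-th power of \<open>f\<^sup>b\<close> has been moved through \<open>\<kappa>\<^sup>d\<close>, at least \<open>\<lceil>c p\<^sup>d\<rceil>\<close> factors \<open>f\<close> are left.\<close>
lemma test_candidate_twist_image:
  assumes c: "0 < c" and Q: "test_candidate c Q" and c': "of_nat (p ^ E) * c' = c + of_nat b"
  shows "test_candidate c' (twist E b ` Q)"
proof -
  have sQ: "subspace Q" and CQ: "\<And>e. e \<ge> 1 \<Longrightarrow> twist e (cexp c e) ` Q \<subseteq> Q" and K: "kappa_dense Q"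
    using Q by (auto simp: test_candidate_def)
  have "twist d (cexp c' d) (twist E b q) \<in> twist E b ` Q" if d: "d \<ge> 1" and q: "q \<in> Q" for d q
  proof -
    have "(c + of_nat b) * of_nat (p ^ d) = (c' * of_nat (p ^ d)) * of_nat (p ^ E)"
      unfolding c'[symmetric] by simp
    also have "\<dots> \<le> of_nat (cexp c' d) * of_nat (p ^ E)" by (rule mult_right_mono[OF cexp_ge]) simp
    finally have le: "c * of_nat (p ^ d) + of_nat (b * p ^ d) \<le> of_nat (cexp c' d * p ^ E)"
      by (simp add: algebra_simps)
    have "(0::rat) \<le> c * of_nat (p ^ d)" using c by simp
    then have "of_nat (b * p ^ d) \<le> (of_nat (cexp c' d * p ^ E) :: rat)" using le by linarith
    then have le': "b * p ^ d \<le> cexp c' d * p ^ E" by (simp only: of_nat_le_iff)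
    have "cexp c d \<le> cexp c' d * p ^ E - b * p ^ d"
      unfolding cexp_le_iff using le by (simp only: of_nat_diff[OF le'])
    then have "cexp c d + b * p ^ d \<le> cexp c' d * p ^ E + b" using le' by linarith
    then obtain y where y: "cexp c' d * p ^ E + b = b * p ^ d + (cexp c d + y)"
      by (metis add.assoc add.commute le_Suc_ex)
    have "twist d (cexp c' d) (twist E b q) = twist (E + d) (b * p ^ d + (cexp c d + y)) q"
      by (simp only: twist_twist y add.commute[of d E])
    also have "\<dots> = twist E b (twist d (cexp c d + y) q)" by (simp only: twist_twist)
    finally show ?thesis
      using twist_le_image[OF sQ le_add1, of d "cexp c d" y] CQ[OF d] q by blast
  qed
  moreover have "kappa_dense (twist E b ` Q)" by (rule kappa_dense_twist[OF K sQ order_refl])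
  ultimately show ?thesis using subspace_twist_image[OF sQ] by (auto simp: test_candidate_def)
qed

end

section \<open>Test modules in the presence of a gauge\<close>

text \<open>A gauge consists of finite-dimensional spaces \<open>V b\<close> such that, whatever the submodule \<open>N\<close>, the
images \<open>\<kappa>\<^sup>e f\<^sup>x N\<close> with \<open>x \<le> b p\<^sup>e\<close> are generated by elements of \<open>V b\<close> once \<open>e\<close> is large. Only the
bound on \<open>e\<close> may depend on \<open>N\<close>.\<close>
locale gauged_cartier_pair = cartier_pair scale p \<kappa> f + K: linear_operators kscale
  for scale :: "'r::comm_ring_1 \<Rightarrow> 'm::ab_group_add \<Rightarrow> 'm" (infixr "*s" 75) and p \<kappa> f
    and kscale :: "'k::field \<Rightarrow> 'm \<Rightarrow> 'm" +
  fixes V :: "nat \<Rightarrow> 'm set"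
  assumes fin_gen: "subspace N \<Longrightarrow> \<exists>W. finite W \<and> W \<subseteq> N \<and> N \<subseteq> span W"
    and k_subspace: "subspace N \<Longrightarrow> K.subspace N"
    and subspace_V: "K.subspace (V b)"
    and finite_V: "\<exists>B. finite B \<and> V b \<subseteq> K.span B"
    and gauge: "subspace N \<Longrightarrow>
      \<exists>e0. \<forall>e\<ge>e0. \<forall>x \<le> b * p ^ e. twist e x ` N \<subseteq> span (twist e x ` N \<inter> V b)"
begin

text \<open>The tail of the Cartier algebra that starts beyond the bound of the gauge cuts \<open>N\<close> down to a
candidate generated by elements of \<open>V b\<close>.\<close>
lemma bounded_candidate:
  assumes c: "c \<le> of_nat b" and N: "test_candidate c N"
  shows "\<exists>N'. test_candidate c N' \<and> N' \<subseteq> N \<and> N' \<subseteq> span (N' \<inter> V b)"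
proof -
  have sN: "subspace N" and CN: "\<And>e. e \<ge> 1 \<Longrightarrow> twist e (cexp c e) ` N \<subseteq> N" and K: "kappa_dense N"
    using N by (auto simp: test_candidate_def)
  obtain e0 where e0: "\<And>e x. e \<ge> e0 \<Longrightarrow> x \<le> b * p ^ e \<Longrightarrow> twist e x ` N \<subseteq> span (twist e x ` N \<inter> V b)"
    using gauge[OF sN] by blast
  define N' where "N' = cartier_tail c (max 1 e0) N"
  have "N' \<subseteq> N"
    unfolding N'_def cartier_tail_def by (rule span_minimal[OF _ sN]) (use CN in fastforce)
  moreover have "N' \<subseteq> span (N' \<inter> V b)"
  proof -
    have "twist e (cexp c e) ` N \<subseteq> span (N' \<inter> V b)" if "e \<ge> max 1 e0" for e
    proof -
      have "c * of_nat (p ^ e) \<le> of_nat b * of_nat (p ^ e)" by (rule mult_right_mono[OF c]) simp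
      then have "cexp c e \<le> b * p ^ e" by (simp add: cexp_le_iff)
      then have "twist e (cexp c e) ` N \<subseteq> span (twist e (cexp c e) ` N \<inter> V b)" using that by (intro e0) auto
      also have "\<dots> \<subseteq> span (N' \<inter> V b)"
      proof (intro span_mono Int_mono order_refl)
        show "twist e (cexp c e) ` N \<subseteq> N'"
          unfolding N'_def cartier_tail_def using that by (intro subset_trans[OF _ span_superset]) auto
      qed
      finally show ?thesis .
    qed
    then have "(\<Union>e\<in>{max 1 e0..}. twist e (cexp c e) ` N) \<subseteq> span (N' \<inter> V b)" by (intro UN_least) simp
    from span_minimal[OF this subspace_span] show ?thesis
      unfolding cartier_tail_def[symmetric] N'_def[symmetric] .
  qed
  moreover have "test_candidate c N'" unfolding N'_def by (rule test_candidate_cartier_tail[OF sN K])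
  ultimately show ?thesis by (intro exI[of _ N']) simp
qed

lemma V_part_eq:
  assumes "subspace N" "subspace N'" "N \<subseteq> N'" "K.dim (N' \<inter> V b) \<le> K.dim (N \<inter> V b)"
  shows "N \<inter> V b = N' \<inter> V b"
proof -
  obtain B where B: "finite B" "V b \<subseteq> K.span B" using finite_V by blast
  show ?thesis
    by (rule K.subspace_eq_if_dim_le[OF B(1)])
       (use assms B(2) k_subspace subspace_V in \<open>auto intro: K.subspace_inter\<close>)
qed

text \<open>Among the candidates generated in \<open>V b\<close> take one, \<open>N\<close>, whose trace on \<open>V b\<close> has least dimension.
For any other candidate \<open>N'\<close>, cutting down \<open>N \<inter> N'\<close> gives a candidate with the same trace, hence
equal to \<open>N\<close>.\<close>
lemma least_candidate:
  assumes c: "c \<le> of_nat b"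
  shows "\<exists>N. test_candidate c N \<and> N \<subseteq> span (N \<inter> V b) \<and> (\<forall>N'. test_candidate c N' \<longrightarrow> N \<subseteq> N')"
proof -
  let ?P = "\<lambda>N. test_candidate c N \<and> N \<subseteq> span (N \<inter> V b)"
  obtain N0 where "?P N0" using bounded_candidate[OF c test_candidate_UNIV] by blast
  from ex_has_least_nat[of ?P, OF this, of "\<lambda>N. K.dim (N \<inter> V b)"]
  obtain N where N: "?P N" and least: "\<forall>N'. ?P N' \<longrightarrow> K.dim (N \<inter> V b) \<le> K.dim (N' \<inter> V b)" by blast
  have "N \<subseteq> N'" if N': "test_candidate c N'" for N'
  proof -
    obtain N'' where N'': "test_candidate c N''" "N'' \<subseteq> N \<inter> N'" "N'' \<subseteq> span (N'' \<inter> V b)"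
      using bounded_candidate[OF c test_candidate_Int[OF conjunct1[OF N] N']] by blast
    have s: "subspace N''" "subspace N" using N'' N by (auto simp: test_candidate_def)
    have "N'' \<inter> V b = N \<inter> V b" by (rule V_part_eq[OF s]) (use N'' least in auto)
    then have "span (N \<inter> V b) \<subseteq> span N''" by (intro span_mono) blast
    also have "span N'' = N''" using s(1) by (simp add: span_eq_iff)
    finally have "N \<subseteq> N''" by (rule subset_trans[OF conjunct2[OF N]])
    then show ?thesis using N''(2) by blast
  qed
  then show ?thesis using N by (intro exI[of _ N]) simp
qed

definition tau :: "rat \<Rightarrow> 'm set" where
  "tau c = test_module p scale \<kappa> f c"

lemma tau_facts:
  assumes c: "0 < c"
  shows tau_candidate: "test_candidate c (tau c)"
    and tau_least: "\<And>N. test_candidate c N \<Longrightarrow> tau c \<subseteq> N"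
    and tau_generated: "\<And>b. c \<le> of_nat b \<Longrightarrow> tau c \<subseteq> span (tau c \<inter> V b)"
proof -
  have eq: "tau c = N" if "test_candidate c N" "\<And>N'. test_candidate c N' \<Longrightarrow> N \<subseteq> N'" for N
  proof -
    have "test_condition p scale (cartier_alg p scale \<kappa> f c) = test_candidate c"
      by (rule ext, rule test_condition_iff[OF c fin_gen])
    then show ?thesis
      unfolding tau_def test_module_def by (simp only:) (rule Least_equality, use that in auto)
  qed
  have *: "test_candidate c (tau c) \<and> (\<forall>N. test_candidate c N \<longrightarrow> tau c \<subseteq> N) \<and> tau c \<subseteq> span (tau c \<inter> V b)"
    if b: "c \<le> of_nat b" for b
  proof -
    obtain N where N: "test_candidate c N" "N \<subseteq> span (N \<inter> V b)" "\<forall>N'. test_candidate c N' \<longrightarrow> N \<subseteq> N'"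
      using least_candidate[OF b] by blast
    have "tau c = N" by (rule eq) (use N in auto)
    then show ?thesis using N by simp
  qed
  have "c \<le> of_nat (nat \<lceil>c\<rceil>)" by linarith
  from *[OF this] show "test_candidate c (tau c)" "\<And>N. test_candidate c N \<Longrightarrow> tau c \<subseteq> N" by auto
  show "\<And>b. c \<le> of_nat b \<Longrightarrow> tau c \<subseteq> span (tau c \<inter> V b)" using * by blast
qed

lemma subspace_tau: "0 < c \<Longrightarrow> subspace (tau c)"
  using tau_candidate by (simp add: test_candidate_def)

lemma tau_antimono: "0 < c \<Longrightarrow> c \<le> c' \<Longrightarrow> tau c' \<subseteq> tau c"
  by (rule tau_least) (auto intro: test_candidate_mono tau_candidate)

text \<open>By minimality \<open>\<tau>(c)\<close> lies in the candidate \<open>\<Sum>\<^sub>d\<^sub>\<ge>\<^sub>1 \<kappa>\<^sup>d f\<^sup>x \<tau>(c')\<close>, \<open>x = \<lceil>c p\<^sup>d\<rceil>\<close>, and \<open>\<kappa>\<^sup>e f\<^sup>a\<close>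
maps the latter into \<open>\<tau>(c')\<close>, since \<open>a p\<^sup>d + c p\<^sup>d \<ge> c' p\<^sup>e\<^sup>+\<^sup>d\<close>.\<close>
lemma twist_tau_subset:
  assumes c: "0 < c" "0 < c'" and le: "of_nat (p ^ e) * c' \<le> c + of_nat a"
  shows "twist e a ` tau c \<subseteq> tau c'"
proof -
  let ?Q = "tau c'"
  have Q: "subspace ?Q" "kappa_dense ?Q" "\<And>e. e \<ge> 1 \<Longrightarrow> twist e (cexp c' e) ` ?Q \<subseteq> ?Q"
    using tau_candidate[OF c(2)] by (auto simp: test_candidate_def)
  have "tau c \<subseteq> cartier_tail c 1 ?Q" by (rule tau_least[OF c(1) test_candidate_cartier_tail[OF Q(1,2)]])
  moreover have "twist e a ` cartier_tail c 1 ?Q \<subseteq> ?Q"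
    unfolding cartier_tail_def
  proof (rule twist_span_subset[OF Q(1)])
    fix g r assume "g \<in> (\<Union>e\<in>{1..}. twist e (cexp c e) ` ?Q)"
    then obtain d q where g: "d \<ge> 1" "q \<in> ?Q" "g = twist d (cexp c d) q" by auto
    have "c' * of_nat (p ^ (e + d)) = (of_nat (p ^ e) * c') * of_nat (p ^ d)" by (simp add: power_add)
    also have "\<dots> \<le> (c + of_nat a) * of_nat (p ^ d)" by (rule mult_right_mono[OF le]) simp
    also have "\<dots> \<le> of_nat (a * p ^ d + cexp c d)" using cexp_ge[of c d] by (simp add: algebra_simps)
    finally have x: "cexp c' (e + d) \<le> a * p ^ d + cexp c d" by (simp only: cexp_le_iff)
    have "twist e a (r *s g) = twist (e + d) (a * p ^ d + cexp c d) (r ^ (p ^ d) *s q)"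
      by (simp only: g(3) twist_frob twist_twist)
    also have "\<dots> \<in> twist (e + d) (cexp c' (e + d)) ` ?Q"
      using twist_le_image[OF Q(1) x, of "e + d"] subspace_scale[OF Q(1) g(2)] by blast
    finally show "twist e a (r *s g) \<in> ?Q" using Q(3)[of "e + d"] g(1) by auto
  qed
  ultimately show ?thesis by blast
qed

lemma tau_subset_twist:
  assumes "0 < c" "0 < c'" "of_nat (p ^ e) * c' = c + of_nat a"
  shows "tau c' \<subseteq> twist e a ` tau c"
  by (rule tau_least[OF assms(2) test_candidate_twist_image[OF assms(1) tau_candidate[OF assms(1)] assms(3)]])

text \<open>For \<open>c < \<lambda>\<close> all \<open>\<tau>(c)\<close> are generated by elements of one finite-dimensional space, in which their
traces form a decreasing family.\<close>
lemma left_limit: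
  assumes lam: "0 < lam"
  shows "\<exists>L \<delta>. 0 < \<delta> \<and> \<delta> \<le> lam \<and> (\<forall>\<epsilon>. 0 < \<epsilon> \<and> \<epsilon> < \<delta> \<longrightarrow> tau (lam - \<epsilon>) = L)"
proof -
  define b where "b = nat \<lceil>lam\<rceil>"
  have b: "lam \<le> of_nat b" unfolding b_def by linarith
  let ?P = "\<lambda>c. 0 < c \<and> c < lam"
  have "?P (lam / 2)" using lam by simp
  from ex_has_least_nat[of ?P, OF this, of "\<lambda>c. K.dim (tau c \<inter> V b)"]
  obtain c0 where c0: "?P c0" and least: "\<forall>c. ?P c \<longrightarrow> K.dim (tau c0 \<inter> V b) \<le> K.dim (tau c \<inter> V b)" by blast
  have eq: "tau c = tau c0" if c: "c0 \<le> c" "c < lam" for c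
  proof (rule subset_antisym)
    show sub: "tau c \<subseteq> tau c0" using tau_antimono c0 c by blast
    have V_eq: "tau c \<inter> V b = tau c0 \<inter> V b"
      by (rule V_part_eq) (use sub subspace_tau c0 c least in auto)
    have "tau c0 \<subseteq> span (tau c0 \<inter> V b)"
      by (rule tau_generated) (use c0 b in simp_all)
    also have "\<dots> \<subseteq> span (tau c)" by (rule span_mono) (use V_eq in blast)
    also have "span (tau c) = tau c" using subspace_tau[of c] c0 c by (simp add: span_eq_iff)
    finally show "tau c0 \<subseteq> tau c" .
  qed
  show ?thesis
  proof (intro exI[of _ "tau c0"] exI[of _ "lam - c0"] conjI allI impI)
    fix \<epsilon> assume "0 < \<epsilon> \<and> \<epsilon> < lam - c0"
    then show "tau (lam - \<epsilon>) = tau c0" by (intro eq) simp_all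
  qed (use c0 in simp_all)
qed

theorem Gr_nilpotent_iff:
  assumes jump: "F_jumping_number p scale \<kappa> f lam" and e: "e \<ge> 1"
    and a: "of_nat a \<ge> lam * (of_nat (p ^ e) - 1)"
  shows "Gr_nilpotent p scale \<kappa> f lam e a \<longleftrightarrow> of_nat a \<noteq> lam * (of_nat (p ^ e) - 1)"
proof -
  have lam: "0 < lam" using jump by (simp add: F_jumping_number_def)
  obtain L \<delta> where \<delta>: "0 < \<delta>" "\<delta> \<le> lam"
    and L': "\<forall>\<epsilon>. 0 < \<epsilon> \<and> \<epsilon> < \<delta> \<longrightarrow> tau (lam - \<epsilon>) = L"
    using left_limit[OF lam] by blast
  have L: "tau (lam - \<epsilon>) = L" if "0 < \<epsilon>" "\<epsilon> < \<delta>" for \<epsilon> using L' that by simp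
  let ?T = "tau lam"
  have left: "test_module_left p scale \<kappa> f lam = L"
    unfolding test_module_left_def tau_def[symmetric]
  proof (rule the_equality)
    show "\<exists>\<delta>>0. \<delta> \<le> lam \<and> (\<forall>\<epsilon>. 0 < \<epsilon> \<and> \<epsilon> < \<delta> \<longrightarrow> tau (lam - \<epsilon>) = L)" using \<delta> L by blast
    fix N assume "\<exists>\<delta>>0. \<delta> \<le> lam \<and> (\<forall>\<epsilon>. 0 < \<epsilon> \<and> \<epsilon> < \<delta> \<longrightarrow> tau (lam - \<epsilon>) = N)"
    then obtain \<delta>' where \<delta>': "0 < \<delta>'" "\<And>\<epsilon>. 0 < \<epsilon> \<Longrightarrow> \<epsilon> < \<delta>' \<Longrightarrow> tau (lam - \<epsilon>) = N" by blast
    have "0 < min \<delta> \<delta>' / 2" "min \<delta> \<delta>' / 2 < \<delta>" "min \<delta> \<delta>' / 2 < \<delta>'" using \<delta>(1) \<delta>'(1) by auto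
    then show "N = L" using \<delta>'(2) L by metis
  qed
  have sT: "subspace ?T" by (rule subspace_tau[OF lam])
  have \<delta>2: "0 < \<delta> / 2" "\<delta> / 2 < \<delta>" "0 < lam - \<delta> / 2" using \<delta> by auto
  have L2: "L = tau (lam - \<delta> / 2)" using L[OF \<delta>2(1,2)] by simp
  have sL: "subspace L" unfolding L2 by (rule subspace_tau[OF \<delta>2(3)])
  have TL: "?T \<subseteq> L" unfolding L2 using \<delta> by (intro tau_antimono \<delta>2) simp
  have "L \<noteq> ?T"
    using jump \<delta>2 \<delta> unfolding L2 F_jumping_number_def tau_def by (metis less_eq_rat_def order_trans)
  then have LT: "\<not> L \<subseteq> ?T" using TL by blast
  have q1: "(1::rat) \<le> of_nat (p ^ e)" using p_ge_2 by simp
  show ?thesis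
  proof (cases "of_nat a = lam * (of_nat (p ^ e) - 1)")
    case False
    then have gap: "lam * (of_nat (p ^ e) - 1) < of_nat a" using a by simp
    \<comment> \<open>The second bound gives \<open>p\<^sup>e \<lambda> \<le> (\<lambda> - \<epsilon>) + a\<close>.\<close>
    define \<epsilon> where "\<epsilon> = min (\<delta> / 2) (of_nat a - lam * (of_nat (p ^ e) - 1))"
    have \<epsilon>: "0 < \<epsilon>" "\<epsilon> < \<delta>" "\<epsilon> \<le> of_nat a - lam * (of_nat (p ^ e) - 1)"
      using \<delta> gap by (auto simp: \<epsilon>_def)
    have LE: "L = tau (lam - \<epsilon>)" using L[OF \<epsilon>(1,2)] by simp
    have "twist e a ` L \<subseteq> ?T"
      unfolding LE using \<epsilon> \<delta> lam by (intro twist_tau_subset) (auto simp: algebra_simps)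
    moreover have "quot_map (-) L ?T (twist e a) X = ?T" if X: "X \<in> quot (-) L ?T" for X
    proof -
      obtain x where x: "x \<in> L" "X = {(x, y). x \<in> L \<and> y \<in> L \<and> x - y \<in> ?T} `` {x}"
        using X by (auto simp: quot_def quotient_def)
      have xX: "x \<in> X" "X \<subseteq> L" using x subspace_0[OF sT] by auto
      show ?thesis
      proof (intro subset_antisym subsetI)
        fix y assume "y \<in> quot_map (-) L ?T (twist e a) X"
        then obtain z where z: "z \<in> X" "y - twist e a z \<in> ?T" by (auto simp: quot_map_def)
        have "twist e a z \<in> ?T" using z(1) xX(2) calculation by blast
        from subspace_add[OF sT z(2) this] show "y \<in> ?T" by simp
      next
        fix y assume y: "y \<in> ?T"
        have "twist e a x \<in> ?T" using x(1) calculation by blast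
        then have "y - twist e a x \<in> ?T" by (rule subspace_diff[OF sT y])
        then show "y \<in> quot_map (-) L ?T (twist e a) X" using y TL xX(1) by (auto simp: quot_map_def)
      qed
    qed
    ultimately have "Gr_nilpotent p scale \<kappa> f lam e a"
      unfolding Gr_nilpotent_def Gr_map_def Gr_def left tau_def[symmetric] twist_def[symmetric]
      by (intro exI[of _ 1]) simp
    then show ?thesis using False by simp
  next
    case True
    have "\<not> Gr_nilpotent p scale \<kappa> f lam e a"
    proof
      assume "Gr_nilpotent p scale \<kappa> f lam e a"
      then obtain n where n: "\<And>X. X \<in> quot (-) L ?T \<Longrightarrow> (quot_map (-) L ?T (twist e a) ^^ n) X = ?T"
        unfolding Gr_nilpotent_def Gr_map_def Gr_def left tau_def[symmetric] twist_def[symmetric] by blast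
      have "twist e a ` L \<subseteq> L"
      proof -
        have "\<delta> / 2 / of_nat (p ^ e) \<le> \<delta> / 2" using q1 \<delta>(1) by (simp add: divide_le_eq)
        then have \<epsilon>: "0 < \<delta> / 2 / of_nat (p ^ e)" "\<delta> / 2 / of_nat (p ^ e) < \<delta>"
          using divide_pos_pos[OF \<delta>2(1), of "of_nat (p ^ e)"] \<delta>2 q1 by linarith+
        have "twist e a ` tau (lam - \<delta> / 2) \<subseteq> tau (lam - \<delta> / 2 / of_nat (p ^ e))"
        proof (rule twist_tau_subset[OF \<delta>2(3)])
          show "0 < lam - \<delta> / 2 / of_nat (p ^ e)" using \<epsilon> \<delta> by linarith
          have "of_nat (p ^ e) * (\<delta> / 2 / of_nat (p ^ e)) = \<delta> / 2" using p_ge_2 by simp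
          then show "of_nat (p ^ e) * (lam - \<delta> / 2 / of_nat (p ^ e)) \<le> lam - \<delta> / 2 + of_nat a"
            unfolding True right_diff_distrib by (simp add: mult.commute)
        qed
        then show ?thesis unfolding L[OF \<epsilon>] L2[symmetric] .
      qed
      then have iter: "(twist e a ^^ i) x \<in> (quot_map (-) L ?T (twist e a) ^^ i) X \<and> (twist e a ^^ i) x \<in> L"
        if "x \<in> X" "x \<in> L" for i x X
      proof (induction i)
        case (Suc i)
        let ?y = "(twist e a ^^ i) x"
        have "twist e a ?y \<in> L" using Suc \<open>twist e a ` L \<subseteq> L\<close> by blast
        moreover have "twist e a ?y \<in> quot_map (-) L ?T (twist e a) ((quot_map (-) L ?T (twist e a) ^^ i) X)"
          unfolding quot_map_def[of _ _ _ _ "(quot_map (-) L ?T (twist e a) ^^ i) X"]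
          using calculation Suc subspace_0[OF sT] by (intro CollectI conjI bexI[of _ ?y]) simp_all
        ultimately show ?case by simp
      qed (use that in simp)
      have nil: "(twist e a ^^ n) x \<in> ?T" if x: "x \<in> L" for x
      proof -
        let ?X = "{(x, y). x \<in> L \<and> y \<in> L \<and> x - y \<in> ?T} `` {x}"
        have "?X \<in> quot (-) L ?T" unfolding quot_def by (rule quotientI[OF x])
        moreover have "x \<in> ?X" using x subspace_0[OF sT] by auto
        ultimately show ?thesis using iter[OF _ x, of ?X n] n by blast
      qed
      define b where "b = (\<Sum>i<n. a * p ^ (i * e))"
      have b: "of_nat b = lam * (of_nat (p ^ (n * e)) - 1)"
      proof -
        have "(of_nat b :: rat) = of_nat a * (\<Sum>i<n. of_nat (p ^ e) ^ i)"
          by (simp add: b_def sum_distrib_left flip: power_mult) (simp add: mult.commute)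
        also have "\<dots> = lam * ((of_nat (p ^ e) - 1) * (\<Sum>i<n. of_nat (p ^ e) ^ i))" by (simp add: True)
        also have "\<dots> = lam * (of_nat (p ^ e) ^ n - 1)" by (simp only: power_diff_1_eq)
        finally show ?thesis by (simp add: mult.commute[of n e] flip: power_mult)
      qed
      let ?q = "of_nat (p ^ (n * e)) :: rat"
      have q: "1 \<le> ?q" using p_ge_2 by simp
      \<comment> \<open>Chosen such that \<open>p\<^sup>E (\<lambda> - \<epsilon>) = (\<lambda> - \<delta> / 2) + b\<close>, where \<open>E = n e\<close>.\<close>
      define \<epsilon> where "\<epsilon> = \<delta> / 2 / ?q"
      have "\<epsilon> \<le> \<delta> / 2" using q \<delta>(1) by (simp add: \<epsilon>_def divide_le_eq)
      moreover have "0 < \<epsilon>" unfolding \<epsilon>_def by (rule divide_pos_pos[OF \<delta>2(1)]) (use q in linarith)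
      moreover have "?q * \<epsilon> = \<delta> / 2" using p_ge_2 by (simp add: \<epsilon>_def)
      ultimately have \<epsilon>: "0 < \<epsilon>" "\<epsilon> < \<delta>" "?q * \<epsilon> = \<delta> / 2" using \<delta>2 by linarith+
      have "tau (lam - \<epsilon>) \<subseteq> twist (n * e) b ` tau (lam - \<delta> / 2)"
        using \<epsilon> \<delta> by (intro tau_subset_twist) (auto simp: b algebra_simps)
      then have "L \<subseteq> twist (n * e) b ` L" unfolding L[OF \<epsilon>(1,2)] L2[symmetric] .
      also have "\<dots> = (twist e a ^^ n) ` L" by (simp add: twist_funpow b_def)
      also have "\<dots> \<subseteq> ?T" using nil by blast
      finally show False using LT by contradiction
    qed
    then show ?thesis using True by simp
  qed
qed

end

section \<open>The degree filtration over an essentially finite type algebra\<close>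

text \<open>The module \<open>M\<close> is generated over \<open>R = S\<^sup>-\<^sup>1 A\<close> by \<open>B\<close>, the algebra \<open>A\<close> over the field by \<open>X\<close>, and the
field over its \<open>p\<close>-th powers by \<open>Bk\<close>.\<close>
locale cartier_presentation = cartier_pair scale p \<kappa> f
  for scale :: "'r::comm_ring_1 \<Rightarrow> 'm::ab_group_add \<Rightarrow> 'm" (infixr "*s" 75) and p \<kappa> f +
  fixes h :: "'k::field \<Rightarrow> 'a::comm_ring_1" and S :: "'a set" and l :: "'a \<Rightarrow> 'r"
    and X :: "'a set" and B :: "'m set" and Bk :: "'k set"
  assumes hom_h: "ring_hom_on_type h"
    and X: "finite X" "generated_subalgebra h X = UNIV"
    and loc: "is_localization S l"
    and B: "finite B" "span B = UNIV"
    and Bk: "finite Bk" "\<And>c. \<exists>d. c = (\<Sum>b\<in>Bk. d b ^ p * b)"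
begin

lemma h_simps: "h 1 = 1" "h (x + y) = h x + h y" "h (x * y) = h x * h y"
  using hom_h by (auto simp: ring_hom_on_type_def)

lemma l_simps: "l 1 = 1" "l (x + y) = l x + l y" "l (x * y) = l x * l y"
  using loc by (auto simp: is_localization_def ring_hom_on_type_def)

lemma h_0: "h 0 = 0" using h_simps(2)[of 0 0] by simp
lemma l_0: "l 0 = 0" using l_simps(2)[of 0 0] by simp
lemma h_power: "h (x ^ n) = h x ^ n" by (induction n) (auto simp: h_simps)
lemma l_power: "l (x ^ n) = l x ^ n" by (induction n) (auto simp: l_simps)

lemma one_S: "1 \<in> S" and mult_S: "s \<in> S \<Longrightarrow> t \<in> S \<Longrightarrow> s * t \<in> S"
  and unit_S: "s \<in> S \<Longrightarrow> l s dvd 1" and frac_S: "\<exists>a. \<exists>s\<in>S. r * l s = l a"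
  using loc by (auto simp: is_localization_def multiplicative_set_def)

definition act :: "'a \<Rightarrow> 'm \<Rightarrow> 'm" where
  "act a m = l a *s m"

definition ks :: "'k \<Rightarrow> 'm \<Rightarrow> 'm" where
  "ks c = act (h c)"

lemma act_simps: "act a (m + n) = act a m + act a n" "act (a + b) m = act a m + act b m"
  "act 1 m = m" "act a 0 = 0" "act 0 m = 0"
  by (auto simp: act_def scale_right_distrib scale_left_distrib l_simps l_0)

lemma act_act: "act a (act b m) = act (a * b) m"
  by (simp add: act_def l_simps)

sublocale K: linear_operators ks
  by unfold_locales (auto simp: ks_def act_simps h_simps act_act)

lemma ks_ks: "ks c (ks d m) = ks (c * d) m"
  by (simp add: ks_def act_act h_simps)

lemma act_hom: "module_hom ks ks (act a)"
  by unfold_locales (auto simp: act_simps ks_def act_act mult.commute)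

lemma k_subspace:
  assumes "subspace N"
  shows "K.subspace N"
  using assms unfolding subspace_def K.subspace_def by (auto simp: ks_def act_def)

lemma act_span_subset:
  assumes "K.subspace U" "\<And>g. g \<in> G \<Longrightarrow> act a g \<in> U"
  shows "act a ` K.span G \<subseteq> U"
proof -
  interpret a: module_hom ks ks "act a" by (rule act_hom)
  have "K.span G \<subseteq> {m. act a m \<in> U}"
    using assms by (intro K.span_minimal) (auto intro!: K.subspaceI
      simp: a.add a.scale a.zero K.subspace_0 K.subspace_add K.subspace_scale)
  then show ?thesis by blast
qed

definition monomial :: "('a \<Rightarrow> nat) \<Rightarrow> 'a" where
  "monomial \<alpha> = (\<Prod>x\<in>X. x ^ \<alpha> x)"

lemma monomial_add: "monomial \<alpha> * monomial \<beta> = monomial (\<lambda>x. \<alpha> x + \<beta> x)"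
  by (simp add: monomial_def power_add prod.distrib)

lemma monomial_power: "monomial \<alpha> ^ n = monomial (\<lambda>x. n * \<alpha> x)"
  by (simp add: monomial_def prod_power_distrib power_mult mult.commute[of n])

lemma monomial_div_mod: "monomial \<alpha> = monomial (\<lambda>x. \<alpha> x div q) ^ q * monomial (\<lambda>x. \<alpha> x mod q)"
  by (simp add: monomial_add monomial_power)

lemma monomial_cong: "(\<And>x. x \<in> X \<Longrightarrow> \<alpha> x = \<beta> x) \<Longrightarrow> monomial \<alpha> = monomial \<beta>"
  by (simp add: monomial_def)

text \<open>The span over the field of the products of elements of \<open>W\<close> with monomials of degree at most \<open>n\<close> in
the generators of \<open>A\<close>. The union over \<open>n\<close> is the \<open>A\<close>-module generated by \<open>W\<close>.\<close>
definition fil :: "'m set \<Rightarrow> nat \<Rightarrow> 'm set" where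
  "fil W n = K.span {act (monomial \<alpha>) w |\<alpha> w. w \<in> W \<and> sum \<alpha> X \<le> n}"

lemma subspace_fil: "K.subspace (fil W n)"
  by (simp add: fil_def)

lemma fil_mono: "m \<le> n \<Longrightarrow> fil W m \<subseteq> fil W n"
  unfolding fil_def by (rule K.span_mono) (blast intro: order_trans)

lemma fil_monomialI: "w \<in> W \<Longrightarrow> sum \<alpha> X \<le> n \<Longrightarrow> act (monomial \<alpha>) w \<in> fil W n"
  unfolding fil_def by (rule K.span_base) auto

lemma fil_base: "W \<subseteq> fil W n"
proof
  fix w assume "w \<in> W"
  then show "w \<in> fil W n" using fil_monomialI[of w W "\<lambda>_. 0" n] by (simp add: monomial_def act_simps)
qed

lemma fil_minimal:
  assumes "K.subspace U" "\<And>\<alpha> w. w \<in> W \<Longrightarrow> sum \<alpha> X \<le> n \<Longrightarrow> act (monomial \<alpha>) w \<in> U"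
  shows "fil W n \<subseteq> U"
  unfolding fil_def using assms by (intro K.span_minimal) auto

lemma monomial_fil: "act (monomial \<beta>) ` fil W n \<subseteq> fil W (n + sum \<beta> X)"
  unfolding fil_def[of W n]
proof (rule act_span_subset[OF subspace_fil])
  fix g assume "g \<in> {act (monomial \<alpha>) w |\<alpha> w. w \<in> W \<and> sum \<alpha> X \<le> n}"
  then obtain \<alpha> w where g: "g = act (monomial \<alpha>) w" "w \<in> W" "sum \<alpha> X \<le> n" by auto
  show "act (monomial \<beta>) g \<in> fil W (n + sum \<beta> X)"
    unfolding g(1) act_act monomial_add
    by (rule fil_monomialI[OF g(2)]) (use g(3) in \<open>simp add: sum.distrib\<close>)
qed

lemma ks_fil: "m \<in> fil W n \<Longrightarrow> act (h c) m \<in> fil W n"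
  using K.subspace_scale[OF subspace_fil] unfolding ks_def by blast

lemma monomial_single:
  assumes "x \<in> X"
  shows "monomial (\<lambda>y. if y = x then 1 else 0) = x" "(\<Sum>y\<in>X. if y = x then 1 else 0) = (1 :: nat)"
proof -
  have "monomial (\<lambda>y. if y = x then 1 else 0) = (\<Prod>y\<in>X. if y = x then x else 1)"
    unfolding monomial_def by (rule prod.cong) auto
  then show "monomial (\<lambda>y. if y = x then 1 else 0) = x" using assms X(1) by simp
  show "(\<Sum>y\<in>X. if y = x then 1 else 0) = (1 :: nat)" using assms X(1) by simp
qed

lemma act_fil: "\<exists>d. \<forall>W n. act a ` fil W n \<subseteq> fil W (n + d)"
proof -
  have "a \<in> generated_subalgebra h X" using X(2) by simp
  then show ?thesis
  proof induction
    case (scalar c)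
    then show ?case using ks_fil by (intro exI[of _ 0]) auto
  next
    case (gen x)
    show ?case
    proof (intro exI[of _ 1] allI)
      fix W n show "act x ` fil W n \<subseteq> fil W (n + 1)"
        using monomial_fil[of "\<lambda>y. if y = x then 1 else 0" W n] by (simp only: monomial_single[OF gen])
    qed
  next
    case (add a b)
    then obtain d e where d: "\<And>W n. act a ` fil W n \<subseteq> fil W (n + d)" and e: "\<And>W n. act b ` fil W n \<subseteq> fil W (n + e)"
      by auto
    have "act (a + b) m \<in> fil W (n + (d + e))" if "m \<in> fil W n" for W n m
      unfolding act_simps using that d[of W n] e[of W n] 
        fil_mono[of "n + d" "n + (d + e)" W] fil_mono[of "n + e" "n + (d + e)" W]
      by (intro K.subspace_add[OF subspace_fil]) auto
    then show ?case by blast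
  next
    case (mult a b)
    then obtain d e where d: "\<And>W n. act a ` fil W n \<subseteq> fil W (n + d)" and e: "\<And>W n. act b ` fil W n \<subseteq> fil W (n + e)"
      by auto
    have "act (a * b) m \<in> fil W (n + (e + d))" if "m \<in> fil W n" for W n m
      unfolding act_act[symmetric] add.assoc[symmetric] using that d e by blast
    then show ?case by blast
  qed
qed

lemma invariant_act:
  assumes "K.invariant (act ` X) J"
  shows "act a ` J \<subseteq> J"
proof -
  have sJ: "K.subspace J" using assms by (simp add: K.invariant_def)
  have "a \<in> generated_subalgebra h X" using X(2) by simp
  then show ?thesis
  proof induction
    case (scalar c)
    then show ?case using K.subspace_scale[OF sJ] by (auto simp: ks_def)
  next
    case (gen x)
    then show ?case using assms by (auto simp: K.invariant_def)
  next
    case (add a b)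
    then show ?case using K.subspace_add[OF sJ] by (auto simp: act_simps image_subset_iff)
  next
    case (mult a b)
    then show ?case by (auto simp: act_act[symmetric] image_subset_iff)
  qed
qed

lemma ex_denominator: "\<exists>s\<in>S. \<exists>n. act s m \<in> fil B n"
proof -
  have "m \<in> span B" using B(2) by simp
  then show ?thesis
  proof (induction rule: span_induct_alt)
    case base
    then show ?case using one_S K.subspace_0[OF subspace_fil] by (auto simp: act_simps)
  next
    case (step r g m)
    obtain s n where s: "s \<in> S" "act s m \<in> fil B n" using step.IH by blast
    obtain a t where t: "t \<in> S" "r * l t = l a" using frac_S by blast
    obtain d where d: "\<And>W n. act (a * s) ` fil W n \<subseteq> fil W (n + d)" using act_fil by blast
    obtain d' where d': "\<And>W n. act t ` fil W n \<subseteq> fil W (n + d')" using act_fil by blast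
    have "act (t * s) (r *s g) = act (a * s) g"
      by (simp add: act_def l_simps ac_simps flip: t(2))
    then have "act (t * s) (r *s g) \<in> fil B (0 + d)" using d[of B 0] fil_base[of B 0] step.hyps by auto
    then have "act (t * s) (r *s g) \<in> fil B (n + d + d')" using fil_mono[of "0 + d" "n + d + d'" B] by auto
    moreover have "act (t * s) m \<in> fil B (n + d')" using d'[of B n] s(2) by (auto simp: act_act[symmetric])
    then have "act (t * s) m \<in> fil B (n + d + d')" using fil_mono[of "n + d'" "n + d + d'" B] by auto
    ultimately have "act (t * s) (r *s g + m) \<in> fil B (n + d + d')"
      unfolding act_simps(1) by (rule K.subspace_add[OF subspace_fil])
    then show ?case using mult_S[OF t(1) s(1)] by blast
  qed
qed

lemma ex_common_denominator: "finite Z \<Longrightarrow> \<exists>s\<in>S. \<exists>n. act s ` Z \<subseteq> fil B n"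
proof (induction rule: finite_induct)
  case empty
  then show ?case using one_S by auto
next
  case (insert z Z)
  obtain s n where s: "s \<in> S" "act s ` Z \<subseteq> fil B n" using insert.IH by blast
  obtain t m where t: "t \<in> S" "act t z \<in> fil B m" using ex_denominator by blast
  obtain d where d: "\<And>W n. act t ` fil W n \<subseteq> fil W (n + d)" using act_fil by blast
  obtain d' where d': "\<And>W n. act s ` fil W n \<subseteq> fil W (n + d')" using act_fil by blast
  have "act (t * s) y \<in> fil B (n + d + (m + d'))" if "y \<in> Z" for y
    using that s(2) d[of B n] fil_mono[of "n + d" "n + d + (m + d')" B] by (auto simp: act_act[symmetric])
  moreover have "act (t * s) z \<in> fil B (n + d + (m + d'))"
    using t(2) d'[of B m] fil_mono[of "m + d'" "n + d + (m + d')" B]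
    by (auto simp: act_act[symmetric] mult.commute[of t s])
  ultimately show ?case using mult_S[OF t(1) s(1)] by blast
qed

lemma unit_cancel:
  assumes "subspace N" "u dvd 1" "u *s m \<in> N"
  shows "m \<in> N"
proof -
  obtain v where "1 = u * v" using assms(2) by (auto elim: dvdE)
  then have "m = v *s (u *s m)" by (simp add: mult.commute)
  then show ?thesis using subspace_scale[OF assms(1,3)] by metis
qed

text \<open>An \<open>R\<close>-submodule is generated by its intersection with the \<open>A\<close>-module generated by \<open>B\<close>, to which
Hilbert's basis theorem applies.\<close>
lemma fin_gen:
  assumes N: "subspace N"
  shows "\<exists>W. finite W \<and> W \<subseteq> N \<and> N \<subseteq> span W"
proof -
  define J where "J = N \<inter> (K.invariant (act ` X) hull B)"
  have inv: "K.invariant (act ` X) (K.invariant (act ` X) hull B)" by (rule K.invariant_hull)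
  have R: "K.invariant (act ` X) N" if "subspace N" for N
    using k_subspace[OF that] subspace_scale[OF that] by (auto simp: K.invariant_def act_def)
  have J: "K.invariant (act ` X) J" using R[OF N] inv 
    by (fastforce simp: J_def K.invariant_def image_subset_iff K.subspace_inter)
  have "\<exists>W. finite W \<and> W \<subseteq> J \<and> J \<subseteq> K.invariant (act ` X) hull W"
    by (rule K.hilbert_basis_commuting_operators[OF _ _ _ B(1) J])
       (use X(1) act_hom in \<open>auto simp: act_act mult.commute J_def\<close>)
  then obtain W where W: "finite W" "W \<subseteq> J" "J \<subseteq> K.invariant (act ` X) hull W" by blast
  have "K.invariant (act ` X) hull W \<subseteq> span W" 
    by (rule hull_minimal) (rule span_superset, rule R[OF subspace_span])
  then have JW: "J \<subseteq> span W" using W(3) by blast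
  have "m \<in> span W" if m: "m \<in> N" for m
  proof -
    obtain s n where s: "s \<in> S" "act s m \<in> fil B n" using ex_denominator by blast
    have "fil B n \<subseteq> K.invariant (act ` X) hull B"
    proof (rule fil_minimal)
      show "K.subspace (K.invariant (act ` X) hull B)" using inv by (simp add: K.invariant_def)
      show "act (monomial \<alpha>) w \<in> K.invariant (act ` X) hull B" if "w \<in> B" for \<alpha> w
        using invariant_act[OF inv] hull_inc[OF that] by blast
    qed
    then have "act s m \<in> span W" using s(2) JW subspace_scale[OF N m] by (auto simp: J_def act_def)
    then show ?thesis unfolding act_def using unit_cancel[OF subspace_span unit_S[OF s(1)]] by blast
  qed
  then show ?thesis using W J_def by blast
qed

lemma fin_gen_bounded:
  assumes N: "subspace N"
  shows "\<exists>W n. W \<subseteq> N \<and> W \<subseteq> fil B n \<and> N \<subseteq> span W"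
proof -
  obtain W where W: "finite W" "W \<subseteq> N" "N \<subseteq> span W" using fin_gen[OF N] by blast
  obtain s n where s: "s \<in> S" "act s ` W \<subseteq> fil B n" using ex_common_denominator[OF W(1)] by blast
  have "act s ` W \<subseteq> N" using W(2) subspace_scale[OF N] by (auto simp: act_def)
  moreover have "W \<subseteq> span (act s ` W)"
  proof
    fix w assume "w \<in> W"
    then have "l s *s w \<in> span (act s ` W)" by (intro span_base) (auto simp: act_def)
    then show "w \<in> span (act s ` W)" by (rule unit_cancel[OF subspace_span unit_S[OF s(1)]])
  qed
  then have "N \<subseteq> span (act s ` W)" using W(3) span_minimal[OF _ subspace_span] by blast
  ultimately show ?thesis using s(2) by blast
qed

lemma finite_fil: "\<exists>G. finite G \<and> fil B n \<subseteq> K.span G"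
proof -
  let ?G = "(\<lambda>(\<alpha>, w). act (monomial \<alpha>) w) ` ((\<Pi>\<^sub>E x\<in>X. {..n}) \<times> B)"
  have "finite ?G" using X(1) B(1) by (intro finite_imageI finite_cartesian_product finite_PiE) auto
  moreover have "fil B n \<subseteq> K.span ?G"
  proof (rule fil_minimal[OF K.subspace_span])
    fix \<alpha> w assume w: "w \<in> B" and \<alpha>: "sum \<alpha> X \<le> n"
    have "\<alpha> x \<le> n" if "x \<in> X" for x using member_le_sum[of x X \<alpha>] that X(1) \<alpha> by simp
    then have "restrict \<alpha> X \<in> (\<Pi>\<^sub>E x\<in>X. {..n})" by auto
    moreover have "monomial \<alpha> = monomial (restrict \<alpha> X)" by (rule monomial_cong) simp
    ultimately show "act (monomial \<alpha>) w \<in> K.span ?G"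
      using w by (intro K.span_base) (auto intro!: image_eqI[of _ _ "(restrict \<alpha> X, w)"])
  qed
  ultimately show ?thesis by blast
qed

lemma \<kappa>_0: "\<kappa> 0 = 0" using \<kappa>_add[of 0 0] by simp

lemma \<kappa>_sum: "\<kappa> (sum g A) = (\<Sum>x\<in>A. \<kappa> (g x))"
  by (induction A rule: infinite_finite_induct) (auto simp: \<kappa>_0 \<kappa>_add)

lemma act_sum: "act a (sum g A) = (\<Sum>x\<in>A. act a (g x))"
  by (induction A rule: infinite_finite_induct) (auto simp: act_simps)

lemma act_h_sum: "act (h (sum g A)) m = (\<Sum>x\<in>A. act (h (g x)) m)"
  by (induction A rule: infinite_finite_induct) (auto simp: act_simps h_simps h_0)

lemma \<kappa>_act: "\<kappa> (act (a ^ p * b) m) = act a (\<kappa> (act b m))"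
  by (simp add: act_def l_simps l_power \<kappa>_frob flip: scale_scale)

text \<open>Writing exponents as \<open>\<alpha> = p \<gamma> + \<beta>\<close> and scalars as \<open>\<Sum> d\<^sub>b\<^sup>p b\<close>, \<open>p\<close>-th powers come out of \<open>\<kappa>\<close> and
leave the finitely many elements \<open>\<kappa>(b x\<^sup>\<beta> g)\<close>, whose common denominator is \<open>s\<close> and whose degree
after multiplication by \<open>s\<close> is at most \<open>C\<close>.\<close>
lemma contraction:
  "\<exists>s\<in>S. \<exists>C. \<forall>n. (\<lambda>m. act s (\<kappa> m)) ` fil B n \<subseteq> fil B (n div p + C)"
proof -
  define Z where "Z = (\<lambda>(b, \<beta>, g). \<kappa> (act (h b * monomial \<beta>) g)) ` (Bk \<times> (\<Pi>\<^sub>E x\<in>X. {..<p}) \<times> B)"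
  have "finite Z" unfolding Z_def using X(1) B(1) Bk(1)
    by (intro finite_imageI finite_cartesian_product finite_PiE) auto
  then obtain s C where s: "s \<in> S" "act s ` Z \<subseteq> fil B C" using ex_common_denominator by blast
  have "act s (\<kappa> m) \<in> fil B (n div p + C)" if m: "m \<in> fil B n" for n m
  proof -
    have sub: "K.subspace {y. \<forall>c. act s (\<kappa> (ks c y)) \<in> fil B (n div p + C)}"
      by (rule K.subspaceI) (auto simp: ks_ks ks_def act_simps \<kappa>_0 \<kappa>_add act_act
          intro: K.subspace_0[OF subspace_fil] K.subspace_add[OF subspace_fil] simp flip: h_simps(3))
    have "fil B n \<subseteq> {y. \<forall>c. act s (\<kappa> (ks c y)) \<in> fil B (n div p + C)}"
    proof (rule fil_minimal[OF sub], intro CollectI allI)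
      fix \<alpha> g c assume g: "g \<in> B" and \<alpha>: "sum \<alpha> X \<le> n"
      define \<beta> where "\<beta> = restrict (\<lambda>x. \<alpha> x mod p) X"
      define \<gamma> where "\<gamma> x = \<alpha> x div p" for x
      have \<beta>: "\<beta> \<in> (\<Pi>\<^sub>E x\<in>X. {..<p})" using p_ge_2 by (auto simp: \<beta>_def)
      have "monomial (\<lambda>x. \<alpha> x mod p) = monomial \<beta>" by (rule monomial_cong) (simp add: \<beta>_def)
      then have \<alpha>_eq: "monomial \<alpha> = monomial \<gamma> ^ p * monomial \<beta>"
        using monomial_div_mod[of \<alpha> p] by (simp add: \<gamma>_def[abs_def])
      have "p * sum \<gamma> X \<le> sum \<alpha> X" unfolding \<gamma>_def sum_distrib_left by (rule sum_mono) simp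
      then have "p * sum \<gamma> X \<le> n" using \<alpha> by simp
      then have \<gamma>: "sum \<gamma> X \<le> n div p" using p_ge_2 by (simp add: less_eq_div_iff_mult_less_eq mult.commute)
      obtain d where d: "c = (\<Sum>b\<in>Bk. d b ^ p * b)" using Bk(2) by blast
      have "act s (\<kappa> (act (h (d b ^ p * b)) (act (monomial \<alpha>) g))) \<in> fil B (n div p + C)" if b: "b \<in> Bk" for b
      proof -
        have "act (h (d b ^ p * b)) (act (monomial \<alpha>) g) = act ((h (d b) * monomial \<gamma>) ^ p * (h b * monomial \<beta>)) g"
          by (simp add: act_act \<alpha>_eq h_simps h_power power_mult_distrib ac_simps)
        then have "act s (\<kappa> (act (h (d b ^ p * b)) (act (monomial \<alpha>) g)))
            = act (h (d b)) (act (monomial \<gamma>) (act s (\<kappa> (act (h b * monomial \<beta>) g))))"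
          by (simp only: \<kappa>_act) (simp add: act_act ac_simps)
        moreover have "\<kappa> (act (h b * monomial \<beta>) g) \<in> Z"
          using b g \<beta> by (auto simp: Z_def intro!: image_eqI[of _ _ "(b, \<beta>, g)"])
        then have "act s (\<kappa> (act (h b * monomial \<beta>) g)) \<in> fil B C" using s(2) by blast
        then have "act (monomial \<gamma>) (act s (\<kappa> (act (h b * monomial \<beta>) g))) \<in> fil B (C + sum \<gamma> X)"
          using monomial_fil[of \<gamma> B C] by blast
        then have "act (monomial \<gamma>) (act s (\<kappa> (act (h b * monomial \<beta>) g))) \<in> fil B (n div p + C)"
          using fil_mono[of "C + sum \<gamma> X" "n div p + C" B] \<gamma> by auto
        ultimately show ?thesis by (simp add: ks_fil)
      qed
      then show "act s (\<kappa> (ks c (act (monomial \<alpha>) g))) \<in> fil B (n div p + C)"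
        unfolding ks_def d act_h_sum \<kappa>_sum act_sum by (intro K.subspace_sum[OF subspace_fil]) auto
    qed
    then have "act s (\<kappa> (ks 1 m)) \<in> fil B (n div p + C)" using m by blast
    then show ?thesis by (simp add: ks_def act_simps h_simps)
  qed
  then show ?thesis using s(1) by blast
qed

text \<open>The constant does not grow with \<open>e\<close>: the errors form a geometric series, bounded by \<open>2 C\<close>
because \<open>p \<ge> 2\<close>.\<close>
lemma contraction_iterate:
  assumes "\<And>n. g ` fil B n \<subseteq> fil B (n div p + C)"
  shows "(g ^^ e) ` fil B n \<subseteq> fil B (n div p ^ e + 2 * C)"
proof (induction e)
  case 0
  then show ?case using fil_mono[of n "n + 2 * C" B] by auto
next
  case (Suc e)
  have "(g ^^ Suc e) ` fil B n \<subseteq> g ` fil B (n div p ^ e + 2 * C)"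
    using Suc by auto
  also have "\<dots> \<subseteq> fil B ((n div p ^ e + 2 * C) div p + C)" by (rule assms)
  also have "\<dots> \<subseteq> fil B (n div p ^ Suc e + 2 * C)"
  proof (rule fil_mono)
    have "2 * C \<le> C * p" using p_ge_2 by simp
    then have "(n div p ^ e + 2 * C) div p \<le> (n div p ^ e + C * p) div p" by (intro div_le_mono) simp
    also have "\<dots> = n div p ^ e div p + C" using p_ge_2 by simp
    also have "n div p ^ e div p = n div p ^ Suc e" by (simp only: power_Suc2 div_mult2_eq)
    finally show "(n div p ^ e + 2 * C) div p + C \<le> n div p ^ Suc e + 2 * C" by simp
  qed
  finally show ?case .
qed

lemma unit_mult: "u dvd 1 \<Longrightarrow> v dvd 1 \<Longrightarrow> u * v dvd (1 :: 'r)"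
  using mult_dvd_mono[of u 1 v 1] by simp

lemma unit_power: "u dvd 1 \<Longrightarrow> u ^ n dvd (1 :: 'r)"
  using dvd_power_same[of u 1 n] by simp

text \<open>Passing from \<open>\<kappa>\<close> to \<open>s \<kappa>\<close> does not change images of submodules, since \<open>s\<close> is a unit of \<open>R\<close> and
units move through \<open>\<kappa>\<close> as powers.\<close>
lemma scaled_\<kappa>_pow:
  assumes s: "s \<in> S"
  shows "\<exists>v. v dvd 1 \<and> (\<forall>m. ((\<lambda>m. act s (\<kappa> m)) ^^ e) m = (\<kappa> ^^ e) (v *s m))"
proof (induction e)
  case 0
  show ?case by (intro exI[of _ 1]) simp
next
  case (Suc e)
  then obtain v where v: "v dvd 1" "\<And>m. ((\<lambda>m. act s (\<kappa> m)) ^^ e) m = (\<kappa> ^^ e) (v *s m)" by blast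
  have "l s ^ p ^ Suc e * v dvd 1"
    by (intro unit_mult unit_power v(1) unit_S[OF s])
  moreover have "((\<lambda>m. act s (\<kappa> m)) ^^ Suc e) m = (\<kappa> ^^ Suc e) ((l s ^ p ^ Suc e * v) *s m)" for m
  proof -
    have "((\<lambda>m. act s (\<kappa> m)) ^^ Suc e) m = act s (\<kappa> ((\<kappa> ^^ e) (v *s m)))" by (simp add: v(2))
    also have "\<dots> = l s *s (\<kappa> ^^ Suc e) (v *s m)" by (simp add: act_def)
    also have "\<dots> = (\<kappa> ^^ Suc e) (l s ^ p ^ Suc e *s (v *s m))" by (rule \<kappa>_pow_frob[symmetric])
    finally show ?thesis by simp
  qed
  ultimately show ?case by blast
qed

lemma act_power_fil:
  assumes "\<And>W n. act a ` fil W n \<subseteq> fil W (n + d)"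
  shows "act (a ^ x) ` fil W n \<subseteq> fil W (n + d * x)"
proof (induction x)
  case 0
  then show ?case by (auto simp: act_simps)
next
  case (Suc x)
  have "act (a ^ Suc x) ` fil W n = act a ` (act (a ^ x) ` fil W n)" by (simp add: image_image act_act)
  also have "\<dots> \<subseteq> act a ` fil W (n + d * x)" using Suc by auto
  also have "\<dots> \<subseteq> fil W (n + d * x + d)" by (rule assms)
  finally show ?case by (simp add: algebra_simps)
qed

text \<open>Let \<open>N\<close> be generated by \<open>W\<close> of degree at most \<open>n0\<close>. Taking \<open>q\<close>-th powers out of \<open>\<kappa>\<^sup>e\<close>, \<open>q = p\<^sup>e\<close>, the
module \<open>\<kappa>\<^sup>e f\<^sup>x N\<close> is generated by the images of \<open>c x\<^sup>\<beta> w\<close> with \<open>w \<in> W\<close>, scalars \<open>c\<close>, and all exponents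
in \<open>\<beta>\<close> below \<open>q\<close>. Before \<open>\<kappa>\<^sup>e\<close> is applied, the degree is at most
\<open>n0 + |X| q + d0 b q\<close>, where \<open>d0\<close> bounds the degree of a numerator of \<open>f\<close>; division by \<open>q > n0\<close> leaves a bound that
does not depend on \<open>N\<close>.\<close>
theorem gauge_bound:
  "\<exists>D. \<forall>b N. subspace N \<longrightarrow> (\<exists>e0. \<forall>e\<ge>e0. \<forall>x \<le> b * p ^ e.
     twist e x ` N \<subseteq> span (twist e x ` N \<inter> fil B (D b)))"
proof -
  obtain s C where s: "s \<in> S" and C: "\<And>n. (\<lambda>m. act s (\<kappa> m)) ` fil B n \<subseteq> fil B (n div p + C)"
    using contraction by blast
  obtain f0 t where t: "t \<in> S" "f * l t = l f0" using frac_S by blast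
  obtain d0 where d0: "\<And>W n. act f0 ` fil W n \<subseteq> fil W (n + d0)" using act_fil by blast
  define D where "D b = card X + d0 * b + 2 * C" for b
  have "\<exists>e0. \<forall>e\<ge>e0. \<forall>x \<le> b * p ^ e. twist e x ` N \<subseteq> span (twist e x ` N \<inter> fil B (D b))"
    if N: "subspace N" for b N
  proof -
    obtain W n0 where W: "W \<subseteq> N" "W \<subseteq> fil B n0" "N \<subseteq> span W" using fin_gen_bounded[OF N] by blast
    have "twist e x ` N \<subseteq> span (twist e x ` N \<inter> fil B (D b))" if e: "e \<ge> n0" and x: "x \<le> b * p ^ e" for e x
    proof -
      let ?I = "twist e x ` N"
      define U where "U = span (?I \<inter> fil B (D b))"
      have sU: "subspace U" by (simp add: U_def)
      define q where "q = p ^ e"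
      have q: "n0 < q" "q > 0"
        using e p_ge_2 unfolding q_def by (metis Suc_1 less_exp order_le_less_trans order_less_le_trans power_mono zero_le)+
      obtain v where v: "v dvd 1" "\<And>m. ((\<lambda>m. act s (\<kappa> m)) ^^ e) m = (\<kappa> ^^ e) (v *s m)"
        using scaled_\<kappa>_pow[OF s] by blast
      define G where "G y = ((\<lambda>m. act s (\<kappa> m)) ^^ e) (act (f0 ^ x) y)" for y
      define u where "u = v * l t ^ x"
      have u: "u dvd 1" unfolding u_def by (intro unit_mult unit_power v(1) unit_S[OF t(1)])
      have G: "G y = twist e x (u *s y)" for y
        unfolding G_def v(2)
        by (simp add: act_def twist_def u_def l_power power_mult_distrib ac_simps flip: t(2))
      have G_add: "G (y + z) = G y + G z" for y z by (simp add: G scale_right_distrib twist_add)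
      have G_0: "G 0 = 0" by (simp add: G twist_zero)
      have G_frob: "G (r ^ q *s y) = r *s G y" for r y
        by (simp add: G twist_frob q_def ac_simps)
      \<comment> \<open>The exponents below \<open>q\<close> contribute \<open>|X|\<close> to the degree after division by \<open>q\<close>.\<close>
      have claim1: "G (act (h c * monomial \<beta>) w) \<in> U" if w: "w \<in> W" and \<beta>: "\<And>y. y \<in> X \<Longrightarrow> \<beta> y < q" for c \<beta> w
      proof -
        have "G (act (h c * monomial \<beta>) w) \<in> ?I"
          unfolding G act_def using W(1) w by (intro imageI subspace_scale[OF N]) auto
        moreover have "G (act (h c * monomial \<beta>) w) \<in> fil B (D b)"
        proof -
          have "act (monomial \<beta>) w \<in> fil B (n0 + sum \<beta> X)" using monomial_fil[of \<beta> B n0] W(2) w by blast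
          then have "act (h c * monomial \<beta>) w \<in> fil B (n0 + sum \<beta> X)"
            using ks_fil by (simp add: act_act[symmetric])
          then have "act (f0 ^ x) (act (h c * monomial \<beta>) w) \<in> fil B (n0 + sum \<beta> X + d0 * x)"
            using act_power_fil[of f0 d0, OF d0] by blast
          then have "G (act (h c * monomial \<beta>) w) \<in> fil B ((n0 + sum \<beta> X + d0 * x) div p ^ e + 2 * C)"
            unfolding G_def using contraction_iterate[OF C, of e] by blast
          moreover have "(n0 + sum \<beta> X + d0 * x) div p ^ e + 2 * C \<le> D b"
          proof -
            have "sum \<beta> X \<le> card X * q" using sum_bounded_above[of X \<beta> q] \<beta> by (simp add: order_less_imp_le)
            moreover have "d0 * x \<le> d0 * (b * q)" using x unfolding q_def by (rule mult_le_mono2)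
            ultimately have "n0 + sum \<beta> X + d0 * x \<le> n0 + (card X + d0 * b) * q"
              by (simp only: add_mult_distrib mult.assoc)
            then have "(n0 + sum \<beta> X + d0 * x) div q \<le> (n0 + (card X + d0 * b) * q) div q" by (rule div_le_mono)
            also have "\<dots> = card X + d0 * b" using q by simp
            finally show ?thesis by (simp add: D_def q_def)
          qed
          ultimately show ?thesis using fil_mono by blast
        qed
        ultimately show ?thesis by (simp add: U_def span_base)
      qed
      \<comment> \<open>Large exponents reduce to small ones by taking \<open>q\<close>-th powers of monomials out of \<open>\<kappa>\<^sup>e\<close>.\<close>
      have claim2: "G (act a w) \<in> U" if w: "w \<in> W" for a w
      proof -
        obtain d where d: "\<And>W n. act a ` fil W n \<subseteq> fil W (n + d)" using act_fil by blast
        have aw: "act a w \<in> fil W d" using d[of W 0] fil_base[of W 0] w by auto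
        have sub: "K.subspace {y. \<forall>c. G (ks c y) \<in> U}"
          by (rule K.subspaceI) (auto simp: ks_ks, auto simp: ks_def act_simps G_0 G_add
              intro: subspace_0[OF sU] subspace_add[OF sU])
        have "fil W d \<subseteq> {y. \<forall>c. G (ks c y) \<in> U}"
        proof (rule fil_minimal[OF sub], intro CollectI allI)
          fix \<alpha> g c assume g: "g \<in> W"
          have "ks c (act (monomial \<alpha>) g) = l (monomial (\<lambda>x. \<alpha> x div q)) ^ q *s act (h c * monomial (\<lambda>x. \<alpha> x mod q)) g"
            by (subst monomial_div_mod[of \<alpha> q]) (simp add: ks_def act_def l_simps l_power ac_simps)
          then have "G (ks c (act (monomial \<alpha>) g)) = l (monomial (\<lambda>x. \<alpha> x div q)) *s G (act (h c * monomial (\<lambda>x. \<alpha> x mod q)) g)"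
            by (simp only: G_frob)
          also have "\<dots> \<in> U" by (rule subspace_scale[OF sU claim1[OF g]]) (use q in simp)
          finally show "G (ks c (act (monomial \<alpha>) g)) \<in> U" .
        qed
        then have "G (ks 1 (act a w)) \<in> U" using aw by blast
        then show ?thesis by (simp add: ks_def act_simps h_simps)
      qed
      \<comment> \<open>A denominator \<open>s'\<close> is cleared by moving \<open>l s'\<close> through \<open>G\<close> as its \<open>q\<close>-th power.\<close>
      have "subspace {y. \<forall>r. G (r *s y) \<in> U}"
        by (rule subspaceI) (auto simp: G_0 G_add scale_right_distrib intro: subspace_0[OF sU] subspace_add[OF sU])
      moreover have "G (r *s w) \<in> U" if w: "w \<in> W" for r w
      proof -
        obtain a s' where s': "s' \<in> S" "r * l s' = l a" using frac_S by blast
        have "l s' *s G (r *s w) = G ((l s' ^ (q - 1) * (r * l s')) *s w)"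
          using q by (simp add: ac_simps flip: G_frob power_Suc)
        also have "\<dots> = G (act (s' ^ (q - 1) * a) w)" by (simp add: act_def l_simps l_power s'(2))
        finally have "l s' *s G (r *s w) \<in> U" using claim2[OF w] by simp
        then show ?thesis by (rule unit_cancel[OF sU unit_S[OF s'(1)]])
      qed
      ultimately have claim3: "span W \<subseteq> {y. \<forall>r. G (r *s y) \<in> U}" by (intro span_minimal) auto
      show ?thesis
      proof
        fix z assume "z \<in> twist e x ` N"
        then obtain n where n: "n \<in> N" "z = twist e x n" by blast
        obtain u' where "1 = u * u'" using u by (auto elim: dvdE)
        then have "z = G (u' *s n)" by (simp add: n(2) G)
        then show "z \<in> span (?I \<inter> fil B (D b))" using claim3 W(3) n(1) U_def by blast
      qed
    qed
    then show ?thesis by blast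
  qed
  then show ?thesis by blast
qed

lemma gauged:
  obtains V where "gauged_cartier_pair scale p \<kappa> f ks V"
proof -
  obtain D where "\<forall>b N. subspace N \<longrightarrow> (\<exists>e0. \<forall>e\<ge>e0. \<forall>x \<le> b * p ^ e.
     twist e x ` N \<subseteq> span (twist e x ` N \<inter> fil B (D b)))" using gauge_bound ..
  then have "gauged_cartier_pair scale p \<kappa> f ks (\<lambda>b. fil B (D b))"
    by unfold_locales (auto simp: fin_gen k_subspace subspace_fil finite_fil)
  then show ?thesis by (rule that)
qed

end

section \<open>Nilpotence on the associated graded\<close>

text \<open>If \<open>\<lambda> = u / v\<close> in lowest terms and \<open>a v = u (p\<^sup>e - 1)\<close>, then \<open>p\<close> dividing \<open>v\<close> would divide \<open>u\<close>.\<close>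
lemma denominator_dvd:
  fixes lam :: rat and p a e :: nat
  assumes "int p dvd snd (quotient_of lam)" "e \<ge> 1" "of_nat a = lam * (of_nat (p ^ e) - 1)"
  shows "p = 1"
proof -
  obtain u v where uv: "quotient_of lam = (u, v)" by fastforce
  have v: "v > 0" using quotient_of_denom_pos[OF uv] .
  have "lam = of_int u / of_int v" by (rule quotient_of_div[OF uv])
  then have "lam * of_int v = of_int u" using v by simp
  then have "of_nat a * of_int v = (of_int u * (of_nat (p ^ e) - 1) :: rat)"
    using assms(3) by (simp add: mult.commute mult.left_commute)
  then have "of_int (int a * v) = (of_int (u * (int (p ^ e) - 1)) :: rat)" by simp
  then have "int a * v = u * (int (p ^ e) - 1)" by (simp only: of_int_eq_iff)
  then have "u = u * int (p ^ e) - int a * v" by (simp add: algebra_simps)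
  moreover have "int p dvd int (p ^ e)" using assms(2) by simp
  moreover have "int p dvd v" using assms(1) uv by simp
  ultimately have "int p dvd u" by (metis dvd_diff dvd_mult)
  then have "int p dvd gcd u v" using \<open>int p dvd v\<close> by simp
  then show ?thesis using quotient_of_coprime[OF uv] by simp
qed

theorem theorem2p3:
  fixes p :: nat
    and h :: "'k::field \<Rightarrow> 'a::comm_ring_1"
    and S :: "'a set"
    and l :: "'a \<Rightarrow> 'r::comm_ring_1"
    and scale :: "'r \<Rightarrow> 'm::ab_group_add \<Rightarrow> 'm"
    and \<kappa> :: "'m \<Rightarrow> 'm"
    and f :: 'r
    and lam :: rat
  assumes "p > 0" and "CHAR('k) = p"
    and "F_finite TYPE('k)"
    and "finite_type_algebra h"
    and "is_localization S l"
    and "cartier_module p scale \<kappa>"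
    and "F_jumping_number p scale \<kappa> f lam"
  shows "(\<forall>e a :: nat. e \<ge> 1 \<longrightarrow> int a \<ge> \<lceil>lam * (of_nat (p ^ e) - 1)\<rceil> \<longrightarrow>
            (\<not> Gr_nilpotent p scale \<kappa> f lam e a \<longleftrightarrow> of_nat a = lam * (of_nat (p ^ e) - 1)))
       \<and> (int p dvd snd (quotient_of lam) \<longrightarrow>
            (\<forall>e a :: nat. e \<ge> 1 \<longrightarrow> int a \<ge> \<lceil>lam * (of_nat (p ^ e) - 1)\<rceil> \<longrightarrow>
               Gr_nilpotent p scale \<kappa> f lam e a))"
proof -
  have p: "p \<ge> 2" using assms(1,2) CHAR_not_1[where 'a = 'k] by linarith
  have \<kappa>: "module scale" "module_hom (frob_scale p 1 scale) scale \<kappa>"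
    using assms(6) by (auto simp: cartier_module_def fin_gen_module_def)
  interpret cartier_pair scale p \<kappa> f
    using \<kappa>(1) p module_hom.add[OF \<kappa>(2)] module_hom.scale[OF \<kappa>(2)]
    by (simp add: cartier_pair_def cartier_pair_axioms_def frob_scale_def)
  obtain B where B: "finite B" "span B = UNIV"
    using assms(6) by (auto simp: cartier_module_def fin_gen_module_def)
  obtain X where X: "finite X" "generated_subalgebra h X = UNIV" and h: "ring_hom_on_type h"
    using assms(4) by (auto simp: finite_type_algebra_def)
  have F: "module (frob_scale p 1 ((*) :: 'k \<Rightarrow> 'k \<Rightarrow> 'k))"
    and "\<exists>Bk. finite Bk \<and> module.span (frob_scale p 1 ((*) :: 'k \<Rightarrow> 'k \<Rightarrow> 'k)) Bk = UNIV"
    using assms(2,3) by (auto simp: F_finite_def fin_gen_module_def)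
  then obtain Bk :: "'k set" where Bk: "finite Bk" "module.span (frob_scale p 1 (*)) Bk = UNIV" by blast
  have "\<exists>d. c = (\<Sum>b\<in>Bk. d b ^ p * b)" for c
    using module.span_finite[OF F Bk(1)] Bk(2) by (auto simp: frob_scale_def)
  then interpret cartier_presentation scale p \<kappa> f h S l X B Bk
    by unfold_locales (use h X B Bk(1) assms(5) in auto)
  obtain V where "gauged_cartier_pair scale p \<kappa> f ks V" by (rule gauged)
  then interpret G: gauged_cartier_pair scale p \<kappa> f ks V .
  have *: "Gr_nilpotent p scale \<kappa> f lam e a \<longleftrightarrow> of_nat a \<noteq> lam * (of_nat (p ^ e) - 1)"
    if "e \<ge> 1" "int a \<ge> \<lceil>lam * (of_nat (p ^ e) - 1)\<rceil>" for e a
    by (rule G.Gr_nilpotent_iff[OF assms(7) that(1)]) (use that(2) in linarith)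
  then show ?thesis using denominator_dvd[of p lam] p by fastforce
qed

end
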